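(* Let $(\Omega,\mathcal F,\mathcal F_t,X_t,P^x)$, $x\in\mathcal X$, be $\mathcal X$-valued càdlàg Markov processes with invariant ergodic probability measure $\mu_*$ and $L^2(\mu_* )$-generator $(A,D(A))$ (as in the context), and let $\mu$ be an initial distribution. Let $\langle\cdot,\cdot\rangle_\#$ be an inner product on $L^2(\mu_* )$, with induced norm $\|\cdot\|_\#$, such that: 1. there exist $0<c\le C<\infty$ such that $c\|g\|\le\|g\|_\#\le C\|g\|$ for all $g\in L^2(\mu_* )$; 2. $\langle g,1\rangle_\#=\langle g,1\rangle$ for all $g\in L^2(\mu_* )$; 3. there is $\alpha>0$ such that $\|g\|_\#^2\le\alpha\langle -Ag,g\rangle_\#$ for all $g\in D(A)$ with $\mu_*[g]=0$. For bounded measurable $f:\mathcal X\to\mathbb R$ let $\widehat f=f-\mu_*[f]$, let $M_{\pm\widehat f}$ denote the operator of multiplication by $\pm\widehat f$ on $L^2(\mu_* )$, and let $M_{\pm\widehat f}^\dagger$ be its adjoint with respect to $\langle\cdot,\cdot\rangle_\#$. Then for all $T>0$ and $r\ge0$, and for each choice of sign, $$P^\mu\left(\pm\left[\frac1T\int_0^T f(X_t)\,dt-\mu_*[f]\right]\ge r\right)\ \le\ c^{-1}\left\|\frac{d\mu}{d\mu_*}\right\|\,e^{-T\,\Psi^*_{v_\pm,b_\pm}(r)},$$ where $$v_\pm=2\alpha\left\|\tfrac12\left(M_{\pm\widehat f}+M_{\pm\widehat f}^\dagger\right)1\right\|_\#^2,\qquad b_\pm=\alpha\max\left\{0,\ \sup_{\|g\|_\#=1}\langle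 M_{\pm\widehat f}\,g,g\rangle_\#\right\}.$$
   Context: $\mathcal X$ is a Polish space; the processes are time-homogeneous, with $X_0=x$ $P^x$-a.s.; $P^\mu=\int P^x\,d\mu(x)$. $\mu_*$ is an invariant ergodic probability measure on $\mathcal X$, $\langle\cdot,\cdot\rangle$ and $\|\cdot\|$ are the scalar product and norm of the real Hilbert space $L^2(\mu_* )$, $\mu_*[f]=\int f\,d\mu_*$, and $(A,D(A))$ is the generator of the strongly continuous semigroup $T_t[g](x)=E^x[g(X_t)]$ on $L^2(\mu_* )$. The initial distribution $\mu$ is absolutely continuous with respect to $\mu_*$ with $\left\|\frac{d\mu}{d\mu_*}\right\|<\infty$. For $v,b\ge0$ set $\Psi_{v,b}(\lambda)=\frac{\lambda^2v}{2(1-\lambda b)}$ for $0\le\lambda<1/b$ (with $1/b=\infty$ if $b=0$), and for $r\ge0$ $$\Psi^*_{v,b}(r)=\sup_{0\le\lambda<1/b}\{\lambda r-\Psi_{v,b}(\lambda)\},$$ which for $v>0$ equals $\frac{2r^2}{v\left(1+\sqrt{1+2br/v}\right)^2}$. *)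

theory Defs
  imports "HOL-Probability.Probability"
begin

section \<open>Cadlag Markov processes\<close>

text \<open>Time is \<open>[0, \<infinity>)\<close>; the values of \<open>F\<close> and \<open>X\<close> at negative times are irrelevant. Only the
  \<open>\<sigma>\<close>-algebra of \<open>Om\<close> matters, not its measure.\<close>

locale cadlag_markov_process =
  fixes Om :: "'w measure"
    and F :: "real \<Rightarrow> 'w measure"
    and X :: "real \<Rightarrow> 'w \<Rightarrow> 'x::polish_space"
    and P :: "'x \<Rightarrow> 'w measure"
  assumes filtration_sub: "\<And>t. 0 \<le> t \<Longrightarrow> subalgebra Om (F t)"
    and filtration_mono: "\<And>s t. 0 \<le> s \<Longrightarrow> s \<le> t \<Longrightarrow> sets (F s) \<subseteq> sets (F t)"
    and adapted: "\<And>t. 0 \<le> t \<Longrightarrow> X t \<in> F t \<rightarrow>\<^sub>M borel"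
    and right_cont: "\<And>\<omega> t. \<omega> \<in> space Om \<Longrightarrow> 0 \<le> t \<Longrightarrow>
          ((\<lambda>s. X s \<omega>) \<longlongrightarrow> X t \<omega>) (at_right t)"
    and left_limits: "\<And>\<omega> t. \<omega> \<in> space Om \<Longrightarrow> 0 < t \<Longrightarrow>
          \<exists>l. ((\<lambda>s. X s \<omega>) \<longlongrightarrow> l) (at_left t)"
    and kernel: "P \<in> borel \<rightarrow>\<^sub>M prob_algebra Om"
    and start: "\<And>x. AE \<omega> in P x. X 0 \<omega> = x"
    and markov: "\<And>x s t B. 0 \<le> s \<Longrightarrow> 0 \<le> t \<Longrightarrow> B \<in> sets borel \<Longrightarrow>
          AE \<omega> in P x. real_cond_exp (P x) (F s) (\<lambda>\<omega>'. indicator B (X (s + t) \<omega>')) \<omega>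
                       = measure (P (X s \<omega>)) {\<omega>' \<in> space Om. X t \<omega>' \<in> B}"

text \<open>\<open>mu \<bind> P\<close> is the mixture \<open>P\<^sup>\<mu> = \<integral> P\<^sup>x d\<mu>(x)\<close>.\<close>

definition invariant_measure ::
  "(real \<Rightarrow> 'w \<Rightarrow> 'x::polish_space) \<Rightarrow> ('x \<Rightarrow> 'w measure) \<Rightarrow> 'x measure \<Rightarrow> bool" where
  "invariant_measure X P mu \<longleftrightarrow>
     prob_space mu \<and> sets mu = sets borel \<and> (\<forall>t\<ge>0. distr (mu \<bind> P) borel (X t) = mu)"

definition markov_semigroup ::
  "(real \<Rightarrow> 'w \<Rightarrow> 'x) \<Rightarrow> ('x \<Rightarrow> 'w measure) \<Rightarrow> real \<Rightarrow> ('x \<Rightarrow> real) \<Rightarrow> 'x \<Rightarrow> real" where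
  "markov_semigroup X P t g x = (\<integral>\<omega>. g (X t \<omega>) \<partial>P x)"

definition ergodic_measure ::
  "(real \<Rightarrow> 'w \<Rightarrow> 'x::polish_space) \<Rightarrow> ('x \<Rightarrow> 'w measure) \<Rightarrow> 'x measure \<Rightarrow> bool" where
  "ergodic_measure X P mu \<longleftrightarrow>
     (\<forall>B\<in>sets borel. (\<forall>t\<ge>0. AE x in mu. markov_semigroup X P t (indicator B) x = indicator B x)
        \<longrightarrow> measure mu B = 0 \<or> measure mu B = 1)"

section \<open>The space \<open>L\<^sup>2\<close>\<close>

text \<open>Elements of \<open>L\<^sup>2(M)\<close> are represented by square-integrable functions; equality in
  \<open>L\<^sup>2(M)\<close> is equality almost everywhere.\<close>

definition l2 :: "'x measure \<Rightarrow> ('x \<Rightarrow> real) set" where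
  "l2 M = {g \<in> borel_measurable M. integrable M (\<lambda>x. (g x)\<^sup>2)}"

definition l2_inner :: "'x measure \<Rightarrow> ('x \<Rightarrow> real) \<Rightarrow> ('x \<Rightarrow> real) \<Rightarrow> real" where
  "l2_inner M g h = (\<integral>x. g x * h x \<partial>M)"

definition l2_norm :: "'x measure \<Rightarrow> ('x \<Rightarrow> real) \<Rightarrow> real" where
  "l2_norm M g = sqrt (l2_inner M g g)"

text \<open>An arbitrary inner product on \<open>L\<^sup>2(M)\<close>; the first clause says that it is well defined on
  classes modulo almost everywhere equality.\<close>

definition inner_product_on_l2 ::
  "'x measure \<Rightarrow> (('x \<Rightarrow> real) \<Rightarrow> ('x \<Rightarrow> real) \<Rightarrow> real) \<Rightarrow> bool" where
  "inner_product_on_l2 M ip \<longleftrightarrow>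
     (\<forall>g\<in>l2 M. \<forall>g'\<in>l2 M. \<forall>h\<in>l2 M. (AE x in M. g x = g' x) \<longrightarrow> ip g h = ip g' h) \<and>
     (\<forall>g\<in>l2 M. \<forall>h\<in>l2 M. ip g h = ip h g) \<and>
     (\<forall>g\<in>l2 M. \<forall>g'\<in>l2 M. \<forall>h\<in>l2 M. ip (\<lambda>x. g x + g' x) h = ip g h + ip g' h) \<and>
     (\<forall>a. \<forall>g\<in>l2 M. \<forall>h\<in>l2 M. ip (\<lambda>x. a * g x) h = a * ip g h) \<and>
     (\<forall>g\<in>l2 M. 0 \<le> ip g g) \<and>
     (\<forall>g\<in>l2 M. ip g g = 0 \<longrightarrow> (AE x in M. g x = 0))"

definition ip_norm :: "(('x \<Rightarrow> real) \<Rightarrow> ('x \<Rightarrow> real) \<Rightarrow> real) \<Rightarrow> ('x \<Rightarrow> real) \<Rightarrow> real" where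
  "ip_norm ip g = sqrt (ip g g)"

definition mult_op :: "('x \<Rightarrow> real) \<Rightarrow> ('x \<Rightarrow> real) \<Rightarrow> 'x \<Rightarrow> real" where
  "mult_op \<phi> g = (\<lambda>x. \<phi> x * g x)"

text \<open>\<open>K'\<close> is the adjoint of the everywhere defined operator \<open>K\<close> on \<open>L\<^sup>2(M)\<close> with respect to
  \<open>ip\<close>. It is unique modulo almost everywhere equality, and for bounded \<open>K\<close> and \<open>ip\<close> equivalent to
  the standard inner product it exists by the Riesz representation theorem.\<close>

definition is_adjoint ::
  "'x measure \<Rightarrow> (('x \<Rightarrow> real) \<Rightarrow> ('x \<Rightarrow> real) \<Rightarrow> real) \<Rightarrow>
   (('x \<Rightarrow> real) \<Rightarrow> 'x \<Rightarrow> real) \<Rightarrow> (('x \<Rightarrow> real) \<Rightarrow> 'x \<Rightarrow> real) \<Rightarrow> bool" where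
  "is_adjoint M ip K K' \<longleftrightarrow>
     (\<forall>h\<in>l2 M. K' h \<in> l2 M \<and> (\<forall>g\<in>l2 M. ip (K g) h = ip g (K' h)))"

section \<open>Generator\<close>

text \<open>Strong continuity of the semigroup on \<open>L\<^sup>2\<close> of an invariant measure is a consequence of
  right-continuity of the paths, and is therefore not required separately.\<close>

definition is_generator_value ::
  "'x measure \<Rightarrow> (real \<Rightarrow> ('x \<Rightarrow> real) \<Rightarrow> 'x \<Rightarrow> real) \<Rightarrow> ('x \<Rightarrow> real) \<Rightarrow> ('x \<Rightarrow> real) \<Rightarrow> bool" where
  "is_generator_value M S g h \<longleftrightarrow> h \<in> l2 M \<and>
     ((\<lambda>t. l2_norm M (\<lambda>x. (S t g x - g x) / t - h x)) \<longlongrightarrow> 0) (at_right 0)"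

definition generator_dom ::
  "'x measure \<Rightarrow> (real \<Rightarrow> ('x \<Rightarrow> real) \<Rightarrow> 'x \<Rightarrow> real) \<Rightarrow> ('x \<Rightarrow> real) set" where
  "generator_dom M S = {g \<in> l2 M. \<exists>h. is_generator_value M S g h}"

text \<open>The limit is unique only modulo almost everywhere equality; a representative is chosen.\<close>

definition generator ::
  "'x measure \<Rightarrow> (real \<Rightarrow> ('x \<Rightarrow> real) \<Rightarrow> 'x \<Rightarrow> real) \<Rightarrow> ('x \<Rightarrow> real) \<Rightarrow> 'x \<Rightarrow> real" where
  "generator M S g = (SOME h. is_generator_value M S g h)"

section \<open>The rate function\<close>

definition Psi :: "real \<Rightarrow> real \<Rightarrow> real \<Rightarrow> real" where
  "Psi v b l = l\<^sup>2 * v / (2 * (1 - l * b))"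

text \<open>The supremum is extended-real valued, since it is \<open>\<infinity>\<close> for \<open>v = b = 0\<close> and \<open>r > 0\<close>.\<close>

definition Psi_star :: "real \<Rightarrow> real \<Rightarrow> real \<Rightarrow> ereal" where
  "Psi_star v b r = (SUP l\<in>{l. 0 \<le> l \<and> (b = 0 \<or> l < 1 / b)}. ereal (l * r - Psi v b l))"

fun exp_ereal :: "ereal \<Rightarrow> ennreal" where
  "exp_ereal (ereal y) = ennreal (exp y)"
| "exp_ereal PInfty = \<infinity>"
| "exp_ereal MInfty = 0"

text \<open>The density is finite almost everywhere, so passing to real values does not change it in
  \<open>L\<^sup>2\<close>.\<close>

definition real_density :: "'x measure \<Rightarrow> 'x measure \<Rightarrow> 'x \<Rightarrow> real" where
  "real_density M N x = enn2real (RN_deriv M N x)"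

end

theory Submission
  imports Defs
begin

text \<open>
  Let \<open>V = \<plusminus>(f - \<mu>\<^sub>*[f])\<close>. By the exponential Markov inequality, applied for every admissible \<open>\<lambda>\<close>, the
  tail probability is at most \<open>exp (- \<lambda> T r)\<close> times the integral against \<open>\<mu>\<close> of the Feynman-Kac function
  \<open>u\<^sub>t(x) = E\<^sup>x[exp (\<lambda> \<integral>\<^sub>0\<^sup>t V(X\<^sub>s) ds)]\<close> at time \<open>T\<close>. That integral is at most the product of the \<open>L\<^sup>2\<close>-norms
  of the density and of \<open>u\<^sub>T\<close>, and \<open>\<parallel>u\<^sub>T\<parallel> \<le> \<parallel>u\<^sub>T\<parallel>\<^sub># / c\<close>. So everything rests on the bound
  \<open>\<parallel>u\<^sub>T\<parallel>\<^sub># \<le> exp (T \<Psi>(\<lambda>))\<close>, after which the supremum over \<open>\<lambda>\<close> gives the Legendre transform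
  (\<open>le_exp_neg_SUP\<close>).

  In \<open>L\<^sup>2(\<mu>\<^sub>*)\<close> the function \<open>u\<close> solves \<open>u' = (A + \<lambda> V) u\<close> with \<open>u\<^sub>0 = 1\<close>. Hence
  \<open>d/dt \<parallel>u\<parallel>\<^sub>#\<^sup>2 = 2 \<langle>(A + \<lambda> V) u, u\<rangle>\<^sub>#\<close>, and it suffices to bound this quadratic form by
  \<open>\<Psi>(\<lambda>) \<parallel>u\<parallel>\<^sub>#\<^sup>2\<close> (\<open>perturbed_form_le\<close>). Split \<open>u = a + h\<close> with \<open>a\<close> the mean of \<open>u\<close>. Since \<open>\<langle>g, 1\<rangle>\<^sub># = \<mu>\<^sub>*[g]\<close>,
  the two parts are \<open>#\<close>-orthogonal and \<open>A u = A h\<close> is \<open>#\<close>-orthogonal to constants, so that the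
  Poincare inequality yields \<open>\<langle>A u, u\<rangle>\<^sub># \<le> - \<parallel>h\<parallel>\<^sub>#\<^sup>2 / \<alpha>\<close>. In \<open>\<langle>V u, u\<rangle>\<^sub>#\<close> the term \<open>a\<^sup>2 \<langle>V, 1\<rangle>\<^sub>#\<close> vanishes, the
  cross term is \<open>2 a \<langle>(V + V\<^sup>\<dagger>) 1 / 2, h\<rangle>\<^sub>#\<close>, and the remaining term is at most \<open>b \<parallel>h\<parallel>\<^sub>#\<^sup>2 / \<alpha>\<close>. Maximising over
  \<open>\<parallel>h\<parallel>\<^sub>#\<close> leaves exactly \<open>\<Psi>(\<lambda>) a\<^sup>2\<close>.

  The analytic work is to justify the evolution equation without the theory of perturbed
  semigroups, for a merely bounded measurable \<open>V\<close> and from the Markov property at single times.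
  Only right derivatives are used, because right continuity of paths gives those directly,
  and \<open>energy_growth\<close> integrates them. The increment \<open>u\<^sub>t\<^sub>+\<^sub>h - u\<^sub>t\<close> is read off from the paths near time \<open>t\<close>, and
  \<open>T\<^sub>h u\<^sub>t - u\<^sub>t\<close> from the paths near times \<open>0\<close> and \<open>t\<close>, once \<open>T\<^sub>h u\<^sub>t\<close> is recognised as the expectation of the
  exponential over the shifted interval (\<open>feynman_kac_markov\<close>). In both cases the error is controlled by
  \<open>V(X\<^sub>s) \<rightarrow> V(X\<^sub>t)\<close> in mean as \<open>s\<close> decreases to \<open>t\<close> (\<open>l1_right_cont\<close>), which for a discontinuous \<open>V\<close> comes
  from stationarity.
\<close>

section \<open>Elementary real analysis\<close>

lemma abs_exp_minus_one_le: "\<bar>exp d - 1\<bar> \<le> \<bar>d\<bar> * exp \<bar>d\<bar>" for d :: real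
proof (cases "0 \<le> d")
  case True
  have "1 - d \<le> exp (-d)" using exp_ge_add_one_self[of "-d"] by simp
  hence "(1 - d) * exp d \<le> exp (-d) * exp d" by (intro mult_right_mono) auto
  thus ?thesis using True by (simp add: exp_minus algebra_simps)
next
  case False
  have "1 + d \<le> exp d" by (rule exp_ge_add_one_self)
  moreover have "exp d < 1" using False by simp
  ultimately have "\<bar>exp d - 1\<bar> \<le> \<bar>d\<bar> * 1" using False by linarith
  also have "\<dots> \<le> \<bar>d\<bar> * exp \<bar>d\<bar>" by (intro mult_left_mono) auto
  finally show ?thesis .
qed

lemma abs_exp_minus_affine_le: "\<bar>exp d - 1 - d\<bar> \<le> d\<^sup>2 * exp \<bar>d\<bar>" for d :: real
proof (cases "0 \<le> d")
  case True
  have "exp d - 1 - d \<le> d * exp d - d"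
    using abs_exp_minus_one_le[of d] True by simp
  also have "\<dots> = d * (exp d - 1)" by (simp add: algebra_simps)
  also have "\<dots> \<le> d * (d * exp d)"
    using abs_exp_minus_one_le[of d] True by (intro mult_left_mono) auto
  finally show ?thesis
    using True exp_ge_add_one_self[of d] by (simp add: power2_eq_square algebra_simps)
next
  case False
  have "1 - d \<le> exp (-d)" using exp_ge_add_one_self[of "-d"] by simp
  hence "(1 - d) * exp d \<le> exp (-d) * exp d" by (intro mult_right_mono) auto
  hence "exp d - 1 \<le> d * exp d" by (simp add: exp_minus algebra_simps)
  hence "exp d - 1 - d \<le> d * (exp d - 1)" by (simp add: algebra_simps)
  also have "\<dots> = (- d) * (1 - exp d)" by (simp add: algebra_simps)
  also have "\<dots> \<le> (- d) * (- d)"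
  proof (rule mult_left_mono)
    show "1 - exp d \<le> - d" using exp_ge_add_one_self[of d] by linarith
  qed (use False in simp)
  also have "\<dots> = d\<^sup>2 * 1" by (simp add: power2_eq_square)
  also have "\<dots> \<le> d\<^sup>2 * exp \<bar>d\<bar>" by (intro mult_left_mono) auto
  finally have "exp d - 1 - d \<le> d\<^sup>2 * exp \<bar>d\<bar>" .
  moreover have "0 \<le> exp d - 1 - d" using exp_ge_add_one_self[of d] by linarith
  ultimately show ?thesis by (simp only: abs_of_nonneg)
qed

text \<open>A bound on increments that is quadratic in the step forces a zero derivative. It replaces the
  fundamental theorem of calculus below, where the integrand is only measurable.\<close>

lemma constant_if_quadratic_increments:
  fixes R :: "real \<Rightarrow> real"
  assumes "a \<le> b"
    and quad: "\<And>s t. a \<le> s \<Longrightarrow> s \<le> t \<Longrightarrow> t \<le> b \<Longrightarrow> \<bar>R t - R s\<bar> \<le> K * (t - s)\<^sup>2"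
  shows "R b = R a"
proof -
  have sym: "\<bar>R y - R x\<bar> \<le> K * (y - x)\<^sup>2" if "x \<in> {a..b}" "y \<in> {a..b}" for x y
    using quad[of x y] quad[of y x] that
    by (cases "x \<le> y") (auto simp: abs_minus_commute power2_commute)
  have "(R has_field_derivative 0) (at x within {a..b})" if x: "x \<in> {a..b}" for x
  proof -
    have "((\<lambda>y. K * \<bar>y - x\<bar>) \<longlongrightarrow> K * \<bar>x - x\<bar>) (at x within {a..b})"
      by (intro tendsto_intros)
    hence 1: "((\<lambda>y. K * \<bar>y - x\<bar>) \<longlongrightarrow> 0) (at x within {a..b})" by simp
    have "((\<lambda>y. (R y - R x) / (y - x)) \<longlongrightarrow> 0) (at x within {a..b})"
    proof (rule Lim_null_comparison[OF _ 1])
      have "norm ((R y - R x) / (y - x)) \<le> K * \<bar>y - x\<bar>" if "y \<in> {a..b}" "y \<noteq> x" for y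
      proof -
        have "norm ((R y - R x) / (y - x)) = \<bar>R y - R x\<bar> / \<bar>y - x\<bar>" by simp
        also have "\<dots> \<le> (K * (y - x)\<^sup>2) / \<bar>y - x\<bar>"
          using sym[OF x that(1)] by (intro divide_right_mono) auto
        also have "\<dots> = (K * \<bar>y - x\<bar>) * \<bar>y - x\<bar> / \<bar>y - x\<bar>"
          by (simp add: power2_eq_square abs_mult_self_eq mult.assoc)
        also have "\<dots> = K * \<bar>y - x\<bar>" using that(2) by simp
        finally show ?thesis .
      qed
      thus "\<forall>\<^sub>F y in at x within {a..b}. norm ((R y - R x) / (y - x)) \<le> K * \<bar>y - x\<bar>"
        by (auto simp: eventually_at_filter)
    qed
    thus ?thesis by (simp add: has_field_derivative_iff)
  qed
  hence "\<exists>c. \<forall>x\<in>{a..b}. R x = c"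
    by (intro has_field_derivative_zero_constant) auto
  thus ?thesis using \<open>a \<le> b\<close> by auto
qed

text \<open>Right derivatives suffice for monotonicity of a continuous function. If \<open>z\<close> exceeded the line of slope
  \<open>e\<close> through its initial point, then just after the last time below that line the hypothesis would
  keep it below for a little longer.\<close>

lemma nonincreasing_if_right_derivative_nonpos:
  fixes z :: "real \<Rightarrow> real"
  assumes T: "0 \<le> T" and cont: "continuous_on {0..T} z"
    and right: "\<And>t e. 0 \<le> t \<Longrightarrow> t < T \<Longrightarrow> 0 < e \<Longrightarrow>
                  \<forall>\<^sub>F h in at_right 0. z (t + h) \<le> z t + e * h"
  shows "z T \<le> z 0"
proof (rule field_le_epsilon)
  fix e' :: real assume e': "0 < e'"
  define e where "e = e' / (T + 1)"
  have e: "0 < e" using e' T by (simp add: e_def)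
  define S where "S = {t \<in> {0..T}. z t \<le> z 0 + e * t}"
  have "closed S" unfolding S_def
    by (intro continuous_on_closed_Collect_le continuous_intros cont)
  have bdd: "bounded S" by (rule bounded_subset[of "{0..T}"]) (auto simp: S_def)
  hence "compact S" using \<open>closed S\<close> by (simp add: compact_eq_bounded_closed)
  moreover have "0 \<in> S" using T by (auto simp: S_def)
  ultimately obtain m where m: "m \<in> S" "\<And>t. t \<in> S \<Longrightarrow> t \<le> m"
    using compact_attains_sup[of S] by blast
  have "m = T"
  proof (rule ccontr)
    assume "m \<noteq> T"
    hence mT: "0 \<le> m" "m < T" using m by (auto simp: S_def)
    have "\<forall>\<^sub>F h in at_right 0. 0 < h \<and> h < T - m"
      unfolding eventually_at_right_field using mT by (intro exI[of _ "T - m"]) auto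
    with right[OF mT e]
    have "\<forall>\<^sub>F h in at_right 0. z (m + h) \<le> z m + e * h \<and> 0 < h \<and> h < T - m"
      by eventually_elim auto
    then obtain h where h: "z (m + h) \<le> z m + e * h" "0 < h" "h < T - m"
      using eventually_happens'[OF trivial_limit_at_right_real] by blast
    hence "m + h \<in> S" using m(1) mT by (auto simp: S_def algebra_simps)
    with m(2) h show False by fastforce
  qed
  hence "z T \<le> z 0 + e * T" using m by (auto simp: S_def)
  also have "e * T \<le> e'" using e' T by (simp add: e_def field_simps)
  finally show "z T \<le> z 0 + e'" by simp
qed

lemma
  fixes w :: "real \<Rightarrow> real"
  assumes [measurable]: "w \<in> borel_measurable borel" and bnd: "\<And>s. a \<le> s \<Longrightarrow> s \<le> b \<Longrightarrow> \<bar>w s\<bar> \<le> B"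
  shows set_integrable_if_bounded: "set_integrable lborel {a..b} w"
    and abs_set_integral_le: "a \<le> b \<Longrightarrow> \<bar>LINT s:{a..b}|lborel. w s\<bar> \<le> B * (b - a)"
proof -
  show int: "set_integrable lborel {a..b} w"
    unfolding set_integrable_def
    by (rule integrableI_bounded_set[where A="{a..b}" and B=B])
       (use bnd in \<open>auto simp: emeasure_lborel_Icc_eq\<close>)
  assume ab: "a \<le> b"
  have "\<bar>LINT s:{a..b}|lborel. w s\<bar> \<le> (LINT s:{a..b}|lborel. B)"
    unfolding set_lebesgue_integral_def
    by (rule integral_abs_bound_integral)
       (use int bnd ab in \<open>auto simp: set_integrable_def emeasure_lborel_Icc_eq split: split_indicator\<close>)
  also have "\<dots> = B * (b - a)" using ab by (simp add: set_lebesgue_integral_def)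
  finally show "\<bar>LINT s:{a..b}|lborel. w s\<bar> \<le> B * (b - a)" .
qed

lemma set_integral_Icc_split:
  fixes w :: "real \<Rightarrow> real"
  assumes "set_integrable lborel {a..c} w" "a \<le> b" "b \<le> c"
  shows "(LINT s:{a..c}|lborel. w s) = (LINT s:{a..b}|lborel. w s) + (LINT s:{b..c}|lborel. w s)"
proof -
  have u: "{a..c} = {a..b} \<union> {b..c}" using assms by auto
  have "(LINT s:{a..b} \<union> {b..c}|lborel. w s) = (LINT s:{a..b}|lborel. w s) + (LINT s:{b..c}|lborel. w s)"
  proof (rule set_integral_Un_AE)
    show "AE x in lborel. \<not> (x \<in> {a..b} \<and> x \<in> {b..c})"
      using AE_lborel_singleton[of b] by eventually_elim auto
    show "set_integrable lborel {a..b} w" "set_integrable lborel {b..c} w"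
      using assms by (auto intro: set_integrable_subset)
  qed auto
  thus ?thesis using u by simp
qed

lemma borel_measurable_integral_upto:
  fixes w :: "'a \<Rightarrow> real \<Rightarrow> real"
  assumes [measurable]: "case_prod w \<in> borel_measurable (M \<Otimes>\<^sub>M borel)"
    and [measurable]: "\<tau> \<in> borel_measurable M" "\<sigma> \<in> borel_measurable M"
  shows "(\<lambda>x. LINT s:{\<sigma> x..\<tau> x}|lborel. w x s) \<in> borel_measurable M"
proof -
  have "(\<lambda>x. LINT s|lborel. (if \<sigma> x \<le> s \<and> s \<le> \<tau> x then 1 else 0) * w x s) \<in> borel_measurable M"
    by measurable
  thus ?thesis unfolding set_lebesgue_integral_def
    by (simp add: indicator_def if_distrib cong: if_cong)
qed

text \<open>The identity \<open>exp (F b) = 1 + \<integral> F' exp F\<close> for \<open>F\<close> the indefinite integral of a bounded measurable \<open>w\<close>. As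
  \<open>F\<close> need not be differentiable, the chain rule is replaced by second-order Taylor bounds: over a
  short interval the two sides change by the same amount up to the square of its length.\<close>

lemma exp_set_integral_eq:
  fixes w :: "real \<Rightarrow> real"
  assumes w[measurable]: "w \<in> borel_measurable borel"
    and bnd: "\<And>s. \<bar>w s\<bar> \<le> B" and ab: "a \<le> b"
  shows "exp (LINT s:{a..b}|lborel. w s)
       = 1 + (LINT s:{a..b}|lborel. w s * exp (LINT r:{a..s}|lborel. w r))"
proof -
  define F where "F s = (LINT r:{a..s}|lborel. w r)" for s
  have F[measurable]: "F \<in> borel_measurable borel"
    unfolding F_def by (rule borel_measurable_integral_upto) measurable
  have B: "0 \<le> B" using bnd[of 0] by simp
  define E where "E = exp (B * (b - a))"
  have int: "set_integrable lborel {s..t} w" for s t by (rule set_integrable_if_bounded[OF w bnd])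
  have Fdiff: "F t - F s = (LINT r:{s..t}|lborel. w r)" if "a \<le> s" "s \<le> t" for s t
    using set_integral_Icc_split[OF int that] by (simp add: F_def)
  have Fle: "\<bar>F t - F s\<bar> \<le> B * (t - s)" if "a \<le> s" "s \<le> t" for s t
    using Fdiff[OF that] abs_set_integral_le[OF w bnd that(2)] by simp
  have Fb: "\<bar>F t\<bar> \<le> B * (b - a)" if "a \<le> t" "t \<le> b" for t
  proof -
    have "\<bar>F t\<bar> \<le> B * (t - a)" unfolding F_def by (rule abs_set_integral_le[OF w bnd that(1)])
    also have "\<dots> \<le> B * (b - a)" using that B by (intro mult_left_mono) auto
    finally show ?thesis .
  qed
  have expF: "exp (F t) \<le> E" if "a \<le> t" "t \<le> b" for t
    using Fb[OF that] by (simp add: E_def)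
  have dle: "exp \<bar>F t - F s\<bar> \<le> E" if "a \<le> s" "s \<le> t" "t \<le> b" for s t
  proof -
    have "B * (t - s) \<le> B * (b - a)" using that B by (intro mult_left_mono) auto
    thus ?thesis using Fle[OF that(1,2)] by (simp add: E_def)
  qed
  have E1: "0 \<le> E" by (simp add: E_def)
  have expd: "\<bar>exp (F t) - exp (F s)\<bar> \<le> E * (B * (t - s) * E)" if "a \<le> s" "s \<le> t" "t \<le> b" for s t
  proof -
    have "\<bar>exp (F t) - exp (F s)\<bar> = exp (F s) * \<bar>exp (F t - F s) - 1\<bar>"
      by (simp add: exp_diff abs_mult[symmetric, of "exp (F s)", simplified] algebra_simps)
    also have "\<dots> \<le> E * (\<bar>F t - F s\<bar> * exp \<bar>F t - F s\<bar>)"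
      using that by (intro mult_mono expF abs_exp_minus_one_le E1) auto
    also have "\<dots> \<le> E * (B * (t - s) * E)"
      using that B by (intro mult_left_mono mult_mono Fle dle E1) auto
    finally show ?thesis .
  qed
  define R where "R s = exp (F s) - (LINT r:{a..s}|lborel. w r * exp (F r))" for s
  have "R b = R a"
  proof (rule constant_if_quadratic_increments[OF ab])
    fix s t assume st: "a \<le> s" "s \<le> t" "t \<le> b"
    have wexp: "\<bar>w r * exp (F r)\<bar> \<le> B * E" if "a \<le> r" "r \<le> b" for r
      using that bnd[of r] expF[OF that] B by (auto simp: abs_mult intro!: mult_mono)
    have int1: "set_integrable lborel {a..t} (\<lambda>r. w r * exp (F r))"
      by (rule set_integrable_if_bounded[where B="B*E"]) (use wexp st in auto)
    have int2: "set_integrable lborel {s..t} (\<lambda>r. w r * exp (F r))"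
      by (rule set_integrable_subset[OF int1]) (use st in auto)
    have "(LINT r:{s..t}|lborel. w r * (exp (F r) - exp (F s)))
        = (LINT r:{s..t}|lborel. w r * exp (F r)) - (LINT r:{s..t}|lborel. w r * exp (F s))"
      by (subst set_integral_diff(2)[symmetric]) (use int2 int in \<open>auto simp: algebra_simps\<close>)
    also have "(LINT r:{s..t}|lborel. w r * exp (F s)) = (F t - F s) * exp (F s)"
      using Fdiff[OF st(1,2)] by simp
    also have "(LINT r:{s..t}|lborel. w r * exp (F r))
       = (LINT r:{a..t}|lborel. w r * exp (F r)) - (LINT r:{a..s}|lborel. w r * exp (F r))"
      using set_integral_Icc_split[OF int1 st(1,2)] by simp
    finally have eq: "R t - R s = exp (F s) * (exp (F t - F s) - 1 - (F t - F s))
         - (LINT r:{s..t}|lborel. w r * (exp (F r) - exp (F s)))"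
      by (simp add: R_def exp_diff algebra_simps)
    have b1: "\<bar>exp (F s) * (exp (F t - F s) - 1 - (F t - F s))\<bar> \<le> E * ((B * (t - s))\<^sup>2 * E)"
    proof -
      have "\<bar>exp (F t - F s) - 1 - (F t - F s)\<bar> \<le> (F t - F s)\<^sup>2 * exp \<bar>F t - F s\<bar>"
        by (rule abs_exp_minus_affine_le)
      also have "\<dots> \<le> (B * (t - s))\<^sup>2 * E"
      proof (intro mult_mono dle st)
        show "(F t - F s)\<^sup>2 \<le> (B * (t - s))\<^sup>2"
          using Fle[OF st(1,2)] by (metis abs_ge_zero power2_abs power_mono)
      qed auto
      finally show ?thesis
        using expF[of s] st by (auto simp: abs_mult intro!: mult_mono E1)
    qed
    have b2: "\<bar>LINT r:{s..t}|lborel. w r * (exp (F r) - exp (F s))\<bar> \<le> B * (E * (B * (t - s) * E)) * (t - s)"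
    proof (rule abs_set_integral_le)
      fix r assume r: "s \<le> r" "r \<le> t"
      have "\<bar>exp (F r) - exp (F s)\<bar> \<le> E * (B * (r - s) * E)" using r st by (intro expd) auto
      also have "\<dots> \<le> E * (B * (t - s) * E)"
        using r B E1 by (intro mult_left_mono mult_right_mono) auto
      finally show "\<bar>w r * (exp (F r) - exp (F s))\<bar> \<le> B * (E * (B * (t - s) * E))"
        using bnd[of r] B by (auto simp: abs_mult intro!: mult_mono)
    qed (use st in auto)
    have "\<bar>R t - R s\<bar> \<le> E * ((B * (t - s))\<^sup>2 * E) + B * (E * (B * (t - s) * E)) * (t - s)"
      unfolding eq using b1 b2 by linarith
    also have "\<dots> = (2 * E\<^sup>2 * B\<^sup>2) * (t - s)\<^sup>2" by (simp add: power2_eq_square algebra_simps)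
    finally show "\<bar>R t - R s\<bar> \<le> (2 * E\<^sup>2 * B\<^sup>2) * (t - s)\<^sup>2" .
  qed
  moreover have null: "(LINT r:{a..a}|lborel. g r) = 0" if "g \<in> borel_measurable borel" for g :: "real \<Rightarrow> real"
    using abs_set_integral_le[OF that, of a a "\<bar>g a\<bar>"] by simp
  have "F a = 0" unfolding F_def by (rule null[OF w])
  moreover have "(LINT r:{a..a}|lborel. w r * exp (F r)) = 0" by (rule null) measurable
  ultimately show ?thesis by (simp add: R_def F_def)
qed

section \<open>Kernels and the Markov property\<close>

text \<open>The integral against a kernel may depend on the parameter through the integrand as well: push the
  measure \<open>L x\<close> forward to the product space and integrate there.\<close>

lemma borel_measurable_integral_kernel:
  fixes f :: "'a \<Rightarrow> 'b \<Rightarrow> real"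
  assumes f[measurable]: "(\<lambda>(x, y). f x y) \<in> borel_measurable (M \<Otimes>\<^sub>M N)"
    and L[measurable]: "L \<in> M \<rightarrow>\<^sub>M subprob_algebra N"
  shows "(\<lambda>x. \<integral>y. f x y \<partial>L x) \<in> borel_measurable M"
proof -
  note measurable_distr2[measurable]
  have "(\<lambda>x. \<integral>z. (\<lambda>(x, y). f x y) z \<partial>distr (L x) (M \<Otimes>\<^sub>M N) (\<lambda>y. (x, y))) \<in> borel_measurable M"
    by measurable
  thus ?thesis
  proof (rule measurable_cong[THEN iffD1, rotated])
    fix x assume x: "x \<in> space M"
    have [measurable_cong]: "sets (L x) = sets N" using sets_kernel[OF L x] .
    show "(\<integral>z. (\<lambda>(x, y). f x y) z \<partial>distr (L x) (M \<Otimes>\<^sub>M N) (\<lambda>y. (x, y))) = (\<integral>y. f x y \<partial>L x)"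
      using x by (subst integral_distr) auto
  qed
qed

lemma integral_bind_bounded:
  fixes f :: "'b \<Rightarrow> real"
  assumes M: "finite_measure M" "space M \<noteq> {}" and N: "N \<in> M \<rightarrow>\<^sub>M prob_algebra L"
    and f[measurable]: "f \<in> borel_measurable L" and bnd: "\<And>y. y \<in> space L \<Longrightarrow> \<bar>f y\<bar> \<le> K"
  shows "(\<integral>y. f y \<partial>(M \<bind> N)) = (\<integral>x. (\<integral>y. f y \<partial>N x) \<partial>M)"
proof -
  have N'[measurable]: "N \<in> M \<rightarrow>\<^sub>M subprob_algebra L" by (rule measurable_prob_algebraD[OF N])
  let ?D = "distr M (subprob_algebra L) N"
  have fin: "finite_measure ?D" by (rule finite_measure.finite_measure_distr[OF M(1) N'])
  have "AE M' in ?D. emeasure M' (space M') \<le> ennreal 1"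
    using measurable_space[OF N]
    by (subst AE_distr_iff) (auto simp: space_prob_algebra prob_space.emeasure_space_1 intro!: AE_I2)
  from integral_join[OF f bnd _ fin this]
  have "(\<integral>y. f y \<partial>join ?D) = (\<integral>M'. (\<integral>y. f y \<partial>M') \<partial>?D)" by simp
  also have "\<dots> = (\<integral>x. (\<integral>y. f y \<partial>N x) \<partial>M)" by (rule integral_distr) measurable
  finally show ?thesis by (simp add: bind_nonempty''[OF N' M(2)])
qed

lemma integrable_bounded_finite:
  fixes f :: "'a \<Rightarrow> real"
  assumes "finite_measure Q" "f \<in> borel_measurable Q" "\<And>x. x \<in> space Q \<Longrightarrow> \<bar>f x\<bar> \<le> K"
  shows "integrable Q f"
  by (rule finite_measure.integrable_const_bound[OF assms(1), where B=K]) (use assms in auto)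

lemma abs_integral_prob_le:
  fixes f :: "'a \<Rightarrow> real"
  assumes Q: "prob_space Q" and bnd: "\<And>x. x \<in> space Q \<Longrightarrow> \<bar>f x\<bar> \<le> K"
  shows "\<bar>\<integral>x. f x \<partial>Q\<bar> \<le> K"
proof -
  interpret prob_space Q by fact
  obtain x0 where "x0 \<in> space Q" using not_empty by auto
  hence K: "0 \<le> K" using bnd[of x0] by linarith
  show ?thesis
  proof (cases "integrable Q f")
    case True
    have "\<bar>\<integral>x. f x \<partial>Q\<bar> \<le> (\<integral>x. \<bar>f x\<bar> \<partial>Q)" by (rule integral_abs_bound)
    also have "\<dots> \<le> (\<integral>x. K \<partial>Q)" using True bnd by (intro integral_mono) auto
    finally show ?thesis by (simp add: prob_space)
  qed (use K in \<open>simp add: not_integrable_integral_eq\<close>)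
qed

context cadlag_markov_process
begin

abbreviation sg :: "real \<Rightarrow> ('x \<Rightarrow> real) \<Rightarrow> 'x \<Rightarrow> real"
  where "sg \<equiv> markov_semigroup X P"

lemma space_filtration: "0 \<le> t \<Longrightarrow> space (F t) = space Om"
  using filtration_sub[of t] by (simp add: subalgebra_def)

lemma filtration_measurable_mono:
  assumes "0 \<le> s" "s \<le> t" "g \<in> F s \<rightarrow>\<^sub>M N"
  shows "g \<in> F t \<rightarrow>\<^sub>M N"
  using measurable_from_subalg[of "F t" "F s"] assms filtration_mono[of s t]
  by (auto simp: subalgebra_def space_filtration)

lemma filtration_measurable_Om:
  assumes "0 \<le> s" "g \<in> F s \<rightarrow>\<^sub>M N"
  shows "g \<in> Om \<rightarrow>\<^sub>M N"
  using measurable_from_subalg[OF filtration_sub] assms by blast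

lemma X_measurable: "0 \<le> t \<Longrightarrow> X t \<in> Om \<rightarrow>\<^sub>M borel"
  by (rule filtration_measurable_Om[OF _ adapted])

text \<open>Progressive measurability. The clamping of time to \<open>[0, b]\<close> makes the statement total in time, so
  that integrals over subintervals of \<open>[0, b]\<close> inherit measurability with respect to \<open>F b\<close>.\<close>

lemma clamped_process_measurable_F:
  assumes b: "0 \<le> b"
  shows "(\<lambda>(s, w). X (max 0 (min s b)) w) \<in> borel \<Otimes>\<^sub>M F b \<rightarrow>\<^sub>M borel"
proof -
  define c where "c s = max 0 (min s b)" for s :: real
  \<comment> \<open>the first point above \<open>s\<close> of a grid; above, since paths are right continuous\<close>
  define \<tau> where "\<tau> n s = (of_int \<lfloor>s * real (Suc n)\<rfloor> + 1) / real (Suc n)" for n s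
  have meas: "(\<lambda>(s, w). X (c (\<tau> n s)) w) \<in> borel \<Otimes>\<^sub>M F b \<rightarrow>\<^sub>M borel" for n
  proof -
    have [measurable]: "X (c u) \<in> F b \<rightarrow>\<^sub>M borel" for u
      by (rule filtration_measurable_mono[OF _ _ adapted]) (use b in \<open>auto simp: c_def\<close>)
    have "(\<lambda>z. (\<lambda>k z. X (c ((of_int k + 1) / real (Suc n))) (snd z)) \<lfloor>fst z * real (Suc n)\<rfloor> z)
            \<in> borel \<Otimes>\<^sub>M F b \<rightarrow>\<^sub>M borel"
      by (rule measurable_compose_countable) measurable
    thus ?thesis by (simp add: \<tau>_def case_prod_beta)
  qed
  have lim: "(\<lambda>n. X (c (\<tau> n s)) w) \<longlonglongrightarrow> X (c s) w" if "w \<in> space Om" for s w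
  proof (rule continuous_within_tendsto_compose'[of "c s" "{c s..}" "\<lambda>s. X s w"])
    show "continuous (at (c s) within {c s..}) (\<lambda>s. X s w)"
      using right_cont[OF that, of "c s"]
      by (simp add: continuous_within at_within_Ici_at_right c_def)
    have "s \<le> \<tau> n s" "\<tau> n s \<le> s + 1 / real (Suc n)" for n
    proof -
      have "s * real (Suc n) \<le> of_int \<lfloor>s * real (Suc n)\<rfloor> + 1" by linarith
      thus "s \<le> \<tau> n s" by (simp add: \<tau>_def pos_le_divide_eq)
      have "\<tau> n s \<le> (s * real (Suc n) + 1) / real (Suc n)"
        unfolding \<tau>_def by (intro divide_right_mono) (linarith, simp)
      also have "\<dots> = s + 1 / real (Suc n)" by (simp add: add_divide_distrib)
      finally show "\<tau> n s \<le> s + 1 / real (Suc n)" .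
    qed note bnd = this
    show "c (\<tau> n s) \<in> {c s..}" for n
      using bnd(1)[of n] by (auto simp: c_def)
    have "(\<lambda>n. s + 1 / real (Suc n)) \<longlonglongrightarrow> s + 0"
      by (intro tendsto_add tendsto_const LIMSEQ_Suc[OF lim_1_over_n])
    hence lim: "(\<lambda>n. s + 1 / real (Suc n)) \<longlonglongrightarrow> s" by (simp only: add_0_right)
    have "(\<lambda>n. \<tau> n s) \<longlonglongrightarrow> s"
      by (rule tendsto_sandwich[OF _ _ tendsto_const lim])
         (rule always_eventually, rule allI, rule bnd)+
    thus "(\<lambda>n. c (\<tau> n s)) \<longlonglongrightarrow> c s"
      unfolding c_def by (intro tendsto_max tendsto_min tendsto_const)
  qed
  have "(\<lambda>(s, w). X (c s) w) \<in> borel \<Otimes>\<^sub>M F b \<rightarrow>\<^sub>M borel"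
  proof (rule borel_measurable_LIMSEQ_metric[OF meas])
    fix z :: "real \<times> 'w" assume "z \<in> space (borel \<Otimes>\<^sub>M F b)"
    hence "snd z \<in> space Om" by (auto simp: space_pair_measure space_filtration[OF b])
    from lim[OF this, of "fst z"]
    show "(\<lambda>n. case z of (s, w) \<Rightarrow> X (c (\<tau> n s)) w) \<longlonglongrightarrow> (case z of (s, w) \<Rightarrow> X (c s) w)"
      by (simp add: case_prod_beta)
  qed
  thus ?thesis by (simp only: c_def)
qed

lemma clamped_process_measurable:
  assumes b: "0 \<le> b"
  shows "(\<lambda>(s, w). X (max 0 (min s b)) w) \<in> borel \<Otimes>\<^sub>M Om \<rightarrow>\<^sub>M borel"
proof -
  have "id \<in> borel \<Otimes>\<^sub>M Om \<rightarrow>\<^sub>M borel \<Otimes>\<^sub>M F b"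
  proof (rule measurable_pair)
    show "snd \<circ> id \<in> borel \<Otimes>\<^sub>M Om \<rightarrow>\<^sub>M F b"
      using filtration_measurable_Om[OF b, of "\<lambda>x. x" "F b"]
      by (simp add: o_def measurable_compose[OF measurable_snd])
  qed simp
  from measurable_compose[OF this clamped_process_measurable_F[OF b]] show ?thesis by simp
qed

lemma kernel_subprob[measurable]: "P \<in> borel \<rightarrow>\<^sub>M subprob_algebra Om"
  by (rule measurable_prob_algebraD[OF kernel])

lemma prob_space_P: "prob_space (P x)" and sets_P: "sets (P x) = sets Om"
  using measurable_space[OF kernel, of x] by (auto simp: space_prob_algebra)

lemma space_P: "space (P x) = space Om"
  by (rule sets_eq_imp_space_eq[OF sets_P])

lemma semigroup_measurable:
  assumes t: "0 \<le> t" and \<phi>[measurable]: "\<phi> \<in> borel_measurable borel"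
  shows "sg t \<phi> \<in> borel_measurable borel"
proof -
  note [measurable] = X_measurable[OF t]
  have "(\<lambda>x. \<integral>w. \<phi> (X t w) \<partial>P x) \<in> borel_measurable borel"
    by (rule borel_measurable_integral_kernel) measurable
  thus ?thesis by (simp add: markov_semigroup_def[abs_def])
qed

lemma semigroup_bounded:
  assumes "\<And>y. \<bar>\<phi> y\<bar> \<le> K"
  shows "\<bar>sg t \<phi> x\<bar> \<le> K"
  unfolding markov_semigroup_def by (rule abs_integral_prob_le[OF prob_space_P assms])

text \<open>The Markov property in integrated form, for an arbitrary law \<open>Q\<close> on the sample space. Both \<open>P x\<close> and all
  mixtures \<open>\<nu> \<bind> P\<close> have it, and this common form allows the two to be compared.\<close>

definition markov_under :: "'w measure \<Rightarrow> bool" where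
  "markov_under Q \<longleftrightarrow> prob_space Q \<and> sets Q = sets Om \<and>
     (\<forall>s t \<phi> Z K B. 0 \<le> s \<longrightarrow> 0 \<le> t \<longrightarrow> \<phi> \<in> borel_measurable borel \<longrightarrow> (\<forall>y. \<bar>\<phi> y\<bar> \<le> K) \<longrightarrow>
        Z \<in> borel_measurable (F s) \<longrightarrow> (\<forall>w\<in>space Om. \<bar>Z w\<bar> \<le> B) \<longrightarrow>
        (\<integral>w. Z w * \<phi> (X (s + t) w) \<partial>Q) = (\<integral>w. Z w * sg t \<phi> (X s w) \<partial>Q))"

lemma markov_underD:
  assumes "markov_under Q" "0 \<le> s" "0 \<le> t" "\<phi> \<in> borel_measurable borel" "\<And>y. \<bar>\<phi> y\<bar> \<le> K"
    "Z \<in> borel_measurable (F s)" "\<And>w. w \<in> space Om \<Longrightarrow> \<bar>Z w\<bar> \<le> B"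
  shows "(\<integral>w. Z w * \<phi> (X (s + t) w) \<partial>Q) = (\<integral>w. Z w * sg t \<phi> (X s w) \<partial>Q)"
  using assms unfolding markov_under_def by blast

text \<open>The hypothesis on conditional probabilities concerns indicators only. For a nonnegative weight \<open>Z\<close> it says
  that two finite measures agree: the law of \<open>X (s + t)\<close> under \<open>Z dP\<close>, and the law of \<open>X s\<close> under \<open>Z dP\<close> moved on by
  the transition kernel. Integrating \<open>\<phi>\<close> against both gives the claim.\<close>

lemma markov_nonneg_weight:
  assumes s: "0 \<le> s" and t: "0 \<le> t" and \<phi>[measurable]: "\<phi> \<in> borel_measurable borel"
    and \<phi>K: "\<And>y. \<bar>\<phi> y\<bar> \<le> K" and Z: "Z \<in> borel_measurable (F s)"
    and ZB: "\<And>w. w \<in> space Om \<Longrightarrow> 0 \<le> Z w" "\<And>w. w \<in> space Om \<Longrightarrow> Z w \<le> B"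
  shows "(\<integral>w. Z w * \<phi> (X (s + t) w) \<partial>P x) = (\<integral>w. Z w * sg t \<phi> (X s w) \<partial>P x)"
proof -
  interpret Px: prob_space "P x" by (rule prob_space_P)
  note [measurable_cong] = sets_P
  have ZOm[measurable]: "Z \<in> borel_measurable Om" by (rule filtration_measurable_Om[OF s Z])
  have [measurable]: "X s \<in> Om \<rightarrow>\<^sub>M borel" "X (s + t) \<in> Om \<rightarrow>\<^sub>M borel" "X t \<in> Om \<rightarrow>\<^sub>M borel"
    using s t by (auto intro: X_measurable)
  define D where "D = density (P x) (\<lambda>w. ennreal (Z w))"
  have [measurable_cong]: "sets D = sets Om" by (simp add: D_def sets_P)
  have spD: "space D = space Om" by (simp add: D_def space_P)
  have intZ: "integrable (P x) Z"
    using ZB by (intro integrable_bounded_finite[where K=B]) (auto simp: space_P Px.finite_measure_axioms)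
  have dens: "(\<integral>w. g w \<partial>D) = (\<integral>w. Z w * g w \<partial>P x)"
    if [measurable]: "g \<in> borel_measurable Om" for g :: "'w \<Rightarrow> real"
  proof -
    have "AE w in P x. 0 \<le> Z w" using ZB by (intro AE_I2) (auto simp: space_P)
    from integral_density[OF _ _ this, of g] show ?thesis by (simp add: D_def)
  qed
  have nndens: "(\<integral>\<^sup>+w. g w \<partial>D) = (\<integral>\<^sup>+w. ennreal (Z w) * g w \<partial>P x)"
    if [measurable]: "g \<in> borel_measurable Om" for g
    unfolding D_def by (rule nn_integral_density) measurable
  have finD: "finite_measure D"
  proof
    have "emeasure D (space D) = (\<integral>\<^sup>+w. ennreal (Z w) \<partial>P x)"
      unfolding spD by (auto simp: D_def emeasure_density space_P intro!: nn_integral_cong)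
    also have "\<dots> = ennreal (\<integral>w. Z w \<partial>P x)"
      using ZB by (intro nn_integral_eq_integral intZ) (auto simp: space_P)
    finally show "emeasure D (space D) \<noteq> \<infinity>" by simp
  qed
  define L where "L y = distr (P y) borel (X t)" for y
  have L: "L \<in> borel \<rightarrow>\<^sub>M prob_algebra borel"
    unfolding L_def by (rule measurable_compose[OF kernel measurable_distr_prob_space]) measurable
  define \<nu> where "\<nu> = distr D borel (X s)"
  have fin\<nu>: "finite_measure \<nu>"
    unfolding \<nu>_def by (rule finite_measure.finite_measure_distr[OF finD]) measurable
  have L': "L \<in> \<nu> \<rightarrow>\<^sub>M prob_algebra borel" using L by (simp add: \<nu>_def)
  have ne: "space \<nu> \<noteq> {}" by (simp add: \<nu>_def)
  have "distr D borel (X (s + t)) = \<nu> \<bind> L"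
  proof (rule measure_eqI)
    show "sets (distr D borel (X (s + t))) = sets (\<nu> \<bind> L)"
      using sets_bind_measurable[OF measurable_prob_algebraD[OF L'] ne] by simp
    fix A assume "A \<in> sets (distr D borel (X (s + t)))"
    hence A[measurable]: "A \<in> sets borel" by simp
    define p where "p y = measure (L y) A" for y
    have p: "p y = measure (P y) {w \<in> space Om. X t w \<in> A}" for y
      unfolding p_def L_def by (subst measure_distr) (auto simp: space_P intro!: arg_cong[where f="measure (P y)"])
    have p_meas[measurable]: "p \<in> borel_measurable borel"
      unfolding p_def by (rule measure_measurable_prob_algebra2[OF _ L]) simp
    have p01: "0 \<le> p y" "p y \<le> 1" for y
      unfolding p using prob_space.prob_le_1[OF prob_space_P] by auto
    interpret sub: finite_measure_subalgebra "P x" "F s"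
      by unfold_locales (use filtration_sub[OF s] in \<open>auto simp: subalgebra_def sets_P space_P\<close>)
    have int1: "integrable (P x) (\<lambda>w. Z w * indicator A (X (s + t) w))"
    proof (rule integrable_bounded_finite[where K=B])
      fix w assume "w \<in> space (P x)"
      hence "0 \<le> Z w" "Z w \<le> B" using ZB by (auto simp: space_P)
      thus "\<bar>Z w * indicator A (X (s + t) w)\<bar> \<le> B" by (simp split: split_indicator)
    next
      show "(\<lambda>w. Z w * indicator A (X (s + t) w)) \<in> borel_measurable (P x)" by measurable
    qed (rule Px.finite_measure_axioms)
    have "(\<integral>w. Z w * indicator A (X (s + t) w) \<partial>P x)
        = (\<integral>w. Z w * real_cond_exp (P x) (F s) (\<lambda>w. indicator A (X (s + t) w)) w \<partial>P x)"
      by (rule sub.real_cond_exp_intg(2)[symmetric, OF int1 Z]) measurable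
    also have "\<dots> = (\<integral>w. Z w * p (X s w) \<partial>P x)"
    proof (rule integral_cong_AE)
      show "AE w in P x. Z w * real_cond_exp (P x) (F s) (\<lambda>w. indicator A (X (s + t) w)) w
              = Z w * p (X s w)"
        using markov[OF s t A, of x] unfolding p by (rule AE_mp) (simp add: AE_I2)
    qed measurable
    finally have eq: "(\<integral>w. Z w * indicator A (X (s + t) w) \<partial>P x) = (\<integral>w. Z w * p (X s w) \<partial>P x)" .
    have int2: "integrable (P x) (\<lambda>w. Z w * p (X s w))"
    proof (rule integrable_bounded_finite[where K=B])
      fix w assume "w \<in> space (P x)"
      hence "0 \<le> Z w" "Z w \<le> B" using ZB by (auto simp: space_P)
      hence "Z w * p (X s w) \<le> B * 1" using p01 by (intro mult_mono) auto
      thus "\<bar>Z w * p (X s w)\<bar> \<le> B" using \<open>0 \<le> Z w\<close> p01 by (simp add: abs_mult)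
    next
      show "(\<lambda>w. Z w * p (X s w)) \<in> borel_measurable (P x)" by measurable
    qed (rule Px.finite_measure_axioms)
    have "emeasure (distr D borel (X (s + t))) A
        = (\<integral>\<^sup>+w. ennreal (Z w * indicator A (X (s + t) w)) \<partial>P x)"
    proof -
      have "emeasure (distr D borel (X (s + t))) A = (\<integral>\<^sup>+y. indicator A y \<partial>distr D borel (X (s + t)))"
        by simp
      also have "\<dots> = (\<integral>\<^sup>+w. indicator A (X (s + t) w) \<partial>D)"
        by (rule nn_integral_distr) measurable
      also have "\<dots> = (\<integral>\<^sup>+w. ennreal (Z w) * indicator A (X (s + t) w) \<partial>P x)"
        by (rule nndens) measurable
      also have "\<dots> = (\<integral>\<^sup>+w. ennreal (Z w * indicator A (X (s + t) w)) \<partial>P x)"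
        by (rule nn_integral_cong) (simp split: split_indicator)
      finally show ?thesis .
    qed
    also have "\<dots> = ennreal (\<integral>w. Z w * indicator A (X (s + t) w) \<partial>P x)"
      using ZB by (intro nn_integral_eq_integral int1) (auto simp: space_P)
    also have "\<dots> = (\<integral>\<^sup>+w. ennreal (Z w * p (X s w)) \<partial>P x)"
      unfolding eq using ZB p01 by (intro nn_integral_eq_integral[symmetric] int2) (auto simp: space_P)
    also have "\<dots> = (\<integral>\<^sup>+w. ennreal (p (X s w)) \<partial>D)"
    proof -
      have "(\<integral>\<^sup>+w. ennreal (Z w * p (X s w)) \<partial>P x) = (\<integral>\<^sup>+w. ennreal (Z w) * ennreal (p (X s w)) \<partial>P x)"
        using ZB p01 by (intro nn_integral_cong ennreal_mult) (auto simp: space_P)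
      also have "\<dots> = (\<integral>\<^sup>+w. ennreal (p (X s w)) \<partial>D)"
        by (rule nndens[symmetric]) measurable
      finally show ?thesis .
    qed
    also have "\<dots> = (\<integral>\<^sup>+y. ennreal (p y) \<partial>\<nu>)"
      unfolding \<nu>_def by (rule nn_integral_distr[symmetric]) measurable
    also have "\<dots> = (\<integral>\<^sup>+y. emeasure (L y) A \<partial>\<nu>)"
    proof (rule nn_integral_cong)
      fix y
      have "prob_space (L y)" using measurable_space[OF L, of y] by (simp add: space_prob_algebra)
      thus "ennreal (p y) = emeasure (L y) A"
        by (simp add: p_def finite_measure.emeasure_eq_measure prob_space.finite_measure)
    qed
    also have "\<dots> = emeasure (\<nu> \<bind> L) A"
      by (rule emeasure_bind[symmetric, OF ne measurable_prob_algebraD[OF L'] A])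
    finally show "emeasure (distr D borel (X (s + t))) A = emeasure (\<nu> \<bind> L) A" .
  qed
  hence e1: "(\<integral>y. \<phi> y \<partial>distr D borel (X (s + t))) = (\<integral>y. (\<integral>z. \<phi> z \<partial>L y) \<partial>\<nu>)"
    using integral_bind_bounded[OF fin\<nu> ne L' \<phi> \<phi>K] by simp
  have e2: "(\<integral>y. \<phi> y \<partial>distr D borel (X (s + t))) = (\<integral>w. Z w * \<phi> (X (s + t) w) \<partial>P x)"
    by (subst integral_distr) (auto simp: dens)
  have e3: "(\<integral>z. \<phi> z \<partial>L y) = sg t \<phi> y" for y
    unfolding L_def markov_semigroup_def by (rule integral_distr) measurable
  have e4: "(\<integral>y. sg t \<phi> y \<partial>\<nu>) = (\<integral>w. Z w * sg t \<phi> (X s w) \<partial>P x)"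
  proof -
    note [measurable] = semigroup_measurable[OF t \<phi>]
    have "(\<integral>y. sg t \<phi> y \<partial>\<nu>) = (\<integral>w. sg t \<phi> (X s w) \<partial>D)"
      unfolding \<nu>_def by (rule integral_distr) measurable
    also have "\<dots> = (\<integral>w. Z w * sg t \<phi> (X s w) \<partial>P x)" by (rule dens) measurable
    finally show ?thesis .
  qed
  show ?thesis using e1 unfolding e2 e3 e4 .
qed

lemma markov_under_P: "markov_under (P x)"
  unfolding markov_under_def
proof (intro conjI allI impI prob_space_P sets_P)
  fix s t K B :: real and \<phi> :: "'x \<Rightarrow> real" and Z :: "'w \<Rightarrow> real"
  assume s: "0 \<le> s" and t: "0 \<le> t" and \<phi>[measurable]: "\<phi> \<in> borel_measurable borel"
    and \<phi>K: "\<forall>y. \<bar>\<phi> y\<bar> \<le> K" and Z: "Z \<in> borel_measurable (F s)"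
    and ZB: "\<forall>w\<in>space Om. \<bar>Z w\<bar> \<le> B"
  interpret Px: prob_space "P x" by (rule prob_space_P)
  note [measurable_cong] = sets_P
  have [measurable]: "Z \<in> borel_measurable Om" by (rule filtration_measurable_Om[OF s Z])
  have [measurable]: "X s \<in> Om \<rightarrow>\<^sub>M borel" "X (s + t) \<in> Om \<rightarrow>\<^sub>M borel"
    using s t by (auto intro: X_measurable)
  note [measurable] = semigroup_measurable[OF t \<phi>]
  have sgK: "\<bar>sg t \<phi> y\<bar> \<le> K" for y using \<phi>K by (intro semigroup_bounded) auto
  have int: "integrable (P x) (\<lambda>w. Z w * g (X u w))" "integrable (P x) (\<lambda>w. g (X u w))"
    if [measurable]: "g \<in> borel_measurable borel" "X u \<in> Om \<rightarrow>\<^sub>M borel" and g: "\<And>y. \<bar>g y\<bar> \<le> K" for g u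
  proof -
    show "integrable (P x) (\<lambda>w. g (X u w))"
      by (rule integrable_bounded_finite[where K=K]) (use g in \<open>auto simp: Px.finite_measure_axioms\<close>)
    show "integrable (P x) (\<lambda>w. Z w * g (X u w))"
    proof (rule integrable_bounded_finite[where K="B * K"])
      fix w assume "w \<in> space (P x)"
      hence "\<bar>Z w\<bar> \<le> B" using ZB by (auto simp: space_P)
      thus "\<bar>Z w * g (X u w)\<bar> \<le> B * K"
        using g[of "X u w"] unfolding abs_mult by (intro mult_mono) linarith+
    qed (auto simp: Px.finite_measure_axioms)
  qed
  \<comment> \<open>\<open>Z + B\<close> is a nonnegative weight, and so is the constant that has to be subtracted again\<close>
  have shifted: "(\<integral>w. (Z w + B) * \<phi> (X (s + t) w) \<partial>P x) = (\<integral>w. (Z w + B) * sg t \<phi> (X s w) \<partial>P x)"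
  proof (rule markov_nonneg_weight[OF s t \<phi>])
    show "(\<lambda>w. Z w + B) \<in> borel_measurable (F s)" by (intro borel_measurable_add borel_measurable_const Z)
    show "0 \<le> Z w + B" "Z w + B \<le> 2 * B" if "w \<in> space Om" for w
      using bspec[OF ZB that] by linarith+
  qed (use \<phi>K in auto)
  have const: "(\<integral>w. 1 * \<phi> (X (s + t) w) \<partial>P x) = (\<integral>w. 1 * sg t \<phi> (X s w) \<partial>P x)"
    by (rule markov_nonneg_weight[OF s t \<phi>, where B=1]) (use \<phi>K in auto)
  show "(\<integral>w. Z w * \<phi> (X (s + t) w) \<partial>P x) = (\<integral>w. Z w * sg t \<phi> (X s w) \<partial>P x)"
  proof -
    have a: "(\<integral>w. (Z w + B) * g (X u w) \<partial>P x)
        = (\<integral>w. Z w * g (X u w) \<partial>P x) + B * (\<integral>w. 1 * g (X u w) \<partial>P x)"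
      if "g \<in> borel_measurable borel" "X u \<in> Om \<rightarrow>\<^sub>M borel" "\<And>y. \<bar>g y\<bar> \<le> K" for g u
      unfolding distrib_right using int[OF that] by simp
    note m = X_measurable[OF s] X_measurable[of "s + t"] semigroup_measurable[OF t \<phi>]
    have "\<bar>\<phi> y\<bar> \<le> K" for y using \<phi>K by blast
    from a[OF \<phi> m(2) this] a[OF m(3) m(1) sgK] s t shifted show ?thesis unfolding const by linarith
  qed
qed

lemma prob_space_mixture:
  assumes "prob_space \<nu>" "sets \<nu> = sets borel"
  shows "prob_space (\<nu> \<bind> P)" "sets (\<nu> \<bind> P) = sets Om" "space (\<nu> \<bind> P) = space Om"
proof -
  have \<nu>: "\<nu> \<in> space (prob_algebra borel)" using assms by (simp add: space_prob_algebra)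
  show "prob_space (\<nu> \<bind> P)" by (rule prob_space_bind'[OF \<nu> kernel])
  show "sets (\<nu> \<bind> P) = sets Om" by (rule sets_bind'[OF \<nu> kernel])
  thus "space (\<nu> \<bind> P) = space Om" by (rule sets_eq_imp_space_eq)
qed

lemma integral_mixture:
  fixes f :: "'w \<Rightarrow> real"
  assumes \<nu>: "prob_space \<nu>" "sets \<nu> = sets borel"
    and f: "f \<in> borel_measurable Om" and bnd: "\<And>w. w \<in> space Om \<Longrightarrow> \<bar>f w\<bar> \<le> K"
  shows "(\<integral>w. f w \<partial>(\<nu> \<bind> P)) = (\<integral>x. (\<integral>w. f w \<partial>P x) \<partial>\<nu>)"
proof (rule integral_bind_bounded[OF _ _ _ f bnd])
  show "P \<in> \<nu> \<rightarrow>\<^sub>M prob_algebra Om" using kernel \<nu>(2) by (simp cong: measurable_cong_sets)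
qed (use \<nu> in \<open>auto simp: prob_space.finite_measure prob_space.not_empty\<close>)

lemma markov_under_mixture:
  assumes \<nu>: "prob_space \<nu>" "sets \<nu> = sets borel"
  shows "markov_under (\<nu> \<bind> P)"
  unfolding markov_under_def
proof (intro conjI allI impI prob_space_mixture \<nu>)
  fix s t K B :: real and \<phi> :: "'x \<Rightarrow> real" and Z :: "'w \<Rightarrow> real"
  assume s: "0 \<le> s" and t: "0 \<le> t" and \<phi>[measurable]: "\<phi> \<in> borel_measurable borel"
    and \<phi>K: "\<forall>y. \<bar>\<phi> y\<bar> \<le> K" and Z: "Z \<in> borel_measurable (F s)"
    and ZB: "\<forall>w\<in>space Om. \<bar>Z w\<bar> \<le> B"
  have [measurable]: "Z \<in> borel_measurable Om" by (rule filtration_measurable_Om[OF s Z])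
  have [measurable]: "X s \<in> Om \<rightarrow>\<^sub>M borel" "X (s + t) \<in> Om \<rightarrow>\<^sub>M borel"
    using s t by (auto intro: X_measurable)
  note [measurable] = semigroup_measurable[OF t \<phi>]
  have bnd: "\<bar>Z w * g y\<bar> \<le> B * K" if "w \<in> space Om" "\<And>y. \<bar>g y\<bar> \<le> K" for w y and g :: "'x \<Rightarrow> real"
    using bspec[OF ZB that(1)] that(2)[of y] unfolding abs_mult by (intro mult_mono) linarith+
  have sgK: "\<bar>sg t \<phi> y\<bar> \<le> K" for y using \<phi>K by (intro semigroup_bounded) auto
  have "(\<integral>w. Z w * \<phi> (X (s + t) w) \<partial>(\<nu> \<bind> P)) = (\<integral>x. (\<integral>w. Z w * \<phi> (X (s + t) w) \<partial>P x) \<partial>\<nu>)"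
    by (rule integral_mixture[OF \<nu>, where K="B*K"]) (use bnd \<phi>K in auto)
  also have "\<dots> = (\<integral>x. (\<integral>w. Z w * sg t \<phi> (X s w) \<partial>P x) \<partial>\<nu>)"
    using \<phi>K ZB
    by (intro Bochner_Integration.integral_cong refl markov_underD[OF markov_under_P s t \<phi> _ Z]) auto
  also have "\<dots> = (\<integral>w. Z w * sg t \<phi> (X s w) \<partial>(\<nu> \<bind> P))"
    by (rule integral_mixture[OF \<nu>, where K="B*K", symmetric]) (use bnd sgK in auto)
  finally show "(\<integral>w. Z w * \<phi> (X (s + t) w) \<partial>(\<nu> \<bind> P)) = (\<integral>w. Z w * sg t \<phi> (X s w) \<partial>(\<nu> \<bind> P))" .
qed

end

section \<open>Path integrals and Feynman-Kac functions\<close>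

lemma
  fixes g :: "real \<Rightarrow> 'a \<Rightarrow> real"
  assumes Q: "prob_space Q"
    and g[measurable]: "(\<lambda>(s, w). g s w) \<in> borel_measurable (borel \<Otimes>\<^sub>M Q)"
    and bnd: "\<And>s w. a \<le> s \<Longrightarrow> s \<le> b \<Longrightarrow> w \<in> space Q \<Longrightarrow> \<bar>g s w\<bar> \<le> K"
  shows fubini_strip_eq:
      "(\<integral>w. (LINT s:{a..b}|lborel. g s w) \<partial>Q) = (LINT s:{a..b}|lborel. (\<integral>w. g s w \<partial>Q))"
    and fubini_strip_integrable: "set_integrable lborel {a..b} (\<lambda>s. \<integral>w. g s w \<partial>Q)"
proof -
  interpret Q: prob_space Q by fact
  interpret pair_sigma_finite lborel Q ..
  have int: "integrable (lborel \<Otimes>\<^sub>M Q) (\<lambda>(s, w). indicator {a..b} s *\<^sub>R g s w)"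
  proof (rule integrableI_bounded_set[where A="{a..b} \<times> space Q" and B=K])
    show "emeasure (lborel \<Otimes>\<^sub>M Q) ({a..b} \<times> space Q) < \<infinity>"
      by (subst Q.emeasure_pair_measure_Times) (auto simp: Q.emeasure_space_1 emeasure_lborel_Icc_eq)
    show "AE x in lborel \<Otimes>\<^sub>M Q. x \<in> {a..b} \<times> space Q \<longrightarrow>
            norm (case x of (s, w) \<Rightarrow> indicator {a..b} s *\<^sub>R g s w) \<le> K"
      using bnd by (intro AE_I2) auto
    show "AE x in lborel \<Otimes>\<^sub>M Q. x \<notin> {a..b} \<times> space Q \<longrightarrow>
            (case x of (s, w) \<Rightarrow> indicator {a..b} s *\<^sub>R g s w) = 0"
      by (intro AE_I2) (auto simp: space_pair_measure indicator_def split: if_splits)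
  qed measurable
  from Fubini_integral[OF int] show "(\<integral>w. (LINT s:{a..b}|lborel. g s w) \<partial>Q) =
      (LINT s:{a..b}|lborel. (\<integral>w. g s w \<partial>Q))"
    by (simp add: set_lebesgue_integral_def)
  from integrable_fst[OF int] show "set_integrable lborel {a..b} (\<lambda>s. \<integral>w. g s w \<partial>Q)"
    by (simp add: set_integrable_def)
qed

lemma set_integral_shift:
  fixes f :: "real \<Rightarrow> real"
  shows "(LINT s:{a..a + t}|lborel. f s) = (LINT r:{0..t}|lborel. f (a + r))"
    and "set_integrable lborel {a..a + t} f \<longleftrightarrow> set_integrable lborel {0..t} (\<lambda>r. f (a + r))"
proof -
  have ind: "indicator {a..a + t} (a + 1 * x) = (indicator {0..t} x :: real)" for x :: real
    by (auto split: split_indicator)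
  show "(LINT s:{a..a + t}|lborel. f s) = (LINT r:{0..t}|lborel. f (a + r))"
    unfolding set_lebesgue_integral_def
    by (subst lborel_integral_real_affine[where t=a and c=1]) (simp_all only: ind, simp_all)
  show "set_integrable lborel {a..a + t} f \<longleftrightarrow> set_integrable lborel {0..t} (\<lambda>r. f (a + r))"
    unfolding set_integrable_def
    by (subst lborel_integrable_real_affine_iff[where t=a and c=1, symmetric]) (simp_all only: ind, simp_all)
qed

lemma set_integral_power_scaled:
  "(LINT r:{0..s}|lborel. C * r ^ n) = C * (\<integral>r. r ^ n * indicator {0..s} r \<partial>lborel)" for C s :: real
proof -
  have "(\<lambda>r. indicator {0..s} r *\<^sub>R (C * r ^ n)) = (\<lambda>r. C * (r ^ n * indicator {0..s} r))"
    by (simp add: fun_eq_iff)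
  thus ?thesis unfolding set_lebesgue_integral_def by (simp only: integral_mult_right_zero)
qed

lemma power_fact_Suc:
  "C * b ^ Suc n / fact n * (s ^ Suc n / real (Suc n)) = C * (b * s) ^ Suc n / fact (Suc n)" for C b s :: real
proof -
  have "fact (Suc n) = real (Suc n) * fact n" by simp
  thus ?thesis by (simp only: power_mult_distrib times_divide_times_eq mult.assoc mult.commute[of "fact n"])
qed

lemma abs_le_power_fact_imp_zero:
  fixes d :: real
  assumes "\<And>n. \<bar>d\<bar> \<le> C * x ^ n / fact n"
  shows "d = 0"
proof -
  have "(\<lambda>n. C * (inverse (fact n) * x ^ n)) \<longlonglongrightarrow> C * 0"
    by (intro tendsto_mult tendsto_const summable_LIMSEQ_zero summable_exp)
  hence lim: "(\<lambda>n. C * x ^ n / fact n) \<longlonglongrightarrow> 0"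
    by (simp add: field_simps)
  have "\<bar>d\<bar> \<le> 0" by (rule LIMSEQ_le_const[OF lim]) (use assms in auto)
  thus ?thesis by simp
qed

context cadlag_markov_process
begin

definition path_integral :: "('x \<Rightarrow> real) \<Rightarrow> real \<Rightarrow> real \<Rightarrow> 'w \<Rightarrow> real" where
  "path_integral W a b w = (LINT s:{a..b}|lborel. W (X s w))"

text \<open>The process at negative times is arbitrary, so joint measurability is that of the clamped process,
  which agrees with it on the interval of integration.\<close>

lemma path_integral_clamped:
  assumes "0 \<le> a" "b \<le> c"
  shows "path_integral W a b w = (LINT s:{a..b}|lborel. W (X (max 0 (min s c)) w))"
  unfolding path_integral_def by (rule set_lebesgue_integral_cong) (use assms in auto)

context
  fixes W :: "'x \<Rightarrow> real" and B :: real
  assumes W[measurable]: "W \<in> borel_measurable borel" and WB: "\<And>y. \<bar>W y\<bar> \<le> B"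
begin

lemma path_measurable:
  assumes b: "0 \<le> b" and w[measurable]: "w \<in> space Om"
  shows "(\<lambda>s. W (X (max 0 (min s b)) w)) \<in> borel_measurable borel"
proof -
  note [measurable] = clamped_process_measurable[OF b]
  have "(\<lambda>s. W (case (s, w) of (s, w) \<Rightarrow> X (max 0 (min s b)) w)) \<in> borel_measurable borel"
    by measurable
  thus ?thesis by simp
qed

lemma path_set_integrable:
  assumes "0 \<le> a" "w \<in> space Om"
  shows "set_integrable lborel {a..b} (\<lambda>s. W (X s w))"
proof -
  have "set_integrable lborel {a..b} (\<lambda>s. W (X (max 0 (min s (max 0 b))) w))"
    by (rule set_integrable_if_bounded[where B=B]) (use path_measurable assms WB in auto)
  thus ?thesis
    by (rule set_integrable_cong[THEN iffD1, rotated 3]) (use assms in auto)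
qed

lemma abs_path_integral_le:
  assumes "0 \<le> a" "a \<le> b" "w \<in> space Om"
  shows "\<bar>path_integral W a b w\<bar> \<le> B * (b - a)"
  unfolding path_integral_clamped[OF assms(1) order_refl]
  by (rule abs_set_integral_le) (use path_measurable assms WB in auto)

lemma path_integral_split:
  assumes "0 \<le> a" "a \<le> b" "b \<le> c" "w \<in> space Om"
  shows "path_integral W a c w = path_integral W a b w + path_integral W b c w"
  unfolding path_integral_def by (rule set_integral_Icc_split) (use path_set_integrable assms in auto)

lemma path_integral_measurable_F:
  assumes "0 \<le> a" "0 \<le> b"
  shows "path_integral W a b \<in> borel_measurable (F b)"
proof -
  note [measurable] = clamped_process_measurable_F[OF assms(2)]
  have "(\<lambda>w. LINT s:{a..b}|lborel. W (case (s, w) of (s, w) \<Rightarrow> X (max 0 (min s b)) w)) \<in> borel_measurable (F b)"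
    by (rule borel_measurable_integral_upto) measurable
  thus ?thesis using path_integral_clamped[OF assms(1) order_refl, of W b] by (simp cong: measurable_cong)
qed

lemma path_integral_measurable:
  assumes "0 \<le> a" "0 \<le> b"
  shows "path_integral W a b \<in> borel_measurable Om"
  by (rule filtration_measurable_Om[OF assms(2) path_integral_measurable_F[OF assms]])

lemma path_integral_measurable_joint:
  assumes "0 \<le> a" "0 \<le> b"
  shows "(\<lambda>(s, w). path_integral W a (min s b) w) \<in> borel_measurable (borel \<Otimes>\<^sub>M Om)"
proof -
  note [measurable] = clamped_process_measurable[OF assms(2)]
  have "(\<lambda>z. LINT r:{a..min (fst z) b}|lborel. W (case (r, snd z) of (s, w) \<Rightarrow> X (max 0 (min s b)) w))
          \<in> borel_measurable (borel \<Otimes>\<^sub>M Om)"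
    by (rule borel_measurable_integral_upto) measurable
  also have "(\<lambda>z. LINT r:{a..min (fst z) b}|lborel. W (case (r, snd z) of (s, w) \<Rightarrow> X (max 0 (min s b)) w))
      = (\<lambda>(s, w). path_integral W a (min s b) w)"
    using path_integral_clamped[OF assms(1), of _ b W] by (auto simp: fun_eq_iff)
  finally show ?thesis .
qed

lemma exp_path_integral_le:
  assumes "0 \<le> a" "a \<le> b" "w \<in> space Om"
  shows "exp (path_integral W a b w) \<le> exp (B * (b - a))"
  using abs_path_integral_le[OF assms] by simp

lemma exp_path_integral_eq:
  assumes "0 \<le> a" "a \<le> b" and w: "w \<in> space Om"
  shows "exp (path_integral W a b w) = 1 + (LINT s:{a..b}|lborel. W (X s w) * exp (path_integral W a s w))"
proof -
  have b: "0 \<le> b" using assms by simp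
  have "exp (path_integral W a b w) = 1 + (LINT s:{a..b}|lborel. W (X (max 0 (min s b)) w) *
      exp (LINT r:{a..s}|lborel. W (X (max 0 (min r b)) w)))"
    unfolding path_integral_clamped[OF assms(1) order_refl]
    by (rule exp_set_integral_eq[OF path_measurable[OF b w] WB assms(2)])
  also have "(LINT s:{a..b}|lborel. W (X (max 0 (min s b)) w) *
      exp (LINT r:{a..s}|lborel. W (X (max 0 (min r b)) w)))
      = (LINT s:{a..b}|lborel. W (X s w) * exp (path_integral W a s w))"
  proof (rule set_lebesgue_integral_cong)
    show "\<forall>s. s \<in> {a..b} \<longrightarrow> W (X (max 0 (min s b)) w) * exp (LINT r:{a..s}|lborel. W (X (max 0 (min r b)) w))
       = W (X s w) * exp (path_integral W a s w)"
      using assms(1) path_integral_clamped[OF assms(1), of _ b W w] by (auto simp: max_def min_def)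
  qed simp
  finally show ?thesis .
qed

text \<open>The law of \<open>X (a + t)\<close> under \<open>Q\<close>, tilted by the exponential of the path integral since time \<open>a\<close>. Keeping a
  general terminal function \<open>\<phi>\<close> makes Duhamel's formula a closed recursion.\<close>

definition tilted :: "'w measure \<Rightarrow> real \<Rightarrow> real \<Rightarrow> ('x \<Rightarrow> real) \<Rightarrow> real" where
  "tilted Q a t \<phi> = (\<integral>w. exp (path_integral W a (a + t) w) * \<phi> (X (a + t) w) \<partial>Q)"

text \<open>Expand the exponential by \<open>exp_path_integral_eq\<close>, exchange the integrals, and for each intermediate
  time \<open>s\<close> replace the terminal function by its expectation given the past of \<open>s\<close>.\<close>

lemma tilted_duhamel:
  assumes Q: "markov_under Q" and a: "0 \<le> a" and t: "0 \<le> t"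
    and \<phi>[measurable]: "\<phi> \<in> borel_measurable borel" and \<phi>K: "\<And>y. \<bar>\<phi> y\<bar> \<le> K"
  shows "tilted Q a t \<phi> = (\<integral>w. sg t \<phi> (X a w) \<partial>Q)
           + (LINT r:{0..t}|lborel. tilted Q a r (\<lambda>y. W y * sg (t - r) \<phi> y))" (is ?eq)
    and "set_integrable lborel {0..t} (\<lambda>r. tilted Q a r (\<lambda>y. W y * sg (t - r) \<phi> y))" (is ?int)
proof -
  interpret Q: prob_space Q using Q by (simp add: markov_under_def)
  have sQ[measurable_cong]: "sets Q = sets Om" using Q by (simp add: markov_under_def)
  have spQ: "space Q = space Om" by (rule sets_eq_imp_space_eq[OF sQ])
  define b where "b = a + t"
  have b: "0 \<le> b" "a \<le> b" using a t by (auto simp: b_def)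
  have B0: "0 \<le> B" and K0: "0 \<le> K" using WB[of undefined] \<phi>K[of undefined] by linarith+
  note [measurable] = clamped_process_measurable[OF b(1)] path_integral_measurable_joint[OF a b(1)] X_measurable[OF b(1)]
  define g where "g s w = W (X (max 0 (min s b)) w) * exp (path_integral W a (min s b) w) * \<phi> (X b w)" for s w
  have g_meas: "(\<lambda>(s, w). g s w) \<in> borel_measurable (borel \<Otimes>\<^sub>M Q)"
  proof -
    have "(\<lambda>z. W (case z of (s, w) \<Rightarrow> X (max 0 (min s b)) w) * exp (case z of (s, w) \<Rightarrow> path_integral W a (min s b) w)
            * \<phi> (X b (snd z))) \<in> borel_measurable (borel \<Otimes>\<^sub>M Q)"
      by measurable
    thus ?thesis by (simp add: g_def case_prod_beta)
  qed
  have g_bnd: "\<bar>g s w\<bar> \<le> B * exp (B * t) * K" if "a \<le> s" "s \<le> b" "w \<in> space Q" for s w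
  proof -
    have "exp (path_integral W a s w) \<le> exp (B * (s - a))"
      using that a spQ by (intro exp_path_integral_le) auto
    also have "\<dots> \<le> exp (B * t)" using that B0 by (auto simp: b_def intro!: mult_left_mono)
    finally have "exp (path_integral W a s w) \<le> exp (B * t)" .
    thus ?thesis using that WB \<phi>K B0 unfolding g_def abs_mult by (intro mult_mono) auto
  qed
  have step: "(\<integral>w. g s w \<partial>Q) = tilted Q a (s - a) (\<lambda>y. W y * sg (b - s) \<phi> y)"
    if s: "a \<le> s" "s \<le> b" for s
  proof -
    have s0: "0 \<le> s" "0 \<le> b - s" using s a by auto
    have Z: "(\<lambda>w. W (X s w) * exp (path_integral W a s w)) \<in> borel_measurable (F s)"
      using path_integral_measurable_F[OF a s0(1)] adapted[OF s0(1)] by measurable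
    have "\<bar>W (X s w) * exp (path_integral W a s w)\<bar> \<le> B * exp (B * (s - a))" if "w \<in> space Om" for w
      using exp_path_integral_le[OF a s(1) that] WB B0 unfolding abs_mult by (intro mult_mono) auto
    from markov_underD[OF Q s0 \<phi> \<phi>K Z this]
    have "(\<integral>w. W (X s w) * exp (path_integral W a s w) * \<phi> (X (s + (b - s)) w) \<partial>Q) =
      (\<integral>w. W (X s w) * exp (path_integral W a s w) * sg (b - s) \<phi> (X s w) \<partial>Q)" .
    thus ?thesis using s s0 by (simp add: g_def tilted_def ac_simps min_absorb1)
  qed
  have int_s: "set_integrable lborel {a..b} (\<lambda>s. tilted Q a (s - a) (\<lambda>y. W y * sg (b - s) \<phi> y))"
    by (rule set_integrable_cong[THEN iffD1, OF refl refl _ fubini_strip_integrable[OF Q.prob_space_axioms g_meas g_bnd]])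
       (use step in auto)
  thus ?int unfolding b_def set_integral_shift(2) by simp
  have \<phi>_int: "integrable Q (\<lambda>w. \<phi> (X b w))"
    by (rule integrable_bounded_finite[where K=K]) (use \<phi>K in \<open>auto simp: Q.finite_measure_axioms\<close>)
  have "(\<integral>w. exp (path_integral W a b w) * \<phi> (X b w) \<partial>Q)
      = (\<integral>w. \<phi> (X b w) + (LINT s:{a..b}|lborel. g s w) \<partial>Q)"
  proof (rule Bochner_Integration.integral_cong[OF refl])
    fix w assume "w \<in> space Q"
    hence w: "w \<in> space Om" by (simp add: spQ)
    have "(LINT s:{a..b}|lborel. g s w) = (LINT s:{a..b}|lborel. (W (X s w) * exp (path_integral W a s w)) * \<phi> (X b w))"
      by (rule set_lebesgue_integral_cong) (use a in \<open>auto simp: g_def max_def min_def\<close>)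
    also have "\<dots> = (LINT s:{a..b}|lborel. W (X s w) * exp (path_integral W a s w)) * \<phi> (X b w)"
      by simp
    finally show "exp (path_integral W a b w) * \<phi> (X b w) = \<phi> (X b w) + (LINT s:{a..b}|lborel. g s w)"
      unfolding exp_path_integral_eq[OF a b(2) w] by (simp add: algebra_simps)
  qed
  also have "\<dots> = (\<integral>w. \<phi> (X b w) \<partial>Q) + (\<integral>w. (LINT s:{a..b}|lborel. g s w) \<partial>Q)"
  proof (rule Bochner_Integration.integral_add[OF \<phi>_int])
    show "integrable Q (\<lambda>w. LINT s:{a..b}|lborel. g s w)"
    proof (rule integrable_bounded_finite[where K="B * exp (B * t) * K * (b - a)"])
      show "(\<lambda>w. LINT s:{a..b}|lborel. g s w) \<in> borel_measurable Q"
        using g_meas by (intro borel_measurable_integral_upto) (auto simp: measurable_pair_swap_iff[of _ Q])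
      fix w assume w: "w \<in> space Q"
      have "(\<lambda>s. g s w) \<in> borel_measurable borel"
        using measurable_compose[OF measurable_Pair1'[OF w] measurable_pair_swap[OF g_meas]] by (simp add: case_prod_beta)
      from abs_set_integral_le[OF this g_bnd[OF _ _ w] b(2)]
      show "\<bar>LINT s:{a..b}|lborel. g s w\<bar> \<le> B * exp (B * t) * K * (b - a)" by simp
    qed (rule Q.finite_measure_axioms)
  qed
  also have "(\<integral>w. (LINT s:{a..b}|lborel. g s w) \<partial>Q) = (LINT s:{a..b}|lborel. (\<integral>w. g s w \<partial>Q))"
    by (rule fubini_strip_eq[OF Q.prob_space_axioms g_meas g_bnd])
  also have "\<dots> = (LINT s:{a..b}|lborel. tilted Q a (s - a) (\<lambda>y. W y * sg (b - s) \<phi> y))"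
    by (rule set_lebesgue_integral_cong) (use step in auto)
  also have "\<dots> = (LINT r:{0..t}|lborel. tilted Q a r (\<lambda>y. W y * sg (t - r) \<phi> y))"
    unfolding b_def set_integral_shift(1) by simp
  also have "(\<integral>w. \<phi> (X b w) \<partial>Q) = (\<integral>w. sg t \<phi> (X a w) \<partial>Q)"
    using markov_underD[OF Q a t \<phi> \<phi>K, of "\<lambda>_. 1" 1] by (simp add: b_def)
  finally show ?eq by (simp add: tilted_def b_def)
qed

text \<open>The Markov property for functionals of the whole path. By Duhamel's formula the difference of the two
  sides is the time integral of such differences for terminal functions enlarged by a factor \<open>B\<close> at
  most. Iterating \<open>n\<close> times bounds it by a constant times \<open>(B t)\<^sup>n / n!\<close>, so it vanishes.\<close>

lemma tilted_determined_by_start: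
  assumes Q: "markov_under Q" "markov_under Q'" and a: "0 \<le> a" "0 \<le> a'"
    and law: "\<And>(\<psi> :: 'x \<Rightarrow> real) K. \<psi> \<in> borel_measurable borel \<Longrightarrow> (\<And>y. \<bar>\<psi> y\<bar> \<le> K) \<Longrightarrow>
                (\<integral>w. \<psi> (X a w) \<partial>Q) = (\<integral>w. \<psi> (X a' w) \<partial>Q')"
    and t: "0 \<le> t" and \<phi>: "\<phi> \<in> borel_measurable borel" "\<And>y. \<bar>\<phi> y\<bar> \<le> K"
  shows "tilted Q a t \<phi> = tilted Q' a' t \<phi>"
proof -
  \<comment> \<open>a fixed horizon, so that the constant does not change while the induction moves the time\<close>
  define T where "T = t"
  have B0: "0 \<le> B" using WB[of undefined] by linarith
  have bound: "\<bar>tilted R c s \<psi>\<bar> \<le> exp (B * T) * L"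
    if R: "markov_under R" and c: "0 \<le> c" and s: "0 \<le> s" "s \<le> T" and \<psi>: "\<And>y. \<bar>\<psi> y\<bar> \<le> L"
    for R c s \<psi> L
    unfolding tilted_def
  proof (rule abs_integral_prob_le)
    show "prob_space R" using R by (simp add: markov_under_def)
    fix w assume "w \<in> space R"
    hence w: "w \<in> space Om" using R sets_eq_imp_space_eq[of R Om] by (simp add: markov_under_def)
    have "exp (path_integral W c (c + s) w) \<le> exp (B * (c + s - c))"
      using c s by (intro exp_path_integral_le[OF _ _ w]) auto
    also have "\<dots> \<le> exp (B * T)" using s B0 by (auto intro!: mult_left_mono)
    finally show "\<bar>exp (path_integral W c (c + s) w) * \<psi> (X (c + s) w)\<bar> \<le> exp (B * T) * L"
      using \<psi> unfolding abs_mult by (intro mult_mono) auto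
  qed
  have gronwall: "\<bar>tilted Q a s \<psi> - tilted Q' a' s \<psi>\<bar> \<le> (2 * exp (B * T) * L) * (B * s) ^ n / fact n"
    if "0 \<le> s" "s \<le> T" "\<psi> \<in> borel_measurable borel" "\<And>y. \<bar>\<psi> y\<bar> \<le> L" for n s \<psi> L
    using that
  proof (induction n arbitrary: s \<psi> L)
    case 0
    thus ?case using bound[OF Q(1) a(1), of s \<psi> L] bound[OF Q(2) a(2), of s \<psi> L] by simp
  next
    case (Suc n)
    let ?\<psi> = "\<lambda>r y. W y * sg (s - r) \<psi> y"
    have L0: "0 \<le> L" using Suc.prems(4)[of undefined] by linarith
    have sgL: "\<bar>sg s \<psi> y\<bar> \<le> L" for y by (rule semigroup_bounded[OF Suc.prems(4)])
    note D = tilted_duhamel[OF Q(1) a(1) Suc.prems(1,3,4)]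
    note D' = tilted_duhamel[OF Q(2) a(2) Suc.prems(1,3,4)]
    have int: "set_integrable lborel {0..s} (\<lambda>r. tilted Q a r (?\<psi> r) - tilted Q' a' r (?\<psi> r))"
      by (rule set_integral_diff(1)[OF D(2) D'(2)])
    have split: "tilted Q a s \<psi> - tilted Q' a' s \<psi> = (LINT r:{0..s}|lborel. tilted Q a r (?\<psi> r) - tilted Q' a' r (?\<psi> r))"
      unfolding D(1) D'(1) set_integral_diff(2)[OF D(2) D'(2)]
      using law[where \<psi>="sg s \<psi>", OF semigroup_measurable[OF Suc.prems(1,3)] sgL] by simp
    have "\<bar>tilted Q a s \<psi> - tilted Q' a' s \<psi>\<bar> \<le> (LINT r:{0..s}|lborel. (2 * exp (B * T) * L) * B ^ Suc n / fact n * r ^ n)"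
      unfolding split set_lebesgue_integral_def
    proof (rule integral_abs_bound_integral)
      show "integrable lborel (\<lambda>r. indicator {0..s} r *\<^sub>R (tilted Q a r (?\<psi> r) - tilted Q' a' r (?\<psi> r)))"
        using int by (simp add: set_integrable_def)
      show "integrable lborel (\<lambda>r. indicator {0..s} r *\<^sub>R ((2 * exp (B * T) * L) * B ^ Suc n / fact n * r ^ n))"
        by (intro borel_integrable_atLeastAtMost' [unfolded set_integrable_def] continuous_intros)
      fix r :: real
      show "\<bar>indicator {0..s} r *\<^sub>R (tilted Q a r (?\<psi> r) - tilted Q' a' r (?\<psi> r))\<bar>
          \<le> indicator {0..s} r *\<^sub>R ((2 * exp (B * T) * L) * B ^ Suc n / fact n * r ^ n)"
      proof (cases "r \<in> {0..s}")
        case True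
        have "\<bar>tilted Q a r (?\<psi> r) - tilted Q' a' r (?\<psi> r)\<bar>
            \<le> (2 * exp (B * T) * (B * L)) * (B * r) ^ n / fact n"
        proof (rule Suc.IH)
          show "?\<psi> r \<in> borel_measurable borel"
            using semigroup_measurable[OF _ Suc.prems(3), of "s - r"] True by auto
          have sgr: "\<bar>sg (s - r) \<psi> y\<bar> \<le> L" for y by (rule semigroup_bounded[OF Suc.prems(4)])
          show "\<bar>?\<psi> r y\<bar> \<le> B * L" for y
            using WB[of y] sgr[of y] B0
            unfolding abs_mult by (intro mult_mono) auto
        qed (use True Suc.prems in auto)
        also have "\<dots> = (2 * exp (B * T) * L) * B ^ Suc n / fact n * r ^ n"
          by (simp add: power_mult_distrib)
        finally show ?thesis using True by simp
      qed simp
    qed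
    moreover have "(LINT r:{0..s}|lborel. (2 * exp (B * T) * L) * B ^ Suc n / fact n * r ^ n)
        = (2 * exp (B * T) * L) * B ^ Suc n / fact n * (\<integral>r. r ^ n * indicator {0..s} r \<partial>lborel)"
      by (rule set_integral_power_scaled)
    moreover have "(\<integral>r. r ^ n * indicator {0..s} r \<partial>lborel) = s ^ Suc n / Suc n"
      using integral_power[OF Suc.prems(1), of n] by simp
    moreover have "(2 * exp (B * T) * L) * B ^ Suc n / fact n * (s ^ Suc n / Suc n)
        = (2 * exp (B * T) * L) * (B * s) ^ Suc n / fact (Suc n)"
      by (rule power_fact_Suc)
    ultimately show ?case by (simp only:)
  qed
  have "tilted Q a t \<phi> - tilted Q' a' t \<phi> = 0"
    by (rule abs_le_power_fact_imp_zero, rule gronwall) (use t \<phi> in \<open>auto simp: T_def\<close>)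
  thus ?thesis by simp
qed

definition feynman_kac :: "real \<Rightarrow> 'x \<Rightarrow> real" where
  "feynman_kac t y = (\<integral>w. exp (path_integral W 0 t w) \<partial>P y)"

lemma feynman_kac_measurable: "0 \<le> t \<Longrightarrow> feynman_kac t \<in> borel_measurable borel"
  unfolding feynman_kac_def[abs_def]
  by (rule borel_measurable_integral_kernel) (use path_integral_measurable[of 0 t] in measurable)

lemma feynman_kac_bounds:
  assumes t: "0 \<le> t"
  shows "0 \<le> feynman_kac t y" "feynman_kac t y \<le> exp (B * t)" "\<bar>feynman_kac t y\<bar> \<le> exp (B * t)"
proof -
  show "0 \<le> feynman_kac t y" unfolding feynman_kac_def by (rule Bochner_Integration.integral_nonneg) auto
  show "\<bar>feynman_kac t y\<bar> \<le> exp (B * t)"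
    unfolding feynman_kac_def by (rule abs_integral_prob_le[OF prob_space_P]) (use exp_path_integral_le[of 0 t] t in \<open>auto simp: space_P\<close>)
  thus "feynman_kac t y \<le> exp (B * t)" by simp
qed

text \<open>The process shifted by \<open>h\<close> under \<open>P x\<close>, and the process started from the law of \<open>X h\<close>, have the same initial law,
  so \<open>tilted_determined_by_start\<close> applies with the constant terminal function \<open>1\<close>.\<close>

lemma feynman_kac_markov:
  assumes h: "0 \<le> h" and t: "0 \<le> t"
  shows "sg h (feynman_kac t) x = (\<integral>w. exp (path_integral W h (h + t) w) \<partial>P x)"
proof -
  note [measurable] = X_measurable[OF h] X_measurable[of 0, simplified]
  note [measurable_cong] = sets_P
  define \<nu> where "\<nu> = distr (P x) borel (X h)"
  have \<nu>: "prob_space \<nu>" "sets \<nu> = sets borel"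
    unfolding \<nu>_def by (auto intro!: prob_space.prob_space_distr prob_space_P)
  have "tilted (P x) h t (\<lambda>_. 1) = tilted (\<nu> \<bind> P) 0 t (\<lambda>_. 1)"
  proof (rule tilted_determined_by_start[OF markov_under_P markov_under_mixture[OF \<nu>] h order_refl _ t])
    fix \<psi> :: "'x \<Rightarrow> real" and K assume \<psi>[measurable]: "\<psi> \<in> borel_measurable borel" and K: "\<And>y. \<bar>\<psi> y\<bar> \<le> K"
    have "(\<integral>w. \<psi> (X 0 w) \<partial>(\<nu> \<bind> P)) = (\<integral>y. (\<integral>w. \<psi> (X 0 w) \<partial>P y) \<partial>\<nu>)"
      by (rule integral_mixture[OF \<nu> _ K]) measurable
    also have "\<dots> = (\<integral>y. \<psi> y \<partial>\<nu>)"
    proof (rule Bochner_Integration.integral_cong[OF refl])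
      fix y
      interpret Py: prob_space "P y" by (rule prob_space_P)
      have "(\<integral>w. \<psi> (X 0 w) \<partial>P y) = (\<integral>w. \<psi> y \<partial>P y)"
        by (rule integral_cong_AE) (use start[of y] in auto)
      thus "(\<integral>w. \<psi> (X 0 w) \<partial>P y) = \<psi> y" by (simp add: Py.prob_space)
    qed
    also have "\<dots> = (\<integral>w. \<psi> (X h w) \<partial>P x)" unfolding \<nu>_def by (rule integral_distr) measurable
    finally show "(\<integral>w. \<psi> (X h w) \<partial>P x) = (\<integral>w. \<psi> (X 0 w) \<partial>(\<nu> \<bind> P))" by simp
  qed auto
  also have "\<dots> = (\<integral>w. exp (path_integral W 0 t w) \<partial>(\<nu> \<bind> P))" by (simp add: tilted_def)
  also have "\<dots> = (\<integral>y. feynman_kac t y \<partial>\<nu>)"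
    unfolding feynman_kac_def
    by (rule integral_mixture[OF \<nu>, where K="exp (B * t)"])
       (use path_integral_measurable[of 0 t] exp_path_integral_le[of 0 t] t in auto)
  also have "\<dots> = sg h (feynman_kac t) x"
    unfolding \<nu>_def markov_semigroup_def by (rule integral_distr) (use feynman_kac_measurable[OF t] in measurable)
  finally show ?thesis by (simp add: tilted_def)
qed

end

end

section \<open>Continuity in mean of the stationary process\<close>

context cadlag_markov_process
begin

context
  fixes mu :: "'x measure"
  assumes inv: "invariant_measure X P mu"
begin

lemma prob_space_mu: "prob_space mu" and sets_mu: "sets mu = sets borel"
  using inv by (auto simp: invariant_measure_def)

abbreviation "Pmu \<equiv> mu \<bind> P"

lemma prob_space_Pmu: "prob_space Pmu" and sets_Pmu: "sets Pmu = sets Om" and space_Pmu: "space Pmu = space Om"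
  using prob_space_mixture[OF prob_space_mu sets_mu] by auto

lemma distr_Pmu: "0 \<le> t \<Longrightarrow> distr Pmu borel (X t) = mu"
  using inv by (simp add: invariant_measure_def)

lemma X_measurable_Pmu: "0 \<le> t \<Longrightarrow> X t \<in> Pmu \<rightarrow>\<^sub>M borel"
  using X_measurable[of t] by (simp add: measurable_def sets_Pmu space_Pmu)

lemma stationary_integral:
  fixes g :: "'x \<Rightarrow> real"
  assumes t: "0 \<le> t" and g: "g \<in> borel_measurable borel"
  shows "(\<integral>w. g (X t w) \<partial>Pmu) = (\<integral>x. g x \<partial>mu)"
  using integral_distr[OF X_measurable_Pmu[OF t] g] by (simp add: distr_Pmu[OF t])

lemma stationary_integrable:
  fixes g :: "'x \<Rightarrow> real"
  assumes t: "0 \<le> t" and g: "integrable mu g"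
  shows "integrable Pmu (\<lambda>w. g (X t w))"
proof -
  have "g \<in> borel_measurable borel" using borel_measurable_integrable[OF g] sets_mu by (simp cong: measurable_cong_sets)
  from integrable_distr_eq[OF X_measurable_Pmu[OF t] this] show ?thesis using g by (simp add: distr_Pmu[OF t])
qed

text \<open>Right continuity in mean of \<open>g(X\<^sub>t)\<close> for the stationary process. It holds for every integrable \<open>g\<close>, although \<open>g\<close>
  may be discontinuous everywhere.\<close>

definition l1_right_cont :: "('x \<Rightarrow> real) \<Rightarrow> bool" where
  "l1_right_cont g \<longleftrightarrow> (\<forall>t\<ge>0. ((\<lambda>s. \<integral>w. \<bar>g (X s w) - g (X t w)\<bar> \<partial>Pmu) \<longlongrightarrow> 0) (at_right t))"

text \<open>By stationarity, replacing \<open>g\<close> by \<open>g'\<close> costs at most twice the \<open>L\<^sup>1(\<mu>)\<close>-distance, whatever the time.\<close>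

lemma l1_right_cont_approx:
  assumes g: "integrable mu g"
    and appr: "\<And>e. 0 < e \<Longrightarrow> \<exists>g'. integrable mu g' \<and> l1_right_cont g' \<and> (\<integral>x. \<bar>g x - g' x\<bar> \<partial>mu) \<le> e"
  shows "l1_right_cont g"
  unfolding l1_right_cont_def
proof (intro allI impI tendstoI)
  fix t e :: real assume t: "0 \<le> t" and e: "0 < e"
  obtain g' where g': "integrable mu g'" "l1_right_cont g'" "(\<integral>x. \<bar>g x - g' x\<bar> \<partial>mu) \<le> e / 4"
    using appr[of "e / 4"] e by auto
  have diff: "integrable mu (\<lambda>x. \<bar>g x - g' x\<bar>)" using g g'(1) by (intro integrable_abs) auto
  have dmeas: "(\<lambda>x. \<bar>g x - g' x\<bar>) \<in> borel_measurable borel"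
    using borel_measurable_integrable[OF diff] sets_mu by (simp cong: measurable_cong_sets)
  have "((\<lambda>s. \<integral>w. \<bar>g' (X s w) - g' (X t w)\<bar> \<partial>Pmu) \<longlongrightarrow> 0) (at_right t)"
    using g'(2) t by (simp add: l1_right_cont_def)
  from tendstoD[OF this, of "e / 4"] e
  have "\<forall>\<^sub>F s in at_right t. (\<integral>w. \<bar>g' (X s w) - g' (X t w)\<bar> \<partial>Pmu) < e / 4"
    by (auto elim: eventually_mono)
  moreover have "\<forall>\<^sub>F s in at_right t. t < s" by (simp add: eventually_at_right_less)
  ultimately show "\<forall>\<^sub>F s in at_right t. dist (\<integral>w. \<bar>g (X s w) - g (X t w)\<bar> \<partial>Pmu) 0 < e"
  proof eventually_elim
    case (elim s)
    hence s: "0 \<le> s" using t by simp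
    note i = stationary_integrable[OF s g] stationary_integrable[OF t g]
      stationary_integrable[OF s g'(1)] stationary_integrable[OF t g'(1)]
      stationary_integrable[OF s diff] stationary_integrable[OF t diff]
    have "(\<integral>w. \<bar>g (X s w) - g (X t w)\<bar> \<partial>Pmu)
        \<le> (\<integral>w. \<bar>g (X s w) - g' (X s w)\<bar> + \<bar>g (X t w) - g' (X t w)\<bar> + \<bar>g' (X s w) - g' (X t w)\<bar> \<partial>Pmu)"
      by (rule integral_mono) (use i in auto)
    also have "\<dots> = (\<integral>w. \<bar>g (X s w) - g' (X s w)\<bar> \<partial>Pmu) + (\<integral>w. \<bar>g (X t w) - g' (X t w)\<bar> \<partial>Pmu)
        + (\<integral>w. \<bar>g' (X s w) - g' (X t w)\<bar> \<partial>Pmu)"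
      using i by simp
    also have "\<dots> < e / 4 + e / 4 + e / 2"
      using stationary_integral[OF s dmeas] stationary_integral[OF t dmeas] g'(3) elim e by linarith
    finally show ?case by simp
  qed
qed

text \<open>A path that is in the open set \<open>U\<close> at time \<open>t\<close> stays there for a while, so it is unlikely to be in \<open>U\<close> at \<open>t\<close> and
  outside at \<open>s\<close>. The reverse event has the same probability, since \<open>X s\<close> and \<open>X t\<close> have the same law.\<close>

lemma l1_right_cont_open:
  assumes U: "open U"
  shows "l1_right_cont (indicator U)"
  unfolding l1_right_cont_def
proof (intro allI impI)
  fix t :: real assume t: "0 \<le> t"
  interpret Q: prob_space Pmu by (rule prob_space_Pmu)
  note [measurable] = borel_open[OF U]
  let ?f = "\<lambda>s w. indicator U (X t w) * (1 - indicator U (X s w)) :: real"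
  have eq: "(\<integral>w. \<bar>indicator U (X s w) - indicator U (X t w) :: real\<bar> \<partial>Pmu) = 2 * (\<integral>w. ?f s w \<partial>Pmu)"
    if s: "0 \<le> s" for s
  proof -
    note [measurable] = X_measurable_Pmu[OF t] X_measurable_Pmu[OF s]
    have i: "integrable Pmu (?f s)"
      by (rule integrable_bounded_finite[where K=1]) (auto simp: Q.finite_measure_axioms split: split_indicator)
    have i': "integrable Pmu (\<lambda>w. indicator U (X r w) :: real)" if [measurable]: "X r \<in> Pmu \<rightarrow>\<^sub>M borel" for r
      by (rule integrable_bounded_finite[where K=1]) (auto simp: Q.finite_measure_axioms split: split_indicator)
    note i = i i'[OF X_measurable_Pmu[OF t]] i'[OF X_measurable_Pmu[OF s]]
    have "(\<integral>w. \<bar>indicator U (X s w) - indicator U (X t w) :: real\<bar> \<partial>Pmu)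
        = (\<integral>w. indicator U (X s w) - indicator U (X t w) + 2 * ?f s w \<partial>Pmu)"
      by (rule Bochner_Integration.integral_cong) (auto split: split_indicator)
    also have "\<dots> = (\<integral>w. indicator U (X s w) \<partial>Pmu) - (\<integral>w. indicator U (X t w) \<partial>Pmu) + 2 * (\<integral>w. ?f s w \<partial>Pmu)"
      using i by (subst Bochner_Integration.integral_add) (auto simp: Bochner_Integration.integral_diff)
    also have "(\<integral>w. indicator U (X s w) \<partial>Pmu) = (\<integral>w. indicator U (X t w) \<partial>Pmu :: real)"
      using stationary_integral[OF s, of "indicator U"] stationary_integral[OF t, of "indicator U"] by simp
    finally show ?thesis by simp
  qed
  show "((\<lambda>s. \<integral>w. \<bar>indicator U (X s w) - indicator U (X t w) :: real\<bar> \<partial>Pmu) \<longlongrightarrow> 0) (at_right t)"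
  proof (rule tendsto_at_right_sequentially[of t "t + 1"])
    fix S assume S: "\<And>n. t < S n" "\<And>n. S n < t + 1" "decseq S" "S \<longlonglongrightarrow> t"
    hence S0: "0 \<le> S n" for n using t by (meson less_imp_le order_trans)
    have "(\<lambda>n. \<integral>w. ?f (S n) w \<partial>Pmu) \<longlonglongrightarrow> (\<integral>w. 0 \<partial>Pmu)"
    proof (rule integral_dominated_convergence[where w="\<lambda>_. 1"])
      show "?f (S n) \<in> borel_measurable Pmu" for n
        using X_measurable_Pmu[OF t] X_measurable_Pmu[OF S0[of n]] by measurable
      show "AE w in Pmu. (\<lambda>n. ?f (S n) w) \<longlonglongrightarrow> 0"
      proof (rule AE_I2)
        fix w assume "w \<in> space Pmu"
        hence "((\<lambda>s. X s w) \<longlongrightarrow> X t w) (at_right t)" using right_cont[of w t] t by (simp add: space_Pmu)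
        moreover have "filterlim S (at_right t) sequentially"
        proof -
          have "S n \<noteq> t" for n using S(1)[of n] by simp
          thus ?thesis using S(1,4) by (simp add: filterlim_at)
        qed
        ultimately have lim: "(\<lambda>n. X (S n) w) \<longlonglongrightarrow> X t w" by (rule filterlim_compose)
        show "(\<lambda>n. ?f (S n) w) \<longlonglongrightarrow> 0"
        proof (cases "X t w \<in> U")
          case True
          from topological_tendstoD[OF lim U this]
          have "\<forall>\<^sub>F n in sequentially. ?f (S n) w = 0" by eventually_elim auto
          thus ?thesis by (rule tendsto_eventually)
        qed simp
      qed
    qed (auto split: split_indicator)
    hence "(\<lambda>n. 2 * (\<integral>w. ?f (S n) w \<partial>Pmu)) \<longlonglongrightarrow> 2 * 0"
      by (intro tendsto_mult tendsto_const) simp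
    thus "(\<lambda>n. \<integral>w. \<bar>indicator U (X (S n) w) - indicator U (X t w) :: real\<bar> \<partial>Pmu) \<longlonglongrightarrow> 0"
      by (simp add: eq[OF S0])
  qed simp
qed

lemma l1_right_cont_indicator:
  assumes A: "A \<in> sets borel"
  shows "l1_right_cont (indicator A)"
proof (rule l1_right_cont_approx)
  interpret mu: prob_space mu by (rule prob_space_mu)
  note [measurable] = A
  note [measurable_cong] = sets_mu
  show "integrable mu (indicator A :: 'x \<Rightarrow> real)"
    by (rule integrable_bounded_finite[where K=1]) (auto simp: mu.finite_measure_axioms split: split_indicator)
  fix e :: real assume e: "0 < e"
  have "(INF U \<in> {U. A \<subseteq> U \<and> open U}. emeasure mu U) = emeasure mu A"
    by (rule outer_regular[symmetric, OF sets_mu _ A]) simp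
  also have "\<dots> < emeasure mu A + ennreal e"
    using e by (simp add: mu.emeasure_eq_measure ennreal_plus[symmetric] ennreal_less_iff del: ennreal_plus)
  finally obtain U where U: "A \<subseteq> U" "open U" "emeasure mu U < emeasure mu A + ennreal e"
    by (auto simp: INF_less_iff)
  note [measurable] = borel_open[OF U(2)]
  have "measure mu U < measure mu A + e"
    using U(3) e by (simp add: mu.emeasure_eq_measure ennreal_plus[symmetric] ennreal_less_iff del: ennreal_plus)
  moreover have "measure mu (U - A) = measure mu U - measure mu A"
    using U(1) by (intro mu.finite_measure_Diff) auto
  moreover have "(\<integral>x. \<bar>indicator A x - indicator U x :: real\<bar> \<partial>mu) = (\<integral>x. indicator (U - A) x \<partial>mu)"
    by (rule Bochner_Integration.integral_cong) (use U(1) in \<open>auto split: split_indicator\<close>)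
  moreover have "(\<integral>x. indicator (U - A) x \<partial>mu) = measure mu (U - A)"
    by simp
  moreover have "integrable mu (indicator U :: 'x \<Rightarrow> real)"
  proof (rule integrable_bounded_finite[where K=1])
    show "(indicator U :: 'x \<Rightarrow> real) \<in> borel_measurable mu" by measurable
  qed (auto simp: mu.finite_measure_axioms split: split_indicator)
  ultimately show "\<exists>g'. integrable mu g' \<and> l1_right_cont g' \<and> (\<integral>x. \<bar>indicator A x - g' x\<bar> \<partial>mu) \<le> e"
    using l1_right_cont_open[OF U(2)] by (intro exI[of _ "indicator U"]) simp
qed

lemma l1_right_cont:
  assumes "integrable mu g"
  shows "l1_right_cont g"
  using assms
proof (induction rule: integrable_induct)
  case (base A c)
  have A: "A \<in> sets borel" using base sets_mu by simp
  have "((\<lambda>s. \<bar>c\<bar> * (\<integral>w. \<bar>indicator A (X s w) - indicator A (X t w)\<bar> \<partial>Pmu)) \<longlongrightarrow> \<bar>c\<bar> * 0) (at_right t)"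
    if "0 \<le> t" for t
    using l1_right_cont_indicator[OF A] that unfolding l1_right_cont_def
    by (intro tendsto_mult tendsto_const) auto
  moreover have "(\<integral>w. \<bar>indicator A (X s w) * c - indicator A (X t w) * c\<bar> \<partial>Pmu)
      = \<bar>c\<bar> * (\<integral>w. \<bar>indicator A (X s w) - indicator A (X t w)\<bar> \<partial>Pmu)" for s t
    unfolding integral_mult_right_zero[symmetric] abs_mult[symmetric] by (simp add: algebra_simps)
  ultimately show ?case by (simp add: l1_right_cont_def)
next
  case (add f g)
  show ?case unfolding l1_right_cont_def
  proof (intro allI impI)
    fix t :: real assume t: "0 \<le> t"
    let ?D = "\<lambda>f s. \<integral>w. \<bar>f (X s w) - f (X t w)\<bar> \<partial>Pmu"
    have "((\<lambda>s. ?D f s + ?D g s) \<longlongrightarrow> 0 + 0) (at_right t)"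
      using add.IH t by (intro tendsto_add) (auto simp: l1_right_cont_def)
    hence lim: "((\<lambda>s. ?D f s + ?D g s) \<longlongrightarrow> 0) (at_right t)" by simp
    have "\<forall>\<^sub>F s in at_right t. norm (?D (\<lambda>x. f x + g x) s) \<le> ?D f s + ?D g s"
      using eventually_at_right_less[of t]
    proof eventually_elim
      case (elim s)
      hence s: "0 \<le> s" using t by simp
      note i = stationary_integrable[OF s add.hyps(1)] stationary_integrable[OF t add.hyps(1)]
        stationary_integrable[OF s add.hyps(2)] stationary_integrable[OF t add.hyps(2)]
      have "?D (\<lambda>x. f x + g x) s \<le> (\<integral>w. \<bar>f (X s w) - f (X t w)\<bar> + \<bar>g (X s w) - g (X t w)\<bar> \<partial>Pmu)"
        by (rule integral_mono) (use i in auto)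
      also have "\<dots> = ?D f s + ?D g s" using i by simp
      finally show ?case by (simp add: Bochner_Integration.integral_nonneg)
    qed
    from Lim_null_comparison[OF this lim]
    show "(?D (\<lambda>x. f x + g x) \<longlongrightarrow> 0) (at_right t)" .
  qed
next
  case (lim f s)
  show ?case
  proof (rule l1_right_cont_approx[OF lim.hyps(4)])
    fix e :: real assume e: "0 < e"
    have "(\<lambda>i. \<integral>x. \<bar>f x - s i x\<bar> \<partial>mu) \<longlonglongrightarrow> (\<integral>x. 0 \<partial>mu)"
    proof (rule integral_dominated_convergence[where w="\<lambda>x. 3 * \<bar>f x\<bar>"])
      show "(\<lambda>x. \<bar>f x - s i x\<bar>) \<in> borel_measurable mu" for i
        using borel_measurable_integrable[OF lim.hyps(4)] borel_measurable_integrable[OF lim.hyps(1)] by measurable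
      show "AE x in mu. (\<lambda>i. \<bar>f x - s i x\<bar>) \<longlonglongrightarrow> 0"
      proof (rule AE_I2)
        fix x assume "x \<in> space mu"
        from tendsto_diff[OF tendsto_const lim.hyps(2)[OF this], of "f x"]
        show "(\<lambda>i. \<bar>f x - s i x\<bar>) \<longlonglongrightarrow> 0" by (intro tendsto_rabs_zero) simp
      qed
      show "AE x in mu. norm \<bar>f x - s i x\<bar> \<le> 3 * \<bar>f x\<bar>" for i
        using lim.hyps(3)[of _ i] by (intro AE_I2) fastforce
    qed (use lim.hyps(4) in auto)
    from order_tendstoD(2)[OF this, of e] e
    obtain i where "(\<integral>x. \<bar>f x - s i x\<bar> \<partial>mu) < e" by (auto simp: eventually_sequentially)
    thus "\<exists>g'. integrable mu g' \<and> l1_right_cont g' \<and> (\<integral>x. \<bar>f x - g' x\<bar> \<partial>mu) \<le> e"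
      using lim.hyps(1)[of i] lim.IH[of i] by (intro exI[of _ "s i"]) auto
  qed
qed

end

end

section \<open>The evolution equation of the Feynman-Kac function\<close>

lemma tendsto_zero_if_eventually_le:
  fixes f :: "'a \<Rightarrow> real"
  assumes "\<And>e. 0 < e \<Longrightarrow> \<forall>\<^sub>F x in F. \<bar>f x\<bar> \<le> C * e"
  shows "(f \<longlongrightarrow> 0) F"
proof (rule tendstoI)
  fix e :: real assume e: "0 < e"
  define d where "d = e / (2 * (\<bar>C\<bar> + 1))"
  have d: "0 < d" using e by (simp add: d_def)
  have "C * d \<le> \<bar>C\<bar> * d" using d by (intro mult_right_mono) auto
  also have "\<dots> \<le> (\<bar>C\<bar> + 1) * d" using d by (intro mult_right_mono) auto
  also have "\<dots> = e / 2" by (simp add: d_def field_simps)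
  also have "\<dots> < e" using e by simp
  finally have "C * d < e" .
  with assms[OF d] show "\<forall>\<^sub>F x in F. dist (f x) 0 < e"
    by (auto elim: eventually_mono)
qed

lemma eventually_at_right_0_le_1: "\<forall>\<^sub>F h in at_right 0. 0 < h \<and> h \<le> (1::real)"
  unfolding eventually_at_right_field by (intro exI[of _ 1]) auto

lemma eventually_at_right_0_square_le:
  assumes "0 < (e::real)" shows "\<forall>\<^sub>F h in at_right 0. h\<^sup>2 \<le> e * h"
proof -
  have "\<forall>\<^sub>F h in at_right 0. 0 < h \<and> h < e"
    unfolding eventually_at_right_field using assms by (intro exI[of _ e]) auto
  thus ?thesis by eventually_elim (simp add: power2_eq_square mult_right_mono)
qed

context cadlag_markov_process
begin

context
  fixes mu :: "'x measure" and W :: "'x \<Rightarrow> real" and B :: real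
  assumes inv: "invariant_measure X P mu"
    and W: "W \<in> borel_measurable borel" and WB: "\<And>y. \<bar>W y\<bar> \<le> B"
begin

lemma B_nonneg: "0 \<le> B" using WB[of undefined] by linarith

lemma W_integrable: "integrable mu W"
proof -
  have "W \<in> borel_measurable mu" using W sets_mu[OF inv] by (simp cong: measurable_cong_sets)
  thus ?thesis using WB prob_space_mu[OF inv]
    by (intro integrable_bounded_finite[where K=B]) (auto simp: prob_space.finite_measure)
qed

lemma Pmu_facts:
  "prob_space (mu \<bind> P)" "sets (mu \<bind> P) = sets Om" "space (mu \<bind> P) = space Om"
  using prob_space_Pmu[OF inv] sets_Pmu[OF inv] space_Pmu[OF inv] by auto

text \<open>Averaging the continuity in mean: the path integral over \<open>[t, t + h]\<close> is \<open>h W(X\<^sub>t)\<close> up to \<open>o(h)\<close> in mean.\<close>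

lemma path_integral_infinitesimal:
  assumes t: "0 \<le> t" and e: "0 < e"
  shows "\<forall>\<^sub>F h in at_right 0. (\<integral>w. \<bar>path_integral W t (t + h) w - h * W (X t w)\<bar> \<partial>(mu \<bind> P)) \<le> e * h"
proof -
  let ?Q = "mu \<bind> P"
  interpret Q: prob_space ?Q by (rule Pmu_facts)
  note [measurable_cong] = Pmu_facts(2)
  note [measurable] = W
  let ?D = "\<lambda>s. \<integral>w. \<bar>W (X s w) - W (X t w)\<bar> \<partial>?Q"
  have "(?D \<longlongrightarrow> 0) (at_right t)"
    using l1_right_cont[OF inv W_integrable] t unfolding l1_right_cont_def[OF inv] by blast
  from order_tendstoD(2)[OF this e] obtain d where d: "t < d" "\<And>s. t < s \<Longrightarrow> s < d \<Longrightarrow> ?D s < e"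
    unfolding eventually_at_right_field by blast
  have "(\<integral>w. \<bar>path_integral W t (t + h) w - h * W (X t w)\<bar> \<partial>?Q) \<le> e * h" if h: "0 < h" "h < d - t" for h
  proof -
    define b where "b = t + h"
    have b: "0 \<le> b" "t \<le> b" using t h by (auto simp: b_def)
    note [measurable] = clamped_process_measurable[OF b(1)] X_measurable[OF t] path_integral_measurable[OF W WB t b(1)]
    define g where "g s w = \<bar>W (X (max 0 (min s b)) w) - W (X t w)\<bar>" for s w
    have g_meas: "(\<lambda>(s, w). g s w) \<in> borel_measurable (borel \<Otimes>\<^sub>M ?Q)"
    proof -
      have "(\<lambda>z. \<bar>W (case z of (s, w) \<Rightarrow> X (max 0 (min s b)) w) - W (X t (snd z))\<bar>) \<in> borel_measurable (borel \<Otimes>\<^sub>M ?Q)"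
        by measurable
      thus ?thesis by (simp add: g_def case_prod_beta)
    qed
    have g_bnd: "\<bar>g s w\<bar> \<le> 2 * B" for s w
      using WB[of "X (max 0 (min s b)) w"] WB[of "X t w"] unfolding g_def by linarith
    have path: "(\<lambda>s. g s w) \<in> borel_measurable borel" if "w \<in> space Om" for w
      using path_measurable[OF W WB b(1) that] unfolding g_def by measurable
    have upper: "integrable ?Q (\<lambda>w. LINT s:{t..b}|lborel. g s w)"
    proof (rule integrable_bounded_finite[where K="2 * B * (b - t)"])
      show "(\<lambda>w. LINT s:{t..b}|lborel. g s w) \<in> borel_measurable ?Q"
        using g_meas by (intro borel_measurable_integral_upto) (auto simp: measurable_pair_swap_iff[of _ ?Q])
      show "\<bar>LINT s:{t..b}|lborel. g s w\<bar> \<le> 2 * B * (b - t)" if "w \<in> space ?Q" for w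
        using abs_set_integral_le[OF path g_bnd b(2)] that by (simp add: Pmu_facts)
    qed (rule Q.finite_measure_axioms)
    have "(\<integral>w. \<bar>path_integral W t b w - h * W (X t w)\<bar> \<partial>?Q) \<le> (\<integral>w. (LINT s:{t..b}|lborel. g s w) \<partial>?Q)"
    proof (rule integral_mono'[OF upper])
      fix w assume "w \<in> space ?Q"
      hence w: "w \<in> space Om" by (simp add: Pmu_facts)
      note m = path_measurable[OF W WB b(1) w]
      have i: "set_integrable lborel {t..b} (\<lambda>s. W (X (max 0 (min s b)) w))"
        "set_integrable lborel {t..b} (\<lambda>s. W (X t w))"
        by (rule set_integrable_if_bounded[where B=B]; use m WB in auto)+
      have "path_integral W t b w - h * W (X t w)
          = (LINT s:{t..b}|lborel. W (X (max 0 (min s b)) w)) - (LINT s:{t..b}|lborel. W (X t w))"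
        using h by (simp add: path_integral_clamped[OF t order_refl] set_lebesgue_integral_def b_def)
      also have "\<dots> = (LINT s:{t..b}|lborel. W (X (max 0 (min s b)) w) - W (X t w))"
        by (rule set_integral_diff(2)[symmetric, OF i])
      finally have eq: "path_integral W t b w - h * W (X t w) = (LINT s:{t..b}|lborel. W (X (max 0 (min s b)) w) - W (X t w))" .
      show "\<bar>path_integral W t b w - h * W (X t w)\<bar> \<le> (LINT s:{t..b}|lborel. g s w)"
        unfolding eq g_def
        using set_integral_norm_bound[OF set_integral_diff(1)[OF i]] by simp
      show "0 \<le> (LINT s:{t..b}|lborel. g s w)"
        unfolding set_lebesgue_integral_def by (rule Bochner_Integration.integral_nonneg) (simp add: g_def)
    qed
    also have "\<dots> = (LINT s:{t..b}|lborel. (\<integral>w. g s w \<partial>?Q))"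
      by (rule fubini_strip_eq[OF Q.prob_space_axioms g_meas g_bnd])
    also have "\<dots> \<le> (LINT s:{t..b}|lborel. e)"
    proof (rule set_integral_mono)
      show "set_integrable lborel {t..b} (\<lambda>s. \<integral>w. g s w \<partial>?Q)"
        by (rule fubini_strip_integrable[OF Q.prob_space_axioms g_meas g_bnd])
      show "set_integrable lborel {t..b} (\<lambda>s. e)"
        by (rule set_integrable_if_bounded[where B="\<bar>e\<bar>"]) auto
      fix s assume s: "s \<in> {t..b}"
      show "(\<integral>w. g s w \<partial>?Q) \<le> e"
      proof (cases "s = t")
        case True
        thus ?thesis using e t s by (simp add: g_def min_def)
      next
        case False
        hence "t < s" "s < d" using s h by (auto simp: b_def)
        from d(2)[OF this] show ?thesis using s t by (simp add: g_def min_absorb1)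
      qed
    qed
    also have "\<dots> = e * h" using h by (simp add: set_lebesgue_integral_def b_def)
    finally show ?thesis by (simp add: b_def)
  qed
  thus ?thesis unfolding eventually_at_right_field using d(1) by (intro exI[of _ "d - t"]) auto
qed

lemma abs_path_integral_minus_linear_le:
  assumes s: "0 \<le> s" and h: "0 < h" and w: "w \<in> space Om"
  shows "\<bar>path_integral W s (s + h) w - h * W (X s w)\<bar> \<le> 2 * B * h"
proof -
  have "\<bar>path_integral W s (s + h) w\<bar> \<le> B * h" using abs_path_integral_le[OF W WB s _ w, of "s + h"] h by simp
  moreover have "\<bar>h * W (X s w)\<bar> \<le> B * h"
    using WB[of "X s w"] h by (simp add: abs_mult mult.commute mult_right_mono)
  ultimately show ?thesis by linarith
qed

text \<open>The common last step of both derivative computations. The pathwise error \<open>Y h\<close> is \<open>o(h)\<close> in mean, so \<open>E\<^sup>x[Y h] / h\<close>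
  tends to zero in \<open>L\<^sup>1\<close>; as it is bounded uniformly in \<open>h\<close>, it does so in \<open>L\<^sup>2\<close>.\<close>

lemma kernel_average_l2_small:
  fixes Y :: "real \<Rightarrow> 'w \<Rightarrow> real"
  assumes t: "0 \<le> t" and C: "0 \<le> C"
    and Y: "\<And>h. 0 < h \<Longrightarrow> h \<le> 1 \<Longrightarrow> Y h \<in> borel_measurable Om"
    and bnd: "\<And>h w. 0 < h \<Longrightarrow> h \<le> 1 \<Longrightarrow> w \<in> space Om \<Longrightarrow> \<bar>Y h w\<bar> \<le>
        C * (h\<^sup>2 + \<bar>path_integral W t (t + h) w - h * W (X t w)\<bar> + \<bar>path_integral W 0 h w - h * W (X 0 w)\<bar>)"
  shows "((\<lambda>h. l2_norm mu (\<lambda>x. (\<integral>w. Y h w \<partial>P x) / h)) \<longlongrightarrow> 0) (at_right 0)"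
proof -
  let ?Q = "mu \<bind> P"
  interpret Q: prob_space ?Q by (rule Pmu_facts)
  interpret mu: prob_space mu by (rule prob_space_mu[OF inv])
  note [measurable_cong] = Pmu_facts(2) sets_mu[OF inv]
  note [measurable] = W
  define K where "K = C * (1 + 4 * B)"
  have K0: "0 \<le> K" using C B_nonneg by (simp add: K_def)
  have YK: "\<bar>Y h w\<bar> \<le> K * h" if h: "0 < h" "h \<le> 1" and w: "w \<in> space Om" for h w
  proof -
    have "h\<^sup>2 \<le> h" using h by (simp add: power2_eq_square)
    hence "h\<^sup>2 + \<bar>path_integral W t (t + h) w - h * W (X t w)\<bar> + \<bar>path_integral W 0 h w - h * W (X 0 w)\<bar> \<le> (1 + 4 * B) * h"
      using abs_path_integral_minus_linear_le[OF t h(1) w] abs_path_integral_minus_linear_le[OF order_refl h(1) w]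
      by (simp add: algebra_simps)
    from order_trans[OF bnd[OF h w] mult_left_mono[OF this C]] show ?thesis by (simp add: K_def mult.assoc)
  qed
  have small: "\<forall>\<^sub>F h in at_right 0. (\<integral>w. \<bar>Y h w\<bar> \<partial>?Q) \<le> 3 * C * e * h" if e: "0 < e" for e
    using path_integral_infinitesimal[OF t e] path_integral_infinitesimal[OF order_refl e] eventually_at_right_0_le_1
      eventually_at_right_0_square_le[OF e]
  proof eventually_elim
    case (elim h)
    hence h: "0 < h" "h \<le> 1" by auto
    have int: "integrable ?Q (\<lambda>w. \<bar>path_integral W s (s + h) w - h * W (X s w)\<bar>)" if s: "0 \<le> s" for s
    proof (rule integrable_bounded_finite[where K="2 * B * h"])
      have sh: "0 \<le> s + h" using s h by simp
      note [measurable] = path_integral_measurable[OF W WB s sh] X_measurable[OF s]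
      show "(\<lambda>w. \<bar>path_integral W s (s + h) w - h * W (X s w)\<bar>) \<in> borel_measurable ?Q" by measurable
      show "\<bar>\<bar>path_integral W s (s + h) w - h * W (X s w)\<bar>\<bar> \<le> 2 * B * h" if "w \<in> space ?Q" for w
        using abs_path_integral_minus_linear_le[OF s h(1), of w] that by (simp add: Pmu_facts)
    qed (rule Q.finite_measure_axioms)
    note int_t = int[OF t] and int_0 = int[of 0, simplified]
    have "(\<integral>w. \<bar>Y h w\<bar> \<partial>?Q) \<le> (\<integral>w. C * (h\<^sup>2 + \<bar>path_integral W t (t + h) w - h * W (X t w)\<bar>
        + \<bar>path_integral W 0 h w - h * W (X 0 w)\<bar>) \<partial>?Q)"
      by (rule integral_mono') (use int_t int_0 bnd[OF h] C in \<open>auto simp: Pmu_facts\<close>)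
    also have "\<dots> = C * (h\<^sup>2 + (\<integral>w. \<bar>path_integral W t (t + h) w - h * W (X t w)\<bar> \<partial>?Q)
        + (\<integral>w. \<bar>path_integral W 0 h w - h * W (X 0 w)\<bar> \<partial>?Q))"
      using int_t int_0 by (simp add: Q.prob_space)
    also have "\<dots> \<le> C * (e * h + e * h + e * h)"
      using elim C by (intro mult_left_mono add_mono) auto
    finally show ?case by (simp add: algebra_simps)
  qed
  have "((\<lambda>h. \<integral>x. ((\<integral>w. Y h w \<partial>P x) / h)\<^sup>2 \<partial>mu) \<longlongrightarrow> 0) (at_right 0)"
  proof (rule tendsto_zero_if_eventually_le[where C="K * (3 * C)"])
    fix e :: real assume e: "0 < e"
    show "\<forall>\<^sub>F h in at_right 0. \<bar>\<integral>x. ((\<integral>w. Y h w \<partial>P x) / h)\<^sup>2 \<partial>mu\<bar> \<le> K * (3 * C) * e"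
      using small[OF e] eventually_at_right_0_le_1
    proof eventually_elim
      case (elim h)
      hence h: "0 < h" "h \<le> 1" by auto
      note [measurable] = Y[OF h]
      define A where "A x = (\<integral>w. \<bar>Y h w\<bar> \<partial>P x)" for x
      have A_meas[measurable]: "A \<in> borel_measurable borel"
        unfolding A_def by (rule borel_measurable_integral_kernel) measurable
      have A0: "0 \<le> A x" for x unfolding A_def by (rule Bochner_Integration.integral_nonneg) auto
      have AK: "A x \<le> K * h" for x
        using abs_integral_prob_le[OF prob_space_P, of x "\<lambda>w. \<bar>Y h w\<bar>" "K * h"] YK[OF h] unfolding A_def
        by (simp add: space_P)
      have A_int: "integrable mu A"
        by (rule integrable_bounded_finite[where K="K * h"]) (use A0 AK in \<open>auto simp: mu.finite_measure_axioms\<close>)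
      have "(\<integral>x. ((\<integral>w. Y h w \<partial>P x) / h)\<^sup>2 \<partial>mu) \<le> (\<integral>x. K / h * A x \<partial>mu)"
      proof (rule integral_mono')
        fix x
        have le: "\<bar>\<integral>w. Y h w \<partial>P x\<bar> \<le> A x" unfolding A_def by (rule integral_abs_bound)
        have "((\<integral>w. Y h w \<partial>P x) / h)\<^sup>2 = \<bar>\<integral>w. Y h w \<partial>P x\<bar> * \<bar>\<integral>w. Y h w \<partial>P x\<bar> / h\<^sup>2"
          by (simp add: power2_eq_square)
        also have "\<dots> \<le> (K * h) * A x / h\<^sup>2"
          using le order_trans[OF le AK] K0 h by (intro divide_right_mono mult_mono) auto
        also have "\<dots> = K / h * A x" using h by (simp add: power2_eq_square)
        finally show "((\<integral>w. Y h w \<partial>P x) / h)\<^sup>2 \<le> K / h * A x" .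
        show "0 \<le> K / h * A x" using K0 A0 h by simp
      qed (use A_int in simp)
      also have "\<dots> = K / h * (\<integral>x. A x \<partial>mu)" by simp
      also have "(\<integral>x. A x \<partial>mu) = (\<integral>w. \<bar>Y h w\<bar> \<partial>?Q)"
        unfolding A_def
        by (rule integral_mixture[symmetric, OF prob_space_mu[OF inv] sets_mu[OF inv], where K="K * h"])
           (use YK[OF h] in auto)
      also have "K / h * \<dots> \<le> K / h * (3 * C * e * h)"
        using elim K0 h by (intro mult_left_mono) auto
      also have "\<dots> = K * (3 * C) * e" using h by simp
      finally show ?case by (simp add: Bochner_Integration.integral_nonneg)
    qed
  qed
  from tendsto_real_sqrt[OF this] show ?thesis
    by (simp add: l2_norm_def l2_inner_def power2_eq_square)
qed

definition feynman_kac_deriv :: "real \<Rightarrow> 'x \<Rightarrow> real" where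
  "feynman_kac_deriv t x = (\<integral>w. exp (path_integral W 0 t w) * W (X t w) \<partial>P x)"

lemma feynman_kac_deriv_measurable:
  assumes t: "0 \<le> t" shows "feynman_kac_deriv t \<in> borel_measurable borel"
proof -
  note [measurable] = path_integral_measurable[OF W WB order_refl t] X_measurable[OF t] W
  show ?thesis unfolding feynman_kac_deriv_def[abs_def] by (rule borel_measurable_integral_kernel) measurable
qed

lemma feynman_kac_deriv_bound:
  assumes t: "0 \<le> t" shows "\<bar>feynman_kac_deriv t x\<bar> \<le> exp (B * t) * B"
  unfolding feynman_kac_deriv_def
proof (rule abs_integral_prob_le[OF prob_space_P])
  fix w assume "w \<in> space (P x)"
  hence "exp (path_integral W 0 t w) \<le> exp (B * (t - 0))" using t by (intro exp_path_integral_le[OF W WB]) (auto simp: space_P)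
  thus "\<bar>exp (path_integral W 0 t w) * W (X t w)\<bar> \<le> exp (B * t) * B"
    using WB unfolding abs_mult by (intro mult_mono) auto
qed

lemma exp_path_integral_integrable:
  assumes "0 \<le> a" "a \<le> b"
  shows "integrable (P x) (\<lambda>w. exp (path_integral W a b w))"
    and "0 \<le> s \<Longrightarrow> integrable (P x) (\<lambda>w. exp (path_integral W a b w) * W (X s w))"
proof -
  have b: "0 \<le> b" using assms by simp
  note [measurable] = path_integral_measurable[OF W WB assms(1) b] W
  note [measurable_cong] = sets_P
  interpret prob_space "P x" by (rule prob_space_P)
  have e: "exp (path_integral W a b w) \<le> exp (B * (b - a))" if "w \<in> space (P x)" for w
    using exp_path_integral_le[OF W WB assms] that by (simp add: space_P)
  show "integrable (P x) (\<lambda>w. exp (path_integral W a b w))"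
    by (rule integrable_bounded_finite[where K="exp (B * (b - a))"]) (use e in \<open>auto simp: finite_measure_axioms\<close>)
  assume s: "0 \<le> s"
  note [measurable] = X_measurable[OF s]
  show "integrable (P x) (\<lambda>w. exp (path_integral W a b w) * W (X s w))"
  proof (rule integrable_bounded_finite[where K="exp (B * (b - a)) * B"])
    show "\<bar>exp (path_integral W a b w) * W (X s w)\<bar> \<le> exp (B * (b - a)) * B" if "w \<in> space (P x)" for w
      using e[OF that] WB unfolding abs_mult by (intro mult_mono) auto
  qed (auto simp: finite_measure_axioms)
qed

text \<open>The factor \<open>exp (\<integral>\<^sub>0\<^sup>t W(X\<^sub>s) ds)\<close> splits off, and the exponential over \<open>[t, t + h]\<close> is expanded to second order.\<close>

lemma forward_increment_bound:
  assumes t: "0 \<le> t" and h: "0 < h" "h \<le> 1" and w: "w \<in> space Om"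
  shows "\<bar>exp (path_integral W 0 (t + h) w) - exp (path_integral W 0 t w) - h * (exp (path_integral W 0 t w) * W (X t w))\<bar>
     \<le> exp (B * t) * (B\<^sup>2 * exp B + 1) * (h\<^sup>2 + \<bar>path_integral W t (t + h) w - h * W (X t w)\<bar>)"
proof -
  define I where "I = path_integral W t (t + h) w"
  have split: "path_integral W 0 (t + h) w = path_integral W 0 t w + I"
    unfolding I_def using path_integral_split[OF W WB, of 0 t "t + h" w] t h w by simp
  have I: "\<bar>I\<bar> \<le> B * h" unfolding I_def using abs_path_integral_le[OF W WB t _ w, of "t + h"] h by simp
  have "B * h \<le> B" using h B_nonneg by (simp add: mult_left_le)
  hence eI: "exp \<bar>I\<bar> \<le> exp B" using I by simp
  have E: "exp (path_integral W 0 t w) \<le> exp (B * t)" using exp_path_integral_le[OF W WB order_refl t w] by simp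
  have "\<bar>exp I - 1 - I\<bar> \<le> I\<^sup>2 * exp \<bar>I\<bar>" by (rule abs_exp_minus_affine_le)
  also have "\<dots> \<le> (B * h)\<^sup>2 * exp B"
    using eI I by (intro mult_mono) (metis abs_ge_zero power2_abs power_mono, auto)
  finally have q: "\<bar>exp I - 1 - I\<bar> \<le> B\<^sup>2 * exp B * h\<^sup>2" by (simp add: power_mult_distrib ac_simps)
  have "exp (path_integral W 0 (t + h) w) - exp (path_integral W 0 t w) - h * (exp (path_integral W 0 t w) * W (X t w))
      = exp (path_integral W 0 t w) * ((exp I - 1 - I) + (I - h * W (X t w)))"
    unfolding split exp_add by (simp add: algebra_simps)
  also have "\<bar>\<dots>\<bar> \<le> exp (B * t) * (B\<^sup>2 * exp B * h\<^sup>2 + \<bar>I - h * W (X t w)\<bar>)"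
    unfolding abs_mult using E q by (intro mult_mono) auto
  also have "\<dots> \<le> exp (B * t) * ((B\<^sup>2 * exp B + 1) * (h\<^sup>2 + \<bar>I - h * W (X t w)\<bar>))"
    by (intro mult_left_mono) (auto simp: algebra_simps)
  finally show ?thesis by (simp add: I_def mult.assoc)
qed

text \<open>The counterpart at the left end of the interval. It compares the integrals over \<open>[0, t + h]\<close> and \<open>[h, t + h]\<close>, and so yields the
  difference between \<open>u\<^sub>t\<^sub>+\<^sub>h\<close> and \<open>T\<^sub>h u\<^sub>t\<close>.\<close>

lemma backward_increment_bound:
  assumes t: "0 \<le> t" and h: "0 < h" "h \<le> 1" and w: "w \<in> space Om"
  shows "\<bar>exp (path_integral W 0 (t + h) w) - exp (path_integral W h (h + t) w) - h * (exp (path_integral W 0 t w) * W (X 0 w))\<bar>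
     \<le> exp (B * (t + 1)) * (2 * B\<^sup>2 * exp B + 1) * (h\<^sup>2 + \<bar>path_integral W 0 h w - h * W (X 0 w)\<bar>)"
proof -
  define J where "J = path_integral W 0 h w"
  define I where "I = path_integral W t (t + h) w"
  have th: "t + h = h + t" by simp
  have split: "path_integral W 0 (t + h) w = path_integral W 0 t w + I"
    unfolding I_def using path_integral_split[OF W WB, of 0 t "t + h" w] t h w by simp
  have split': "path_integral W 0 (t + h) w = J + path_integral W h (h + t) w"
    unfolding J_def th using path_integral_split[OF W WB, of 0 h "h + t" w] t h w by simp
  have I: "\<bar>I\<bar> \<le> B * h" unfolding I_def using abs_path_integral_le[OF W WB t _ w, of "t + h"] h by simp
  have J: "\<bar>J\<bar> \<le> B * h" unfolding J_def using abs_path_integral_le[OF W WB order_refl _ w, of h] h by simp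
  have Bh: "B * h \<le> B" using h B_nonneg by (simp add: mult_left_le)
  hence eI: "exp \<bar>I\<bar> \<le> exp B" and eJ: "exp \<bar>- J\<bar> \<le> exp B" using I J by auto
  have "exp (path_integral W 0 (t + h) w) \<le> exp (B * (t + h - 0))"
    using t h w by (intro exp_path_integral_le[OF W WB]) auto
  also have "\<dots> \<le> exp (B * (t + 1))" using h B_nonneg by (auto intro!: mult_left_mono)
  finally have E1: "exp (path_integral W 0 (t + h) w) \<le> exp (B * (t + 1))" .
  have E: "exp (path_integral W 0 t w) \<le> exp (B * (t + 1))"
    using exp_path_integral_le[OF W WB order_refl t w] B_nonneg by (simp add: algebra_simps)
  have "\<bar>exp (- J) - 1 - (- J)\<bar> \<le> (- J)\<^sup>2 * exp \<bar>- J\<bar>" by (rule abs_exp_minus_affine_le)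
  also have "\<dots> \<le> (B * h)\<^sup>2 * exp B"
    using eJ J by (intro mult_mono) (metis abs_ge_zero abs_minus power2_abs power_mono, auto)
  finally have q: "\<bar>1 - exp (- J) - J\<bar> \<le> B\<^sup>2 * exp B * h\<^sup>2"
    by (simp add: power_mult_distrib ac_simps abs_minus_commute)
  have "\<bar>exp I - 1\<bar> \<le> \<bar>I\<bar> * exp \<bar>I\<bar>" by (rule abs_exp_minus_one_le)
  also have "\<dots> \<le> (B * h) * exp B" using eI I by (intro mult_mono) auto
  finally have "\<bar>exp I - 1\<bar> * \<bar>h * W (X 0 w)\<bar> \<le> ((B * h) * exp B) * (h * B)"
    using WB h B_nonneg by (intro mult_mono) (auto simp: abs_mult)
  hence p: "\<bar>(exp I - 1) * (h * W (X 0 w))\<bar> \<le> B\<^sup>2 * exp B * h\<^sup>2"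
    by (simp add: abs_mult power2_eq_square ac_simps)
  have eq: "exp (path_integral W 0 (t + h) w) - exp (path_integral W h (h + t) w) - h * (exp (path_integral W 0 t w) * W (X 0 w))
      = exp (path_integral W 0 (t + h) w) * ((1 - exp (- J) - J) + (J - h * W (X 0 w)))
        + exp (path_integral W 0 t w) * ((exp I - 1) * (h * W (X 0 w)))"
  proof -
    have "exp (path_integral W 0 (t + h) w) * exp (- J) = exp (path_integral W h (h + t) w)"
      unfolding split' exp_add exp_minus by simp
    moreover have "exp (path_integral W 0 t w) * exp I = exp (path_integral W 0 (t + h) w)" unfolding split exp_add ..
    ultimately show ?thesis by (simp add: algebra_simps)
  qed
  have "\<bar>exp (path_integral W 0 (t + h) w) * ((1 - exp (- J) - J) + (J - h * W (X 0 w)))\<bar>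
      \<le> exp (B * (t + 1)) * (B\<^sup>2 * exp B * h\<^sup>2 + \<bar>J - h * W (X 0 w)\<bar>)"
    unfolding abs_mult using E1 q by (intro mult_mono) auto
  moreover have "\<bar>exp (path_integral W 0 t w) * ((exp I - 1) * (h * W (X 0 w)))\<bar> \<le> exp (B * (t + 1)) * (B\<^sup>2 * exp B * h\<^sup>2)"
    unfolding abs_mult[of "exp (path_integral W 0 t w)"] using E p by (intro mult_mono) auto
  ultimately have "\<bar>exp (path_integral W 0 (t + h) w) - exp (path_integral W h (h + t) w) - h * (exp (path_integral W 0 t w) * W (X 0 w))\<bar>
      \<le> exp (B * (t + 1)) * (B\<^sup>2 * exp B * h\<^sup>2 + \<bar>J - h * W (X 0 w)\<bar>) + exp (B * (t + 1)) * (B\<^sup>2 * exp B * h\<^sup>2)"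
    unfolding eq by linarith
  also have "\<dots> = exp (B * (t + 1)) * (2 * B\<^sup>2 * exp B * h\<^sup>2 + \<bar>J - h * W (X 0 w)\<bar>)"
    by (simp add: algebra_simps)
  also have "\<dots> \<le> exp (B * (t + 1)) * ((2 * B\<^sup>2 * exp B + 1) * (h\<^sup>2 + \<bar>J - h * W (X 0 w)\<bar>))"
    by (intro mult_left_mono) (auto simp: algebra_simps)
  finally show ?thesis by (simp add: J_def mult.assoc)
qed

lemma feynman_kac_right_derivative:
  assumes t: "0 \<le> t"
  shows "((\<lambda>h. l2_norm mu (\<lambda>x. (feynman_kac W (t + h) x - feynman_kac W t x) / h - feynman_kac_deriv t x)) \<longlongrightarrow> 0) (at_right 0)"
proof -
  define Y where "Y h w = exp (path_integral W 0 (t + h) w) - exp (path_integral W 0 t w)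
      - h * (exp (path_integral W 0 t w) * W (X t w))" for h w
  have "((\<lambda>h. l2_norm mu (\<lambda>x. (\<integral>w. Y h w \<partial>P x) / h)) \<longlongrightarrow> 0) (at_right 0)"
  proof (rule kernel_average_l2_small[OF t])
    fix h :: real assume h: "0 < h" "h \<le> 1"
    have th: "0 \<le> t + h" using t h by simp
    note [measurable] = path_integral_measurable[OF W WB order_refl t] path_integral_measurable[OF W WB order_refl th]
      X_measurable[OF t] W
    show "Y h \<in> borel_measurable Om" unfolding Y_def by measurable
    fix w assume "w \<in> space Om"
    from forward_increment_bound[OF t h this]
    have "\<bar>Y h w\<bar> \<le> exp (B * t) * (B\<^sup>2 * exp B + 1) * (h\<^sup>2 + \<bar>path_integral W t (t + h) w - h * W (X t w)\<bar>)"
      by (simp add: Y_def)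
    also have "\<dots> \<le> exp (B * t) * (B\<^sup>2 * exp B + 1) *
      (h\<^sup>2 + \<bar>path_integral W t (t + h) w - h * W (X t w)\<bar> + \<bar>path_integral W 0 h w - h * W (X 0 w)\<bar>)"
      by (intro mult_left_mono) auto
    finally show "\<bar>Y h w\<bar> \<le> exp (B * t) * (B\<^sup>2 * exp B + 1) *
      (h\<^sup>2 + \<bar>path_integral W t (t + h) w - h * W (X t w)\<bar> + \<bar>path_integral W 0 h w - h * W (X 0 w)\<bar>)" .
  qed simp
  moreover have "\<forall>\<^sub>F h in at_right 0. l2_norm mu (\<lambda>x. (\<integral>w. Y h w \<partial>P x) / h)
      = l2_norm mu (\<lambda>x. (feynman_kac W (t + h) x - feynman_kac W t x) / h - feynman_kac_deriv t x)"
    using eventually_at_right_0_le_1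
  proof eventually_elim
    case (elim h)
    have "(\<integral>w. Y h w \<partial>P x) = feynman_kac W (t + h) x - feynman_kac W t x - h * feynman_kac_deriv t x" for x
      unfolding Y_def feynman_kac_def[OF W WB] feynman_kac_deriv_def
      using exp_path_integral_integrable(1)[of 0 "t + h" x] exp_path_integral_integrable(1)[of 0 t x]
        exp_path_integral_integrable(2)[of 0 t t x] t elim by simp
    thus ?case using elim by (simp add: diff_divide_distrib)
  qed
  ultimately show ?thesis by (rule Lim_transform_eventually)
qed

text \<open>\<open>A u\<^sub>t = u'\<^sub>t - W u\<^sub>t\<close>: subtract from the increment \<open>u\<^sub>t\<^sub>+\<^sub>h - u\<^sub>t\<close> the contribution \<open>u\<^sub>t\<^sub>+\<^sub>h - T\<^sub>h u\<^sub>t\<close> of the paths on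
  \<open>[0, h]\<close>, whose first-order part is \<open>h W u\<^sub>t\<close> because the paths start in \<open>x\<close>.\<close>

lemma feynman_kac_generator:
  assumes t: "0 \<le> t"
  shows "((\<lambda>h. l2_norm mu (\<lambda>x. (sg h (feynman_kac W t) x - feynman_kac W t x) / h - (feynman_kac_deriv t x - W x * feynman_kac W t x))) \<longlongrightarrow> 0) (at_right 0)"
proof -
  define Y where "Y h w = (exp (path_integral W 0 (t + h) w) - exp (path_integral W 0 t w)
      - h * (exp (path_integral W 0 t w) * W (X t w)))
      - (exp (path_integral W 0 (t + h) w) - exp (path_integral W h (h + t) w) - h * (exp (path_integral W 0 t w) * W (X 0 w)))" for h w
  define C where "C = exp (B * t) * (B\<^sup>2 * exp B + 1) + exp (B * (t + 1)) * (2 * B\<^sup>2 * exp B + 1)"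
  have "((\<lambda>h. l2_norm mu (\<lambda>x. (\<integral>w. Y h w \<partial>P x) / h)) \<longlongrightarrow> 0) (at_right 0)"
  proof (rule kernel_average_l2_small[OF t])
    show "0 \<le> C" by (simp add: C_def)
    fix h :: real assume h: "0 < h" "h \<le> 1"
    have th: "0 \<le> t + h" "0 \<le> h" "0 \<le> h + t" using t h by auto
    note [measurable] = path_integral_measurable[OF W WB order_refl t] path_integral_measurable[OF W WB order_refl th(1)]
      path_integral_measurable[OF W WB th(2,3)] X_measurable[OF t] X_measurable[of 0, simplified] W
    show "Y h \<in> borel_measurable Om" unfolding Y_def by measurable
    fix w assume w: "w \<in> space Om"
    let ?dt = "\<bar>path_integral W t (t + h) w - h * W (X t w)\<bar>" and ?ds = "\<bar>path_integral W 0 h w - h * W (X 0 w)\<bar>"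
    have "\<bar>Y h w\<bar> \<le> exp (B * t) * (B\<^sup>2 * exp B + 1) * (h\<^sup>2 + ?dt)
        + exp (B * (t + 1)) * (2 * B\<^sup>2 * exp B + 1) * (h\<^sup>2 + ?ds)"
      unfolding Y_def using forward_increment_bound[OF t h w] backward_increment_bound[OF t h w] by linarith
    also have "\<dots> \<le> exp (B * t) * (B\<^sup>2 * exp B + 1) * (h\<^sup>2 + ?dt + ?ds)
        + exp (B * (t + 1)) * (2 * B\<^sup>2 * exp B + 1) * (h\<^sup>2 + ?dt + ?ds)"
      by (rule add_mono; rule mult_left_mono) auto
    also have "\<dots> = C * (h\<^sup>2 + ?dt + ?ds)" by (simp add: C_def distrib_right)
    finally show "\<bar>Y h w\<bar> \<le> C * (h\<^sup>2 + ?dt + ?ds)" .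
  qed
  moreover have "\<forall>\<^sub>F h in at_right 0. l2_norm mu (\<lambda>x. (\<integral>w. Y h w \<partial>P x) / h)
      = l2_norm mu (\<lambda>x. (sg h (feynman_kac W t) x - feynman_kac W t x) / h - (feynman_kac_deriv t x - W x * feynman_kac W t x))"
    using eventually_at_right_0_le_1
  proof eventually_elim
    case (elim h)
    hence h: "0 \<le> h" by simp
    have start_eq: "(\<integral>w. exp (path_integral W 0 t w) * W (X 0 w) \<partial>P x) = W x * feynman_kac W t x" for x
    proof -
      note [measurable] = path_integral_measurable[OF W WB order_refl t] X_measurable[of 0, simplified] W
      note [measurable_cong] = sets_P
      have "(\<integral>w. exp (path_integral W 0 t w) * W (X 0 w) \<partial>P x) = (\<integral>w. exp (path_integral W 0 t w) * W x \<partial>P x)"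
        by (rule integral_cong_AE) (use start[of x] in auto)
      thus ?thesis by (simp add: feynman_kac_def[OF W WB])
    qed
    have "(\<integral>w. Y h w \<partial>P x) = (feynman_kac W (t + h) x - feynman_kac W t x - h * feynman_kac_deriv t x)
        - (feynman_kac W (t + h) x - sg h (feynman_kac W t) x - h * (W x * feynman_kac W t x))" for x
      unfolding Y_def feynman_kac_markov[OF W WB h t] start_eq[symmetric]
      unfolding feynman_kac_def[OF W WB] feynman_kac_deriv_def
      using exp_path_integral_integrable(1)[of 0 "t + h" x] exp_path_integral_integrable(1)[of 0 t x]
        exp_path_integral_integrable(2)[of 0 t t x] exp_path_integral_integrable(2)[of 0 t 0 x]
        exp_path_integral_integrable(1)[of h "h + t" x] t elim by simp
    hence "(\<integral>w. Y h w \<partial>P x) / h = (sg h (feynman_kac W t) x - feynman_kac W t x) / h - (feynman_kac_deriv t x - W x * feynman_kac W t x)" for x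
      using elim by (simp add: field_simps)
    thus ?case by simp
  qed
  ultimately show ?thesis by (rule Lim_transform_eventually)
qed

lemma feynman_kac_lipschitz:
  assumes "0 \<le> s" "s \<le> t" "t \<le> T"
  shows "\<bar>feynman_kac W t x - feynman_kac W s x\<bar> \<le> exp (B * T) * B * exp (B * T) * (t - s)"
proof -
  have "feynman_kac W t x - feynman_kac W s x = (\<integral>w. exp (path_integral W 0 t w) - exp (path_integral W 0 s w) \<partial>P x)"
    unfolding feynman_kac_def[OF W WB] using exp_path_integral_integrable(1)[of 0 t x] exp_path_integral_integrable(1)[of 0 s x] assms by simp
  also have "\<bar>\<dots>\<bar> \<le> exp (B * T) * B * exp (B * T) * (t - s)"
  proof (rule abs_integral_prob_le[OF prob_space_P])
    fix w assume "w \<in> space (P x)"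
    hence w: "w \<in> space Om" by (simp add: space_P)
    define I where "I = path_integral W s t w"
    have split: "path_integral W 0 t w = path_integral W 0 s w + I"
      unfolding I_def using path_integral_split[OF W WB, of 0 s t w] assms w by simp
    have I: "\<bar>I\<bar> \<le> B * (t - s)" unfolding I_def by (rule abs_path_integral_le[OF W WB assms(1,2) w])
    also have "\<dots> \<le> B * T" using assms B_nonneg by (intro mult_left_mono) auto
    finally have eI: "exp \<bar>I\<bar> \<le> exp (B * T)" by simp
    have "exp (path_integral W 0 s w) \<le> exp (B * (s - 0))" by (rule exp_path_integral_le[OF W WB order_refl assms(1) w])
    also have "\<dots> \<le> exp (B * T)" using assms B_nonneg by (auto intro!: mult_left_mono)
    finally have E: "exp (path_integral W 0 s w) \<le> exp (B * T)" .
    have "\<bar>exp (path_integral W 0 t w) - exp (path_integral W 0 s w)\<bar> = exp (path_integral W 0 s w) * \<bar>exp I - 1\<bar>"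
    proof -
      have "exp (path_integral W 0 t w) - exp (path_integral W 0 s w) = exp (path_integral W 0 s w) * (exp I - 1)"
        unfolding split exp_add by (simp add: algebra_simps)
      thus ?thesis by (simp add: abs_mult)
    qed
    also have "\<dots> \<le> exp (B * T) * (\<bar>I\<bar> * exp \<bar>I\<bar>)"
      using E by (intro mult_mono abs_exp_minus_one_le) auto
    also have "\<dots> \<le> exp (B * T) * (B * (t - s) * exp (B * T))"
      using I eI by (intro mult_left_mono mult_mono) auto
    finally show "\<bar>exp (path_integral W 0 t w) - exp (path_integral W 0 s w)\<bar> \<le> exp (B * T) * B * exp (B * T) * (t - s)"
      by (simp add: ac_simps)
  qed
  finally show ?thesis .
qed

lemma semigroup_mean:
  assumes h: "0 \<le> h" and g: "g \<in> borel_measurable borel" and gK: "\<And>y. \<bar>g y\<bar> \<le> K"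
  shows "(\<integral>x. sg h g x \<partial>mu) = (\<integral>x. g x \<partial>mu)"
proof -
  have "(\<integral>x. sg h g x \<partial>mu) = (\<integral>w. g (X h w) \<partial>(mu \<bind> P))"
    unfolding markov_semigroup_def
    by (rule integral_mixture[symmetric, OF prob_space_mu[OF inv] sets_mu[OF inv], where K=K])
       (use X_measurable[OF h] g gK in auto)
  thus ?thesis using stationary_integral[OF inv h g] by simp
qed

end

end

section \<open>Inner products on square-integrable functions and the energy estimate\<close>

lemma l2_iff: "g \<in> l2 M \<longleftrightarrow> g \<in> borel_measurable M \<and> integrable M (\<lambda>x. (g x)\<^sup>2)"
  by (simp add: l2_def)

lemma l2_prod_integrable:
  assumes "g \<in> l2 M" "h \<in> l2 M"
  shows "integrable M (\<lambda>x. g x * h x)"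
proof (rule Bochner_Integration.integrable_bound)
  show "integrable M (\<lambda>x. (g x)\<^sup>2 + (h x)\<^sup>2)" using assms by (simp add: l2_iff)
  show "(\<lambda>x. g x * h x) \<in> borel_measurable M" using assms by (auto simp: l2_iff)
  have "\<bar>a * b\<bar> \<le> a\<^sup>2 + b\<^sup>2" for a b :: real
    using sum_squares_bound[of "\<bar>a\<bar>" "\<bar>b\<bar>"] zero_le_power2[of a] zero_le_power2[of b]
    unfolding abs_mult power2_abs by linarith
  thus "AE x in M. norm (g x * h x) \<le> norm ((g x)\<^sup>2 + (h x)\<^sup>2)" by (intro AE_I2) simp
qed

lemma l2_add:
  assumes "g \<in> l2 M" "h \<in> l2 M"
  shows "(\<lambda>x. g x + h x) \<in> l2 M"
proof -
  have "integrable M (\<lambda>x. (g x)\<^sup>2 + (h x)\<^sup>2 + 2 * (g x * h x))"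
    using assms l2_prod_integrable[OF assms] by (simp add: l2_iff)
  thus ?thesis using assms by (auto simp: l2_iff power2_sum ac_simps intro: borel_measurable_add)
qed

lemma l2_scale: "g \<in> l2 M \<Longrightarrow> (\<lambda>x. a * g x) \<in> l2 M"
  by (auto simp: l2_iff power_mult_distrib intro: borel_measurable_times)

lemma l2_diff:
  assumes "g \<in> l2 M" "h \<in> l2 M" shows "(\<lambda>x. g x - h x) \<in> l2 M"
  using l2_add[OF assms(1) l2_scale[OF assms(2), of "-1"]] by simp

lemma l2_uminus: "g \<in> l2 M \<Longrightarrow> (\<lambda>x. - g x) \<in> l2 M"
  using l2_scale[of g M "-1"] by simp

lemma l2_bounded:
  assumes "finite_measure M" "g \<in> borel_measurable M" "\<And>x. \<bar>g x\<bar> \<le> K"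
  shows "g \<in> l2 M"
  unfolding l2_iff
proof
  have "(g x)\<^sup>2 \<le> K\<^sup>2" for x using assms(3)[of x] by (metis abs_ge_zero power2_abs power_mono)
  thus "integrable M (\<lambda>x. (g x)\<^sup>2)"
    by (intro finite_measure.integrable_const_bound[OF assms(1), where B="K\<^sup>2"]) (use assms in auto)
qed (fact assms(2))

lemma l2_mult_bounded:
  assumes g: "g \<in> l2 M" and V: "V \<in> borel_measurable M" "\<And>x. \<bar>V x\<bar> \<le> K"
  shows "(\<lambda>x. V x * g x) \<in> l2 M"
    and "l2_norm M (\<lambda>x. V x * g x) \<le> K * l2_norm M g"
proof -
  have K: "0 \<le> K" using V(2)[of undefined] by linarith
  have le: "(V x * g x)\<^sup>2 \<le> K\<^sup>2 * (g x)\<^sup>2" for x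
    unfolding power_mult_distrib
    using V(2)[of x] by (intro mult_right_mono) (metis abs_ge_zero power2_abs power_mono, simp)
  have int: "integrable M (\<lambda>x. K\<^sup>2 * (g x)\<^sup>2)" using g by (simp add: l2_iff)
  show 1: "(\<lambda>x. V x * g x) \<in> l2 M"
    unfolding l2_iff
  proof
    show "integrable M (\<lambda>x. (V x * g x)\<^sup>2)"
      by (rule Bochner_Integration.integrable_bound[OF int]) (use le g V in \<open>auto simp: l2_iff\<close>)
  qed (use g V in \<open>auto simp: l2_iff\<close>)
  have "(\<integral>x. (V x * g x)\<^sup>2 \<partial>M) \<le> (\<integral>x. K\<^sup>2 * (g x)\<^sup>2 \<partial>M)"
    by (rule integral_mono) (use 1 int le in \<open>auto simp: l2_iff\<close>)
  hence "sqrt (\<integral>x. (V x * g x)\<^sup>2 \<partial>M) \<le> sqrt (K\<^sup>2 * (\<integral>x. (g x)\<^sup>2 \<partial>M))" by simp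
  thus "l2_norm M (\<lambda>x. V x * g x) \<le> K * l2_norm M g"
    using K by (simp add: l2_norm_def l2_inner_def power2_eq_square[symmetric] real_sqrt_mult)
qed

lemma l2_norm_sq: "(l2_norm M g)\<^sup>2 = (\<integral>x. (g x)\<^sup>2 \<partial>M)"
  by (simp add: l2_norm_def l2_inner_def power2_eq_square[symmetric] Bochner_Integration.integral_nonneg)

lemma l2_norm_nonneg: "0 \<le> l2_norm M g"
  by (simp add: l2_norm_def l2_inner_def)

lemma l2_norm_le_bound:
  assumes "prob_space M" "g \<in> borel_measurable M" "\<And>x. \<bar>g x\<bar> \<le> K"
  shows "l2_norm M g \<le> K"
proof -
  interpret prob_space M by fact
  have "(\<lambda>x. 1) \<in> l2 M" by (rule l2_bounded[where K=1]) (auto simp: finite_measure_axioms)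
  from l2_mult_bounded(2)[OF this assms(2,3)] show ?thesis
    by (simp add: l2_norm_def l2_inner_def prob_space)
qed

locale inner_l2 =
  fixes M :: "'x measure" and ip :: "('x \<Rightarrow> real) \<Rightarrow> ('x \<Rightarrow> real) \<Rightarrow> real"
  assumes inner_product: "inner_product_on_l2 M ip"
    and prob: "prob_space M"
begin

abbreviation "nrm \<equiv> ip_norm ip"

lemma const_l2[simp]: "(\<lambda>_. a) \<in> l2 M"
  using prob by (intro l2_bounded[where K="\<bar>a\<bar>"]) (auto simp: prob_space.finite_measure)

lemma ip_cong: "g \<in> l2 M \<Longrightarrow> g' \<in> l2 M \<Longrightarrow> h \<in> l2 M \<Longrightarrow> (AE x in M. g x = g' x) \<Longrightarrow> ip g h = ip g' h"
  and ip_sym: "g \<in> l2 M \<Longrightarrow> h \<in> l2 M \<Longrightarrow> ip g h = ip h g"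
  and ip_add: "g \<in> l2 M \<Longrightarrow> g' \<in> l2 M \<Longrightarrow> h \<in> l2 M \<Longrightarrow> ip (\<lambda>x. g x + g' x) h = ip g h + ip g' h"
  and ip_scale: "g \<in> l2 M \<Longrightarrow> h \<in> l2 M \<Longrightarrow> ip (\<lambda>x. a * g x) h = a * ip g h"
  and ip_nonneg: "g \<in> l2 M \<Longrightarrow> 0 \<le> ip g g"
  and ip_definite: "g \<in> l2 M \<Longrightarrow> ip g g = 0 \<Longrightarrow> AE x in M. g x = 0"
proof -
  note ax = inner_product[unfolded inner_product_on_l2_def]
  note c1 = ax[THEN conjunct1] and r1 = ax[THEN conjunct2]
  note c2 = r1[THEN conjunct1] and r2 = r1[THEN conjunct2]
  note c3 = r2[THEN conjunct1] and r3 = r2[THEN conjunct2]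
  note c4 = r3[THEN conjunct1] and r4 = r3[THEN conjunct2]
  note c5 = r4[THEN conjunct1] and c6 = r4[THEN conjunct2]
  show "g \<in> l2 M \<Longrightarrow> g' \<in> l2 M \<Longrightarrow> h \<in> l2 M \<Longrightarrow> (AE x in M. g x = g' x) \<Longrightarrow> ip g h = ip g' h"
    by (rule c1[rule_format])
  show "g \<in> l2 M \<Longrightarrow> h \<in> l2 M \<Longrightarrow> ip g h = ip h g" by (rule c2[rule_format])
  show "g \<in> l2 M \<Longrightarrow> g' \<in> l2 M \<Longrightarrow> h \<in> l2 M \<Longrightarrow> ip (\<lambda>x. g x + g' x) h = ip g h + ip g' h"
    by (rule c3[rule_format])
  show "g \<in> l2 M \<Longrightarrow> h \<in> l2 M \<Longrightarrow> ip (\<lambda>x. a * g x) h = a * ip g h" by (rule c4[rule_format])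
  show "g \<in> l2 M \<Longrightarrow> 0 \<le> ip g g" by (rule c5[rule_format])
  show "g \<in> l2 M \<Longrightarrow> ip g g = 0 \<Longrightarrow> AE x in M. g x = 0" by (rule c6[rule_format])
qed

lemma ip_add_right: "g \<in> l2 M \<Longrightarrow> g' \<in> l2 M \<Longrightarrow> h \<in> l2 M \<Longrightarrow> ip h (\<lambda>x. g x + g' x) = ip h g + ip h g'"
  by (simp add: ip_sym[of h] ip_add l2_add)

lemma ip_scale_right: "g \<in> l2 M \<Longrightarrow> h \<in> l2 M \<Longrightarrow> ip h (\<lambda>x. a * g x) = a * ip h g"
  by (simp add: ip_sym[of h] ip_scale l2_scale)

lemma ip_uminus: "g \<in> l2 M \<Longrightarrow> h \<in> l2 M \<Longrightarrow> ip (\<lambda>x. - g x) h = - ip g h"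
  using ip_scale[of g h "-1"] by simp

lemma ip_diff: "g \<in> l2 M \<Longrightarrow> g' \<in> l2 M \<Longrightarrow> h \<in> l2 M \<Longrightarrow> ip (\<lambda>x. g x - g' x) h = ip g h - ip g' h"
  using ip_add[of g "\<lambda>x. - g' x" h] by (simp add: ip_uminus l2_uminus)

lemma nrm_sq: "g \<in> l2 M \<Longrightarrow> (nrm g)\<^sup>2 = ip g g"
  by (simp add: ip_norm_def ip_nonneg)

lemma nrm_nonneg: "g \<in> l2 M \<Longrightarrow> 0 \<le> nrm g"
  by (simp add: ip_norm_def ip_nonneg)

lemma cauchy_schwarz:
  assumes g: "g \<in> l2 M" and h: "h \<in> l2 M"
  shows "\<bar>ip g h\<bar> \<le> nrm g * nrm h"
proof (cases "ip h h = 0")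
  case True
  have "ip h g = ip (\<lambda>x. 0 * h x) g"
    by (rule ip_cong) (use ip_definite[OF h True] g h l2_scale[OF h, of 0] in auto)
  also have "\<dots> = 0 * ip h g" by (rule ip_scale[OF h g])
  finally have "ip g h = 0" using ip_sym[OF g h] by simp
  thus ?thesis using nrm_nonneg g h by simp
next
  case False
  hence d: "0 < ip h h" using ip_nonneg[OF h] by simp
  define l where "l = ip g h / ip h h"
  note s = l2_scale[OF h, of l]
  have "0 \<le> ip (\<lambda>x. g x - l * h x) (\<lambda>x. g x - l * h x)" by (intro ip_nonneg l2_diff g s)
  also have "\<dots> = ip g g - 2 * l * ip g h + l\<^sup>2 * ip h h"
    using g h s ip_sym[OF g h] ip_sym[OF l2_diff[OF g s] g] ip_sym[OF l2_diff[OF g s] s]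
    by (simp add: ip_diff l2_diff ip_scale ip_scale_right power2_eq_square algebra_simps)
  also have "\<dots> = ip g g - (ip g h)\<^sup>2 / ip h h"
    using d by (simp add: l_def power2_eq_square field_simps)
  finally have "(ip g h)\<^sup>2 \<le> ip g g * ip h h" using d by (simp add: field_simps)
  also have "\<dots> = (nrm g * nrm h)\<^sup>2" using g h by (simp add: power_mult_distrib nrm_sq)
  finally show ?thesis using nrm_nonneg g h by (metis abs_le_square_iff abs_of_nonneg mult_nonneg_nonneg)
qed

end

lemma inner_product_l2_inner:
  assumes "prob_space M" shows "inner_l2 M (l2_inner M)"
proof (rule inner_l2.intro)
  show "inner_product_on_l2 M (l2_inner M)"
    unfolding inner_product_on_l2_def l2_inner_def
  proof (intro conjI ballI allI impI)
    fix g g' h :: "'a \<Rightarrow> real" assume *: "g \<in> l2 M" "g' \<in> l2 M" "h \<in> l2 M"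
    show "(\<integral>x. g x * h x \<partial>M) = (\<integral>x. g' x * h x \<partial>M)" if "AE x in M. g x = g' x"
      using that * by (intro integral_cong_AE) (auto simp: l2_iff)
    show "(\<integral>x. (g x + g' x) * h x \<partial>M) = (\<integral>x. g x * h x \<partial>M) + (\<integral>x. g' x * h x \<partial>M)"
      using * by (simp add: distrib_right l2_prod_integrable)
  next
    fix a and g h :: "'a \<Rightarrow> real"
    show "(\<integral>x. a * g x * h x \<partial>M) = a * (\<integral>x. g x * h x \<partial>M)" by (simp add: mult.assoc)
    show "(\<integral>x. g x * h x \<partial>M) = (\<integral>x. h x * g x \<partial>M)" by (simp add: mult.commute)
  next
    fix g :: "'a \<Rightarrow> real" assume *: "g \<in> l2 M" "(\<integral>x. g x * g x \<partial>M) = 0"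
    hence "AE x in M. g x * g x = 0"
      using integral_nonneg_eq_0_iff_AE[of M "\<lambda>x. g x * g x"] l2_prod_integrable[of g M g] by auto
    thus "AE x in M. g x = 0" by auto
  qed auto
qed fact

lemma l2_cauchy_schwarz:
  assumes "prob_space M" "g \<in> l2 M" "h \<in> l2 M"
  shows "(\<integral>x. g x * h x \<partial>M) \<le> l2_norm M g * l2_norm M h"
  using inner_l2.cauchy_schwarz[OF inner_product_l2_inner[OF assms(1)] assms(2,3)]
  by (simp add: l2_norm_def ip_norm_def l2_inner_def)

lemma l2_norm_limit_unique:
  fixes q :: "real \<Rightarrow> 'x \<Rightarrow> real"
  assumes h: "h \<in> l2 M" "h' \<in> l2 M" and q: "\<And>t. 0 < t \<Longrightarrow> q t \<in> l2 M"
    and lim: "((\<lambda>t. l2_norm M (\<lambda>x. q t x - h x)) \<longlongrightarrow> 0) (at_right 0)"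
      "((\<lambda>t. l2_norm M (\<lambda>x. q t x - h' x)) \<longlongrightarrow> 0) (at_right 0)"
  shows "AE x in M. h x = h' x"
proof -
  let ?I = "\<integral>x. (h x - h' x)\<^sup>2 \<partial>M"
  have int: "integrable M (\<lambda>x. (h x - h' x)\<^sup>2)" using l2_diff[OF h] by (simp add: l2_iff)
  have "((\<lambda>t. 2 * (l2_norm M (\<lambda>x. q t x - h x))\<^sup>2 + 2 * (l2_norm M (\<lambda>x. q t x - h' x))\<^sup>2) \<longlongrightarrow> 2 * 0\<^sup>2 + 2 * 0\<^sup>2) (at_right 0)"
    by (intro tendsto_intros lim)
  moreover have "\<forall>\<^sub>F t in at_right 0. ?I \<le> 2 * (l2_norm M (\<lambda>x. q t x - h x))\<^sup>2 + 2 * (l2_norm M (\<lambda>x. q t x - h' x))\<^sup>2"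
    using eventually_at_right_less[of "0::real"]
  proof eventually_elim
    case (elim t)
    have i: "integrable M (\<lambda>x. (q t x - h x)\<^sup>2)" "integrable M (\<lambda>x. (q t x - h' x)\<^sup>2)"
      using l2_diff[OF q[OF elim] h(1)] l2_diff[OF q[OF elim] h(2)] by (auto simp: l2_iff)
    have "(a - b)\<^sup>2 \<le> 2 * (c - a)\<^sup>2 + 2 * (c - b)\<^sup>2" for a b c :: real
      using zero_le_power2[of "(c - a) + (c - b)"] by (simp add: power2_eq_square algebra_simps)
    hence "?I \<le> (\<integral>x. 2 * (q t x - h x)\<^sup>2 + 2 * (q t x - h' x)\<^sup>2 \<partial>M)"
      using i int by (intro integral_mono) auto
    thus ?case using i by (simp add: l2_norm_sq)
  qed
  ultimately have "?I \<le> 2 * 0\<^sup>2 + 2 * 0\<^sup>2"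
    by (rule tendsto_lowerbound) simp
  moreover have "0 \<le> ?I" by (rule Bochner_Integration.integral_nonneg) simp
  ultimately have "?I = 0" by simp
  hence "AE x in M. (h x - h' x)\<^sup>2 = 0"
    using integral_nonneg_eq_0_iff_AE[OF int] by simp
  thus ?thesis by auto
qed

text \<open>All limits in \<open>L\<^sup>2\<close> of the same difference quotients agree almost everywhere, so any computed limit can stand
  in for the value that was chosen in the definition of the generator.\<close>

lemma generator_eq_AE:
  assumes g: "g \<in> l2 M" and S: "\<And>t. 0 < t \<Longrightarrow> S t g \<in> l2 M" and h: "is_generator_value M S g h"
  shows "g \<in> generator_dom M S" "generator M S g \<in> l2 M" "AE x in M. generator M S g x = h x"
proof -
  show "g \<in> generator_dom M S" using g h by (auto simp: generator_dom_def)
  have gen: "is_generator_value M S g (generator M S g)"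
    unfolding generator_def by (rule someI[of "is_generator_value M S g", OF h])
  thus "generator M S g \<in> l2 M" by (simp add: is_generator_value_def)
  have "(\<lambda>x. (S t g x - g x) / t) \<in> l2 M" if "0 < t" for t
    using l2_scale[OF l2_diff[OF S[OF that] g], of "1 / t"] by simp
  thus "AE x in M. generator M S g x = h x"
    using gen h by (intro l2_norm_limit_unique[where q="\<lambda>t x. (S t g x - g x) / t"])
      (auto simp: is_generator_value_def)
qed

lemma l2_limit_mean_zero:
  fixes q :: "real \<Rightarrow> 'x \<Rightarrow> real"
  assumes M: "prob_space M" and h: "h \<in> l2 M" and q: "\<And>t. 0 < t \<Longrightarrow> q t \<in> l2 M"
    and mean: "\<And>t. 0 < t \<Longrightarrow> (\<integral>x. q t x \<partial>M) = 0"
    and lim: "((\<lambda>t. l2_norm M (\<lambda>x. q t x - h x)) \<longlongrightarrow> 0) (at_right 0)"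
  shows "(\<integral>x. h x \<partial>M) = 0"
proof -
  interpret L: inner_l2 M "l2_inner M" by (rule inner_product_l2_inner[OF M])
  interpret prob_space M by fact
  have "\<forall>\<^sub>F t in at_right 0. \<bar>\<integral>x. h x \<partial>M\<bar> \<le> l2_norm M (\<lambda>x. q t x - h x)"
    using eventually_at_right_less[of "0::real"]
  proof eventually_elim
    case (elim t)
    have i: "integrable M (q t)" "integrable M h"
      using l2_prod_integrable[OF q[OF elim] L.const_l2[of 1]] l2_prod_integrable[OF h L.const_l2[of 1]] by auto
    have "\<bar>l2_inner M (\<lambda>x. q t x - h x) (\<lambda>_. 1)\<bar> \<le> l2_norm M (\<lambda>x. q t x - h x) * 1"
      using L.cauchy_schwarz[OF l2_diff[OF q[OF elim] h] L.const_l2[of 1]]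
      by (simp add: l2_norm_def ip_norm_def l2_inner_def prob_space)
    thus ?case using i mean[OF elim] by (simp add: l2_inner_def)
  qed
  from tendsto_lowerbound[OF lim this] show ?thesis by simp
qed

locale equivalent_inner_l2 = inner_l2 +
  fixes c C :: real
  assumes c: "0 < c"
    and lower: "\<And>g. g \<in> l2 M \<Longrightarrow> c * l2_norm M g \<le> ip_norm ip g"
    and upper: "\<And>g. g \<in> l2 M \<Longrightarrow> ip_norm ip g \<le> C * l2_norm M g"
    and ip_one: "\<And>g. g \<in> l2 M \<Longrightarrow> ip g (\<lambda>_. 1) = l2_inner M g (\<lambda>_. 1)"
begin

lemma one_one: "ip (\<lambda>_. 1) (\<lambda>_. 1) = 1" "nrm (\<lambda>_. 1) = 1"
proof -
  show "ip (\<lambda>_. 1) (\<lambda>_. 1) = 1"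
    using ip_one[OF const_l2[of 1]] prob_space.prob_space[OF prob] by (simp add: l2_inner_def)
  thus "nrm (\<lambda>_. 1) = 1" by (simp add: ip_norm_def)
qed

lemma C_nonneg: "0 \<le> C"
proof -
  have "l2_norm M (\<lambda>_. 1) = 1"
    using prob_space.prob_space[OF prob] by (simp add: l2_norm_def l2_inner_def)
  thus ?thesis using upper[OF const_l2[of 1]] one_one(2) by simp
qed

lemma mult_form_le:
  assumes V: "V \<in> borel_measurable M" "\<And>x. \<bar>V x\<bar> \<le> K" and g: "g \<in> l2 M"
  shows "\<bar>ip (\<lambda>x. V x * g x) g\<bar> \<le> C * K / c * (nrm g)\<^sup>2"
proof -
  have K: "0 \<le> K" using V(2)[of undefined] by linarith
  note Vg = l2_mult_bounded[OF g V]
  have "\<bar>ip (\<lambda>x. V x * g x) g\<bar> \<le> nrm (\<lambda>x. V x * g x) * nrm g" by (rule cauchy_schwarz[OF Vg(1) g])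
  also have "\<dots> \<le> (C * (K * l2_norm M g)) * nrm g"
    using nrm_nonneg[OF g] C_nonneg by (intro mult_right_mono order_trans[OF upper[OF Vg(1)]] mult_left_mono Vg(2))
  also have "\<dots> \<le> (C * (K * (nrm g / c))) * nrm g"
    using lower[OF g] nrm_nonneg[OF g] C_nonneg K c
    by (intro mult_right_mono mult_left_mono) (auto simp: field_simps)
  finally show ?thesis by (simp add: power2_eq_square ac_simps)
qed

text \<open>The supremum over the unit sphere controls the form by homogeneity. The norm equivalence bounds the
  form on the sphere; without this the real-valued supremum would be meaningless.\<close>

lemma mult_form_le_SUP:
  assumes V: "V \<in> borel_measurable M" "\<And>x. \<bar>V x\<bar> \<le> K" and g: "g \<in> l2 M"
  shows "ip (\<lambda>x. V x * g x) g
     \<le> max 0 (SUP g\<in>{g \<in> l2 M. nrm g = 1}. ip (mult_op V g) g) * (nrm g)\<^sup>2"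
proof (cases "nrm g = 0")
  case True
  thus ?thesis using mult_form_le[OF V g] by simp
next
  case False
  hence n: "0 < nrm g" using nrm_nonneg[OF g] by simp
  define e where "e x = 1 / nrm g * g x" for x
  have e: "e \<in> l2 M" unfolding e_def[abs_def] by (rule l2_scale[OF g])
  have ee: "nrm e = 1"
  proof -
    have "ip e e = (1 / nrm g)\<^sup>2 * ip g g"
      unfolding e_def[abs_def] using g by (simp only: ip_scale ip_scale_right l2_scale power2_eq_square mult.assoc)
    hence "ip e e = 1" unfolding nrm_sq[OF g, symmetric] using n by (simp add: power_divide)
    thus ?thesis by (simp add: ip_norm_def)
  qed
  have bdd: "bdd_above ((\<lambda>g. ip (mult_op V g) g) ` {g \<in> l2 M. nrm g = 1})"
  proof (rule bdd_aboveI2)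
    fix g assume "g \<in> {g \<in> l2 M. nrm g = 1}"
    thus "ip (mult_op V g) g \<le> C * K / c" using mult_form_le[OF V, of g] by (auto simp: mult_op_def)
  qed
  have "ip (mult_op V e) e \<le> (SUP g\<in>{g \<in> l2 M. nrm g = 1}. ip (mult_op V g) g)"
    by (rule cSUP_upper[OF _ bdd]) (use e ee in auto)
  moreover have "ip (mult_op V e) e = (1 / nrm g)\<^sup>2 * ip (\<lambda>x. V x * g x) g"
  proof -
    have "mult_op V e = (\<lambda>x. 1 / nrm g * (V x * g x))" by (auto simp: mult_op_def e_def)
    thus ?thesis unfolding e_def[abs_def] using g l2_mult_bounded(1)[OF g V]
      by (simp only: ip_scale ip_scale_right l2_scale power2_eq_square mult.assoc)
  qed
  ultimately have "(1 / nrm g)\<^sup>2 * ip (\<lambda>x. V x * g x) g \<le> max 0 (SUP g\<in>{g \<in> l2 M. nrm g = 1}. ip (mult_op V g) g)"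
    by linarith
  thus ?thesis using n by (simp add: power_divide field_simps)
qed

text \<open>The functional inequality behind the theorem. \<open>N\<close> is the value of the generator at \<open>u\<close> and \<open>D\<close> the adjoint of
  multiplication by \<open>V\<close> applied to \<open>1\<close>. With \<open>a\<close> the mean of \<open>u\<close>, \<open>H = \<parallel>u - a\<parallel>\<close> and \<open>S = \<parallel>(V + D) / 2\<parallel>\<close>, the form times
  \<open>\<alpha>\<close> is at most \<open>2 \<alpha> l \<bar>a\<bar> S H - (1 - l \<alpha> \<beta>) H\<^sup>2\<close>, a concave quadratic in \<open>H\<close> whose maximum is \<open>\<alpha> \<Psi>(l) a\<^sup>2\<close>.\<close>

lemma perturbed_form_le:
  assumes u: "u \<in> l2 M" and N: "N \<in> l2 M" and V: "V \<in> borel_measurable M" "\<And>x. \<bar>V x\<bar> \<le> K"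
    and V0: "(\<integral>x. V x \<partial>M) = 0" and N0: "(\<integral>x. N x \<partial>M) = 0"
    and D: "D \<in> l2 M" and adj: "\<And>g. g \<in> l2 M \<Longrightarrow> ip (\<lambda>x. V x * g x) (\<lambda>_. 1) = ip g D"
    and \<alpha>: "0 < \<alpha>"
    and spectral_gap: "(nrm (\<lambda>x. u x - (\<integral>y. u y \<partial>M)))\<^sup>2 \<le> \<alpha> * ip (\<lambda>x. - N x) (\<lambda>x. u x - (\<integral>y. u y \<partial>M))"
    and \<beta>: "\<And>g. g \<in> l2 M \<Longrightarrow> ip (\<lambda>x. V x * g x) g \<le> \<beta> * (nrm g)\<^sup>2"
    and l: "0 \<le> l" "l * (\<alpha> * \<beta>) < 1"
  shows "ip (\<lambda>x. N x + l * (V x * u x)) u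
     \<le> Psi (2 * \<alpha> * (nrm (\<lambda>x. (V x + D x) / 2))\<^sup>2) (\<alpha> * \<beta>) l * ip u u"
proof -
  interpret prob_space M by (rule prob)
  define a where "a = (\<integral>x. u x \<partial>M)"
  define h where "h x = u x - a" for x
  define H where "H = nrm h"
  define S where "S = nrm (\<lambda>x. (V x + D x) / 2)"
  define k where "k = 1 - l * (\<alpha> * \<beta>)"
  have k: "0 < k" using l by (simp add: k_def)
  have V2: "V \<in> l2 M" using V by (intro l2_bounded[where K=K]) (auto simp: finite_measure_axioms)
  have h2: "h \<in> l2 M" unfolding h_def[abs_def] by (rule l2_diff[OF u const_l2])
  note Vh = l2_mult_bounded(1)[OF h2 V]
  note Vu = l2_mult_bounded(1)[OF u V]
  have u_int: "integrable M u" using l2_prod_integrable[OF u const_l2[of 1]] by simp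
  have one: "(\<lambda>_. 1) \<in> l2 M" and ca: "(\<lambda>_. a) \<in> l2 M" by simp_all
  have ipc: "ip g (\<lambda>_. a) = a * (\<integral>x. g x \<partial>M)" if "g \<in> l2 M" for g
    using ip_scale_right[OF one that, of a] ip_one[OF that] by (simp add: l2_inner_def)
  have h0: "(\<integral>x. h x \<partial>M) = 0" unfolding h_def using u_int by (simp add: a_def prob_space)
  have uh: "u = (\<lambda>x. h x + a)" by (simp add: h_def fun_eq_iff)
  have H0: "0 \<le> H" unfolding H_def by (rule nrm_nonneg[OF h2])
  have HH: "ip h h = H\<^sup>2" unfolding H_def by (simp add: nrm_sq[OF h2])
  have norm_u: "ip u u = a\<^sup>2 + H\<^sup>2"
  proof -
    have "ip u u = ip h h + ip h (\<lambda>_. a) + (ip (\<lambda>_. a) h + ip (\<lambda>_. a) (\<lambda>_. a))"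
      unfolding uh using h2 ca by (simp add: ip_add ip_add_right l2_add)
    also have "ip (\<lambda>_. a) h = ip h (\<lambda>_. a)" by (rule ip_sym[OF ca h2])
    finally show ?thesis using ipc[OF h2] ipc[OF ca] h0 HH by (simp add: power2_eq_square prob_space)
  qed
  have gap: "\<alpha> * ip N u \<le> - H\<^sup>2"
  proof -
    have "ip N u = ip N h + ip N (\<lambda>_. a)" unfolding uh using N h2 ca by (simp add: ip_add_right)
    hence "ip N u = ip N h" using ipc[OF N] N0 by simp
    moreover have "H\<^sup>2 \<le> \<alpha> * (- ip N h)"
      using spectral_gap ip_uminus[OF N h2] unfolding H_def h_def[abs_def] a_def[symmetric] by simp
    ultimately show ?thesis by simp
  qed
  have pert: "ip (\<lambda>x. V x * u x) u \<le> \<beta> * H\<^sup>2 + 2 * \<bar>a\<bar> * S * H"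
  proof -
    have Va: "(\<lambda>x. a * V x) \<in> l2 M" by (rule l2_scale[OF V2])
    have VD: "(\<lambda>x. V x + D x) \<in> l2 M" by (rule l2_add[OF V2 D])
    have w2: "(\<lambda>x. (V x + D x) / 2) \<in> l2 M" using l2_scale[OF VD, of "1/2"] by simp
    have "(\<lambda>x. V x * u x) = (\<lambda>x. V x * h x + a * V x)" unfolding uh by (simp add: fun_eq_iff algebra_simps)
    hence "ip (\<lambda>x. V x * u x) u = ip (\<lambda>x. V x * h x) u + ip (\<lambda>x. a * V x) u"
      using ip_add[OF Vh Va u] by simp
    also have "\<dots> = ip (\<lambda>x. V x * h x) h + ip (\<lambda>x. V x * h x) (\<lambda>_. a) + (a * ip V h + a * ip V (\<lambda>_. a))"
      using ip_add_right[OF h2 ca Vh] ip_add_right[OF h2 ca V2] ip_scale[OF V2 u, of a]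
      unfolding uh[symmetric] by (simp add: algebra_simps)
    also have "ip (\<lambda>x. V x * h x) (\<lambda>_. a) = a * ip D h"
      using ip_scale_right[OF one Vh, of a] adj[OF h2] ip_sym[OF D h2] by simp
    also have "ip V (\<lambda>_. a) = 0" using ipc[OF V2] V0 by simp
    finally have "ip (\<lambda>x. V x * u x) u = ip (\<lambda>x. V x * h x) h + a * (ip V h + ip D h)"
      by (simp add: algebra_simps)
    also have "ip V h + ip D h = 2 * ip (\<lambda>x. (V x + D x) / 2) h"
      using ip_add[OF V2 D h2] ip_scale[OF VD h2, of "1/2"] by simp
    also have "a * (2 * ip (\<lambda>x. (V x + D x) / 2) h) \<le> \<bar>a\<bar> * (2 * \<bar>ip (\<lambda>x. (V x + D x) / 2) h\<bar>)"
      using abs_ge_self[of "a * (2 * ip (\<lambda>x. (V x + D x) / 2) h)"] by (simp add: abs_mult)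
    also have "\<dots> \<le> \<bar>a\<bar> * (2 * (S * H))"
      unfolding S_def H_def by (intro mult_left_mono cauchy_schwarz w2 h2) auto
    finally show ?thesis using \<beta>[OF h2] by (simp add: H_def)
  qed
  have "\<alpha> * ip (\<lambda>x. N x + l * (V x * u x)) u = \<alpha> * ip N u + \<alpha> * (l * ip (\<lambda>x. V x * u x) u)"
    using ip_add[OF N l2_scale[OF Vu] u] ip_scale[OF Vu u] by (simp add: algebra_simps)
  also have "\<dots> \<le> - H\<^sup>2 + \<alpha> * (l * (\<beta> * H\<^sup>2 + 2 * \<bar>a\<bar> * S * H))"
    using gap pert \<alpha> l by (intro add_mono mult_left_mono) auto
  also have "\<dots> = 2 * (\<alpha> * l * \<bar>a\<bar> * S) * H - k * H\<^sup>2" by (simp add: k_def algebra_simps)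
  \<comment> \<open>complete the square in \<open>H\<close>\<close>
  also have "\<dots> \<le> (\<alpha> * l * \<bar>a\<bar> * S)\<^sup>2 / k"
  proof -
    have "0 \<le> (k * H - \<alpha> * l * \<bar>a\<bar> * S)\<^sup>2 / k" using k by simp
    also have "\<dots> = k * H\<^sup>2 - 2 * (\<alpha> * l * \<bar>a\<bar> * S) * H + (\<alpha> * l * \<bar>a\<bar> * S)\<^sup>2 / k"
      using k by (simp add: power2_diff add_divide_distrib diff_divide_distrib power_mult_distrib power2_eq_square[of k])
    finally show ?thesis by linarith
  qed
  also have "\<dots> = \<alpha> * (Psi (2 * \<alpha> * S\<^sup>2) (\<alpha> * \<beta>) l * a\<^sup>2)"
  proof -
    have "l\<^sup>2 * (2 * \<alpha> * S\<^sup>2) = 2 * (l\<^sup>2 * \<alpha> * S\<^sup>2)" by simp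
    hence "Psi (2 * \<alpha> * S\<^sup>2) (\<alpha> * \<beta>) l = l\<^sup>2 * \<alpha> * S\<^sup>2 / k"
      unfolding Psi_def k_def by (simp only: mult_divide_mult_cancel_left_if) simp
    thus ?thesis by (simp add: power_mult_distrib power2_eq_square[of \<alpha>])
  qed
  also have "\<dots> \<le> \<alpha> * (Psi (2 * \<alpha> * S\<^sup>2) (\<alpha> * \<beta>) l * ip u u)"
  proof -
    have "0 \<le> Psi (2 * \<alpha> * S\<^sup>2) (\<alpha> * \<beta>) l" using k \<alpha> by (simp add: Psi_def k_def)
    thus ?thesis using \<alpha> norm_u by (intro mult_left_mono) auto
  qed
  finally show ?thesis using \<alpha> by (simp add: S_def)
qed

text \<open>Gronwall's lemma for \<open>y t = \<langle>u\<^sub>t, u\<^sub>t\<rangle>\<close> when \<open>u\<close> has only a right derivative in \<open>L\<^sup>2\<close>: the product \<open>y t * exp (- 2 \<Lambda> t)\<close>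
  has nonpositive right derivative. The Lipschitz bound supplies the continuity of \<open>y\<close> that one-sided
  derivatives cannot give.\<close>

lemma energy_growth:
  fixes u u' :: "real \<Rightarrow> 'a \<Rightarrow> real"
  assumes T: "0 \<le> T"
    and u: "\<And>t. 0 \<le> t \<Longrightarrow> u t \<in> l2 M" and u': "\<And>t. 0 \<le> t \<Longrightarrow> u' t \<in> l2 M"
    and bnd: "\<And>t x. 0 \<le> t \<Longrightarrow> t \<le> T \<Longrightarrow> \<bar>u t x\<bar> \<le> K"
    and lip: "\<And>s t x. 0 \<le> s \<Longrightarrow> s \<le> t \<Longrightarrow> t \<le> T \<Longrightarrow> \<bar>u t x - u s x\<bar> \<le> L * (t - s)"
    and deriv: "\<And>t. 0 \<le> t \<Longrightarrow> ((\<lambda>h. l2_norm M (\<lambda>x. (u (t + h) x - u t x) / h - u' t x)) \<longlongrightarrow> 0) (at_right 0)"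
    and diss: "\<And>t. 0 \<le> t \<Longrightarrow> ip (u' t) (u t) \<le> \<Lambda> * ip (u t) (u t)"
  shows "ip (u T) (u T) \<le> exp (2 * \<Lambda> * T) * ip (u 0) (u 0)"
proof -
  define y where "y t = ip (u t) (u t)" for t
  define z where "z t = y t * exp (- 2 * \<Lambda> * t)" for t
  have K: "0 \<le> K" using bnd[of 0 undefined] T by (auto intro: order_trans[OF abs_ge_zero])
  have y_lip: "\<bar>y t - y s\<bar> \<le> (C * L) * (C * (2 * K)) * (t - s)" if st: "0 \<le> s" "s \<le> t" "t \<le> T" for s t
  proof -
    have s: "u s \<in> l2 M" "u t \<in> l2 M" using st u by auto
    note d = l2_diff[OF s(2) s(1)] and p = l2_add[OF s(2) s(1)]
    have "y t - y s = ip (\<lambda>x. u t x - u s x) (\<lambda>x. u t x + u s x)"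
      unfolding y_def using s d p ip_sym[OF s] by (simp add: ip_diff ip_add_right)
    also have "\<bar>\<dots>\<bar> \<le> nrm (\<lambda>x. u t x - u s x) * nrm (\<lambda>x. u t x + u s x)" by (rule cauchy_schwarz[OF d p])
    also have "\<dots> \<le> (C * (L * (t - s))) * (C * (2 * K))"
    proof (intro mult_mono)
      have "l2_norm M (\<lambda>x. u t x - u s x) \<le> L * (t - s)"
        using d by (intro l2_norm_le_bound[OF prob] lip st) (auto simp: l2_iff)
      thus "nrm (\<lambda>x. u t x - u s x) \<le> C * (L * (t - s))"
        by (intro order_trans[OF upper[OF d]] mult_left_mono C_nonneg)
      have "l2_norm M (\<lambda>x. u t x + u s x) \<le> 2 * K"
      proof (rule l2_norm_le_bound[OF prob])
        show "\<bar>u t x + u s x\<bar> \<le> 2 * K" for x using bnd[of t x] bnd[of s x] st by linarith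
      qed (use p in \<open>simp add: l2_iff\<close>)
      thus "nrm (\<lambda>x. u t x + u s x) \<le> C * (2 * K)"
        by (intro order_trans[OF upper[OF p]] mult_left_mono C_nonneg)
      have "0 \<le> L * (t - s)" using lip[OF st, of undefined] by linarith
      thus "0 \<le> C * (L * (t - s))" using C_nonneg by simp
    qed (rule nrm_nonneg[OF p])
    finally show ?thesis by (simp add: ac_simps)
  qed
  have y_cont: "continuous_on {0..T} y"
  proof -
    define K' where "K' = \<bar>(C * L) * (C * (2 * K))\<bar>"
    have lip': "\<bar>y t - y s\<bar> \<le> K' * (t - s)" if "0 \<le> s" "s \<le> t" "t \<le> T" for s t
      using that by (intro order_trans[OF y_lip[OF that]] mult_right_mono) (auto simp: K'_def)
    have "K'-lipschitz_on {0..T} y"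
    proof (rule lipschitz_onI)
      fix s t assume "s \<in> {0..T}" "t \<in> {0..T}"
      thus "dist (y s) (y t) \<le> K' * dist s t"
        using lip'[of s t] lip'[of t s] by (cases "s \<le> t") (auto simp: dist_real_def abs_minus_commute)
    qed (simp add: K'_def)
    thus ?thesis by (rule lipschitz_on_continuous_on)
  qed
  have y_deriv: "(y has_field_derivative 2 * ip (u' t) (u t)) (at_right t)" if t: "0 \<le> t" for t
  proof -
    define q where "q h x = (u (t + h) x - u t x) / h" for h x
    define d where "d h x = q h x - u' t x" for h x
    have q2: "q h \<in> l2 M" if "0 < h" for h
      using l2_scale[OF l2_diff[OF u[of "t + h"] u[OF t]], of "1 / h"] that t by (simp add: q_def[abs_def])
    have d2: "d h \<in> l2 M" if "0 < h" for h
      unfolding d_def[abs_def] by (rule l2_diff[OF q2[OF that] u'[OF t]])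
    have "((\<lambda>h. C * l2_norm M (d h)) \<longlongrightarrow> C * 0) (at_right 0)"
      using deriv[OF t] unfolding d_def[abs_def] q_def by (intro tendsto_mult tendsto_const)
    hence nd0: "((\<lambda>h. C * l2_norm M (d h)) \<longlongrightarrow> 0) (at_right 0)" by simp
    have nd: "((\<lambda>h. nrm (d h)) \<longlongrightarrow> 0) (at_right 0)"
    proof (rule Lim_null_comparison[OF _ nd0])
      show "\<forall>\<^sub>F h in at_right 0. norm (nrm (d h)) \<le> C * l2_norm M (d h)"
        using eventually_at_right_less[of "0::real"]
        by eventually_elim (use d2 upper nrm_nonneg in auto)
    qed
    have ipd: "((\<lambda>h. ip (d h) g) \<longlongrightarrow> 0) (at_right 0)" if g: "g \<in> l2 M" for g
    proof (rule Lim_null_comparison)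
      show "\<forall>\<^sub>F h in at_right 0. norm (ip (d h) g) \<le> nrm (d h) * nrm g"
        using eventually_at_right_less[of "0::real"]
        by eventually_elim (use d2 cauchy_schwarz g in auto)
      show "((\<lambda>h. nrm (d h) * nrm g) \<longlongrightarrow> 0) (at_right 0)" by (rule tendsto_mult_left_zero[OF nd])
    qed
    have expand: "(y (t + h) - y t) / h = 2 * (ip (d h) (u t) + ip (u' t) (u t))
          + h * ((nrm (d h))\<^sup>2 + 2 * ip (d h) (u' t) + ip (u' t) (u' t))" if h: "0 < h" for h
    proof -
      note q2 = q2[OF h] and d2 = d2[OF h] and ut = u[OF t] and u't = u'[OF t]
      note hq = l2_scale[OF q2, of h]
      have "u (t + h) = (\<lambda>x. u t x + h * q h x)" using h by (simp add: q_def fun_eq_iff)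
      hence "y (t + h) = ip (\<lambda>x. u t x + h * q h x) (\<lambda>x. u t x + h * q h x)" by (simp add: y_def)
      also have "\<dots> = y t + 2 * h * ip (q h) (u t) + h * (h * ip (q h) (q h))"
        using ut q2 hq ip_sym[OF ut q2] by (simp add: y_def ip_add ip_add_right l2_add ip_scale ip_scale_right algebra_simps)
      finally have 1: "(y (t + h) - y t) / h = 2 * ip (q h) (u t) + h * ip (q h) (q h)"
        using h by (simp add: field_simps)
      have qd: "q h = (\<lambda>x. d h x + u' t x)" by (simp add: d_def fun_eq_iff)
      have 2: "ip (q h) (u t) = ip (d h) (u t) + ip (u' t) (u t)" unfolding qd by (rule ip_add[OF d2 u't ut])
      have 3: "ip (q h) (q h) = (nrm (d h))\<^sup>2 + 2 * ip (d h) (u' t) + ip (u' t) (u' t)"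
        unfolding qd using d2 u't ip_sym[OF d2 u't] by (simp add: ip_add ip_add_right l2_add nrm_sq)
      show ?thesis unfolding 1 2 3 by simp
    qed
    have "((\<lambda>h. 2 * (ip (d h) (u t) + ip (u' t) (u t))
          + h * ((nrm (d h))\<^sup>2 + 2 * ip (d h) (u' t) + ip (u' t) (u' t))) \<longlongrightarrow>
          2 * (0 + ip (u' t) (u t)) + 0 * (0\<^sup>2 + 2 * 0 + ip (u' t) (u' t))) (at_right 0)"
      by (intro tendsto_intros ipd nd u u' t)
    hence lim: "((\<lambda>h. 2 * (ip (d h) (u t) + ip (u' t) (u t))
          + h * ((nrm (d h))\<^sup>2 + 2 * ip (d h) (u' t) + ip (u' t) (u' t))) \<longlongrightarrow>
          2 * ip (u' t) (u t)) (at_right 0)" by simp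
    have "\<forall>\<^sub>F h in at_right 0. 2 * (ip (d h) (u t) + ip (u' t) (u t))
          + h * ((nrm (d h))\<^sup>2 + 2 * ip (d h) (u' t) + ip (u' t) (u' t)) = (y (t + h) - y t) / h"
      using eventually_at_right_less[of "0::real"] by eventually_elim (simp only: expand)
    from Lim_transform_eventually[OF lim this]
    have "((\<lambda>h. (y (t + h) - y t) / h) \<longlongrightarrow> 2 * ip (u' t) (u t)) (at_right 0)" .
    thus ?thesis
      unfolding has_field_derivative_iff
      by (subst filterlim_at_right_to_0) (simp add: add.commute)
  qed
  have "z T \<le> z 0"
  proof (rule nonincreasing_if_right_derivative_nonpos[OF T])
    show "continuous_on {0..T} z" unfolding z_def by (intro continuous_intros y_cont)
    fix t e :: real assume t: "0 \<le> t" "t < T" and e: "0 < e"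
    define D where "D = (2 * ip (u' t) (u t)) * exp (- 2 * \<Lambda> * t) + (exp (- 2 * \<Lambda> * t) * (- 2 * \<Lambda>)) * y t"
    have "D = 2 * exp (- 2 * \<Lambda> * t) * (ip (u' t) (u t) - \<Lambda> * ip (u t) (u t))"
      by (simp add: D_def y_def algebra_simps)
    also have "\<dots> \<le> 0" using diss[OF t(1)] by (intro mult_nonneg_nonpos) auto
    finally have D: "D \<le> 0" .
    have "((\<lambda>t. exp (- 2 * \<Lambda> * t)) has_field_derivative exp (- 2 * \<Lambda> * t) * (- 2 * \<Lambda>)) (at_right t)"
      by (auto intro!: derivative_eq_intros)
    from DERIV_mult[OF y_deriv[OF t(1)] this]
    have "(z has_field_derivative D) (at_right t)" unfolding z_def[abs_def] D_def by (simp add: ac_simps)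
    hence "((\<lambda>h. (z (t + h) - z t) / h) \<longlongrightarrow> D) (at_right 0)"
      unfolding has_field_derivative_iff by (subst (asm) filterlim_at_right_to_0) (simp add: add.commute)
    from order_tendstoD(2)[OF this, of e] D e
    have "\<forall>\<^sub>F h in at_right 0. (z (t + h) - z t) / h < e" by simp
    with eventually_at_right_less[of "0::real"]
    show "\<forall>\<^sub>F h in at_right 0. z (t + h) \<le> z t + e * h"
      by eventually_elim (simp add: field_simps)
  qed
  hence "y T * exp (- 2 * \<Lambda> * T) \<le> y 0" by (simp add: z_def)
  hence "y T * exp (- 2 * \<Lambda> * T) * exp (2 * \<Lambda> * T) \<le> y 0 * exp (2 * \<Lambda> * T)"
    by (intro mult_right_mono) auto
  also have "y T * exp (- 2 * \<Lambda> * T) * exp (2 * \<Lambda> * T) = y T * exp (- 2 * \<Lambda> * T + 2 * \<Lambda> * T)"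
    by (simp only: exp_add mult.assoc)
  also have "\<dots> = y T" by simp
  finally show ?thesis by (simp only: y_def mult.commute)
qed

end

section \<open>The tail bound\<close>

text \<open>Passing to the infimum over the exponents. When the supremum is infinite the bounds force \<open>E \<le> 0\<close>, which
  is why the limiting argument is made separately in that case.\<close>

lemma le_exp_neg_SUP:
  fixes q :: "real \<Rightarrow> real"
  assumes T: "0 < T" and K: "0 \<le> K" and ne: "base \<in> S"
    and le: "\<And>l. l \<in> S \<Longrightarrow> E \<le> K * exp (- (T * q l))"
  shows "ennreal E \<le> ennreal K * exp_ereal (- (ereal T * (SUP l\<in>S. ereal (q l))))"
proof (cases "SUP l\<in>S. ereal (q l)")
  case (real p)
  have "E \<le> K * exp (- (T * (p - e)))" if e: "0 < e" for e
  proof -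
    have "ereal (p - e) < (SUP l\<in>S. ereal (q l))" using e real by simp
    then obtain l where l: "l \<in> S" "p - e < q l" by (auto simp: less_SUP_iff)
    have "T * (p - e) \<le> T * q l" using l(2) T by (intro mult_left_mono) auto
    hence "K * exp (- (T * q l)) \<le> K * exp (- (T * (p - e)))" using K by (intro mult_left_mono) auto
    thus ?thesis using le[OF l(1)] by linarith
  qed
  hence ev: "\<forall>\<^sub>F e in at_right 0. E \<le> K * exp (- (T * (p - e)))"
    using eventually_at_right_less[of "0::real"] by (auto elim: eventually_mono)
  have "((\<lambda>e. K * exp (- (T * (p - e)))) \<longlongrightarrow> K * exp (- (T * (p - 0)))) (at_right 0)"
    by (intro tendsto_intros)
  from tendsto_lowerbound[OF this ev] have "E \<le> K * exp (- (T * p))" by simp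
  hence "ennreal E \<le> ennreal K * ennreal (exp (- (T * p)))"
    using K by (simp add: ennreal_mult[symmetric] ennreal_leI)
  thus ?thesis by (simp add: real)
next
  case PInf
  have "E \<le> K * exp (- (T * n))" for n
  proof -
    have "ereal n < (SUP l\<in>S. ereal (q l))" by (simp add: PInf)
    then obtain l where l: "l \<in> S" "n < q l" by (auto simp: less_SUP_iff)
    have "T * n \<le> T * q l" using l(2) T by (intro mult_left_mono) auto
    hence "K * exp (- (T * q l)) \<le> K * exp (- (T * n))" using K by (intro mult_left_mono) auto
    thus ?thesis using le[OF l(1)] by linarith
  qed
  hence ev: "\<forall>\<^sub>F n in at_top. E \<le> K * exp (- (T * n))" by simp
  have "filterlim (\<lambda>n. T * n) at_top at_top"
    by (rule filterlim_tendsto_pos_mult_at_top[OF tendsto_const T filterlim_ident])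
  hence "((\<lambda>n. exp (- (T * n))) \<longlongrightarrow> 0) at_top"
    by (intro filterlim_compose[OF exp_at_bot] filterlim_compose[OF filterlim_uminus_at_bot_at_top])
  hence "((\<lambda>n. K * exp (- (T * n))) \<longlongrightarrow> K * 0) at_top" by (intro tendsto_mult tendsto_const)
  from tendsto_lowerbound[OF this ev] have "E \<le> 0" by simp
  thus ?thesis by (simp add: ennreal_neg)
next
  case MInf
  have "ereal (q base) \<le> (SUP l\<in>S. ereal (q l))" by (rule SUP_upper[OF ne])
  thus ?thesis using MInf by simp
qed

lemma density_real_density:
  assumes M: "prob_space M" and N: "prob_space N" "sets N = sets M" and ac: "absolutely_continuous M N"
  shows "density M (\<lambda>x. ennreal (real_density M N x)) = N"
proof -
  interpret M: prob_space M by fact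
  interpret N: prob_space N by fact
  have "AE x in M. RN_deriv M N x \<noteq> \<infinity>"
    by (rule M.RN_deriv_finite[OF N.sigma_finite_measure_axioms ac N(2)])
  hence "density M (\<lambda>x. ennreal (real_density M N x)) = density M (RN_deriv M N)"
    by (intro density_cong) (auto simp: real_density_def less_top)
  also have "\<dots> = N" by (rule M.density_RN_deriv[OF ac N(2)])
  finally show ?thesis .
qed

lemma integral_le_density_norm:
  assumes M: "prob_space M" and N: "prob_space N" "sets N = sets M" and ac: "absolutely_continuous M N"
    and D: "real_density M N \<in> l2 M" and u: "u \<in> l2 M"
  shows "(\<integral>x. u x \<partial>N) \<le> l2_norm M (real_density M N) * l2_norm M u"
proof -
  have "(\<integral>x. u x \<partial>N) = (\<integral>x. u x \<partial>density M (\<lambda>x. ennreal (real_density M N x)))"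
    by (simp only: density_real_density[OF M N ac])
  also have "\<dots> = (\<integral>x. real_density M N x * u x \<partial>M)"
    using u D by (subst integral_density) (auto simp: l2_iff real_density_def)
  also have "\<dots> \<le> l2_norm M (real_density M N) * l2_norm M u" by (rule l2_cauchy_schwarz[OF M D u])
  finally show ?thesis .
qed

context cadlag_markov_process
begin

text \<open>The Poincare inequality is available only for centred functions in the domain of the generator.
  Subtracting the mean does not change the generator value, as the semigroup preserves constants, and
  this value has mean zero because the semigroup preserves \<open>\<mu>\<close>.\<close>

lemma feynman_kac_centered_generator:
  assumes inv: "invariant_measure X P mu" and W: "W \<in> borel_measurable borel" and WB: "\<And>y. \<bar>W y\<bar> \<le> B"
    and t: "0 \<le> t"
  defines "g \<equiv> \<lambda>x. feynman_kac W t x - (\<integral>y. feynman_kac W t y \<partial>mu)"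
    and "N \<equiv> \<lambda>x. feynman_kac_deriv W t x - W x * feynman_kac W t x"
  shows "N \<in> l2 mu" "(\<integral>x. N x \<partial>mu) = 0" "g \<in> generator_dom mu sg" "generator mu sg g \<in> l2 mu"
    "AE x in mu. generator mu sg g x = N x"
proof -
  interpret mu: prob_space mu by (rule prob_space_mu[OF inv])
  note [measurable_cong] = sets_mu[OF inv]
  note [measurable] = W feynman_kac_measurable[OF W WB t] feynman_kac_deriv_measurable[OF inv W WB t]
  define a where "a = (\<integral>y. feynman_kac W t y \<partial>mu)"
  define E where "E = exp (B * t)"
  have B0: "0 \<le> B" by (rule B_nonneg[OF inv W WB])
  have uE: "\<bar>feynman_kac W t x\<bar> \<le> E" for x using feynman_kac_bounds[OF W WB t] by (simp add: E_def)
  have E0: "0 \<le> E" by (simp add: E_def)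
  have u2: "feynman_kac W t \<in> l2 mu"
    by (rule l2_bounded[where K=E]) (use uE in \<open>auto simp: mu.finite_measure_axioms\<close>)
  have "\<bar>W x * feynman_kac W t x\<bar> \<le> B * E" for x
    unfolding abs_mult using uE WB B0 by (intro mult_mono) auto
  hence Wu: "(\<lambda>x. W x * feynman_kac W t x) \<in> l2 mu"
    by (intro l2_bounded[where K="B * E"]) (auto simp: mu.finite_measure_axioms)
  have "feynman_kac_deriv W t \<in> l2 mu"
    by (rule l2_bounded[where K="E * B"])
       (use feynman_kac_deriv_bound[OF inv W WB t] in \<open>auto simp: mu.finite_measure_axioms E_def\<close>)
  thus N2: "N \<in> l2 mu" unfolding N_def by (rule l2_diff[OF _ Wu])
  have g_meas: "g \<in> borel_measurable borel" unfolding g_def by measurable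
  have aE: "\<bar>a\<bar> \<le> E" unfolding a_def by (rule abs_integral_prob_le[OF mu.prob_space_axioms uE])
  have gE: "\<bar>g x\<bar> \<le> 2 * E" for x
    using uE[of x] aE unfolding g_def a_def[symmetric] by linarith
  have g2: "g \<in> l2 mu"
    by (rule l2_bounded[where K="2 * E"]) (use gE g_meas in \<open>auto simp: mu.finite_measure_axioms\<close>)
  have sg2: "sg h p \<in> l2 mu"
    if "0 < h" and p: "p \<in> borel_measurable borel" "\<And>x. \<bar>p x\<bar> \<le> K" for h p K
    by (rule l2_bounded[where K=K])
       (use semigroup_measurable[of h p] semigroup_bounded[OF p(2)] p that in \<open>auto simp: mu.finite_measure_axioms\<close>)
  have sg_g: "sg h g x = sg h (feynman_kac W t) x - a" if h: "0 \<le> h" for h x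
  proof -
    interpret Px: prob_space "P x" by (rule prob_space_P)
    note [measurable_cong] = sets_P
    note [measurable] = X_measurable[OF h]
    have "integrable (P x) (\<lambda>w. feynman_kac W t (X h w))"
      by (rule integrable_bounded_finite[where K=E]) (use uE in \<open>auto simp: Px.finite_measure_axioms\<close>)
    thus ?thesis by (simp add: markov_semigroup_def g_def a_def Px.prob_space)
  qed
  have lim: "((\<lambda>h. l2_norm mu (\<lambda>x. (sg h (feynman_kac W t) x - feynman_kac W t x) / h - N x)) \<longlongrightarrow> 0) (at_right 0)"
    using feynman_kac_generator[OF inv W WB t] by (simp add: N_def)
  have "is_generator_value mu sg g N"
    unfolding is_generator_value_def
  proof
    have "\<forall>\<^sub>F h in at_right 0. l2_norm mu (\<lambda>x. (sg h (feynman_kac W t) x - feynman_kac W t x) / h - N x)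
        = l2_norm mu (\<lambda>x. (sg h g x - g x) / h - N x)"
      using eventually_at_right_less[of "0::real"]
      by eventually_elim (simp add: sg_g, simp add: g_def a_def)
    from Lim_transform_eventually[OF lim this]
    show "((\<lambda>h. l2_norm mu (\<lambda>x. (sg h g x - g x) / h - N x)) \<longlongrightarrow> 0) (at_right 0)" .
  qed (rule N2)
  from generator_eq_AE[OF g2 sg2[OF _ g_meas gE] this]
  show "g \<in> generator_dom mu sg" "generator mu sg g \<in> l2 mu" "AE x in mu. generator mu sg g x = N x"
    by auto
  show "(\<integral>x. N x \<partial>mu) = 0"
  proof (rule l2_limit_mean_zero[OF mu.prob_space_axioms N2 _ _ lim])
    fix h :: real assume h: "0 < h"
    note s2 = sg2[OF h feynman_kac_measurable[OF W WB t] uE]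
    show "(\<lambda>x. (sg h (feynman_kac W t) x - feynman_kac W t x) / h) \<in> l2 mu"
      using l2_scale[OF l2_diff[OF s2 u2], of "1 / h"] by simp
    have i: "integrable mu (sg h (feynman_kac W t))" "integrable mu (feynman_kac W t)"
      by (rule integrable_bounded_finite[where K=E];
          use s2 u2 semigroup_bounded[OF uE] uE in \<open>auto simp: mu.finite_measure_axioms l2_iff\<close>)+
    have "(\<integral>x. sg h (feynman_kac W t) x \<partial>mu) = (\<integral>x. feynman_kac W t x \<partial>mu)"
      by (rule semigroup_mean[OF inv W WB _ feynman_kac_measurable[OF W WB t] uE]) (use h in simp)
    thus "(\<integral>x. (sg h (feynman_kac W t) x - feynman_kac W t x) / h \<partial>mu) = 0" using i by simp
  qed
qed

text \<open>The main estimate: the Feynman-Kac function satisfies \<open>u' = N + l V u\<close> with \<open>N\<close> its generator value, so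
  \<open>perturbed_form_le\<close> is the differential inequality that \<open>energy_growth\<close> integrates from \<open>u\<^sub>0 = 1\<close>.\<close>

lemma feynman_kac_l2_norm_le:
  assumes inv: "invariant_measure X P mu" and L2: "equivalent_inner_l2 mu ip c C"
    and V: "V \<in> borel_measurable borel" "\<And>y. \<bar>V y\<bar> \<le> K" and V0: "(\<integral>x. V x \<partial>mu) = 0"
    and D: "D \<in> l2 mu" and adj: "\<And>g. g \<in> l2 mu \<Longrightarrow> ip (\<lambda>x. V x * g x) (\<lambda>_. 1) = ip g D"
    and \<alpha>: "0 < \<alpha>"
    and poincare: "\<And>g. g \<in> generator_dom mu sg \<Longrightarrow> (\<integral>x. g x \<partial>mu) = 0 \<Longrightarrow>
          (ip_norm ip g)\<^sup>2 \<le> \<alpha> * ip (\<lambda>x. - generator mu sg g x) g"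
  defines "v \<equiv> 2 * \<alpha> * (ip_norm ip (\<lambda>x. (V x + D x) / 2))\<^sup>2"
    and "b \<equiv> \<alpha> * max 0 (SUP g\<in>{g \<in> l2 mu. ip_norm ip g = 1}. ip (mult_op V g) g)"
  assumes l: "0 \<le> l" "l * b < 1" and T: "0 \<le> T"
  shows "l2_norm mu (feynman_kac (\<lambda>x. l * V x) T) \<le> 1 / c * exp (T * Psi v b l)"
proof -
  interpret equivalent_inner_l2 mu ip c C by (rule L2)
  interpret mu: prob_space mu by (rule prob_space_mu[OF inv])
  note [measurable_cong] = sets_mu[OF inv]
  define W where "W x = l * V x" for x
  define B where "B = l * K"
  have W: "W \<in> borel_measurable borel" unfolding W_def[abs_def] using V(1) by measurable
  have WB: "\<bar>W y\<bar> \<le> B" for y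
    using V(2)[of y] l by (simp add: W_def B_def abs_mult mult_left_mono)
  have V': "V \<in> borel_measurable mu" using V(1) by measurable
  have u2: "feynman_kac W t \<in> l2 mu" if t: "0 \<le> t" for t
  proof (rule l2_bounded[where K="exp (B * t)"])
    show "feynman_kac W t \<in> borel_measurable mu" using feynman_kac_measurable[OF W WB t] by measurable
  qed (use feynman_kac_bounds[OF W WB t] in \<open>auto simp: mu.finite_measure_axioms\<close>)
  have u'2: "feynman_kac_deriv W t \<in> l2 mu" if t: "0 \<le> t" for t
  proof (rule l2_bounded[where K="exp (B * t) * B"])
    show "feynman_kac_deriv W t \<in> borel_measurable mu" using feynman_kac_deriv_measurable[OF inv W WB t] by measurable
  qed (use feynman_kac_deriv_bound[OF inv W WB t] in \<open>auto simp: mu.finite_measure_axioms\<close>)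
  have diss: "ip (feynman_kac_deriv W t) (feynman_kac W t) \<le> Psi v b l * ip (feynman_kac W t) (feynman_kac W t)" if t: "0 \<le> t" for t
  proof -
    let ?N = "\<lambda>x. feynman_kac_deriv W t x - W x * feynman_kac W t x"
    let ?g = "\<lambda>x. feynman_kac W t x - (\<integral>y. feynman_kac W t y \<partial>mu)"
    note G = feynman_kac_centered_generator[OF inv W WB t]
    have g2: "?g \<in> l2 mu" by (rule l2_diff[OF u2[OF t] const_l2])
    have "integrable mu (feynman_kac W t)" using l2_prod_integrable[OF u2[OF t] const_l2[of 1]] by simp
    hence "(\<integral>x. ?g x \<partial>mu) = 0" by (simp add: mu.prob_space)
    from poincare[OF G(3) this]
    have "(nrm ?g)\<^sup>2 \<le> \<alpha> * ip (\<lambda>x. - generator mu sg ?g x) ?g" .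
    also have "ip (\<lambda>x. - generator mu sg ?g x) ?g = ip (\<lambda>x. - ?N x) ?g"
      by (rule ip_cong[OF l2_uminus[OF G(4)] l2_uminus[OF G(1)] g2]) (use G(5) in auto)
    finally have gap: "(nrm ?g)\<^sup>2 \<le> \<alpha> * ip (\<lambda>x. - ?N x) ?g" .
    have "ip (\<lambda>x. ?N x + l * (V x * feynman_kac W t x)) (feynman_kac W t) \<le> Psi v b l * ip (feynman_kac W t) (feynman_kac W t)"
      unfolding v_def b_def
      by (rule perturbed_form_le[OF u2[OF t] G(1) V' V(2) V0 G(2) D adj \<alpha> gap mult_form_le_SUP[OF V' V(2)] l(1) l(2)[unfolded b_def]])
    moreover have "(\<lambda>x. ?N x + l * (V x * feynman_kac W t x)) = feynman_kac_deriv W t"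
      by (simp add: fun_eq_iff W_def)
    ultimately show ?thesis by simp
  qed
  have B0: "0 \<le> B" by (rule B_nonneg[OF inv W WB])
  have growth: "ip (feynman_kac W T) (feynman_kac W T) \<le> exp (2 * Psi v b l * T) * ip (feynman_kac W 0) (feynman_kac W 0)"
  proof (rule energy_growth[where u'="feynman_kac_deriv W" and K="exp (B * T)" and L="exp (B * T) * B * exp (B * T)"])
    fix t x assume t: "0 \<le> t" "t \<le> T"
    have "\<bar>feynman_kac W t x\<bar> \<le> exp (B * t)" using feynman_kac_bounds[OF W WB t(1)] by simp
    also have "\<dots> \<le> exp (B * T)" using t B0 by (auto intro!: mult_left_mono)
    finally show "\<bar>feynman_kac W t x\<bar> \<le> exp (B * T)" .
  qed (use T u2 u'2 diss feynman_kac_right_derivative[OF inv W WB] feynman_kac_lipschitz[OF inv W WB] in auto)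
  have "feynman_kac W 0 = (\<lambda>_. 1)"
  proof
    fix x
    interpret Px: prob_space "P x" by (rule prob_space_P)
    have "feynman_kac W 0 x = (\<integral>w. 1 \<partial>P x)"
      unfolding feynman_kac_def[OF W WB]
    proof (rule Bochner_Integration.integral_cong[OF refl])
      fix w assume "w \<in> space (P x)"
      thus "exp (path_integral W 0 0 w) = 1" using abs_path_integral_le[OF W WB, of 0 0 w] by (simp add: space_P)
    qed
    thus "feynman_kac W 0 x = 1" by (simp add: Px.prob_space)
  qed
  hence "(nrm (feynman_kac W T))\<^sup>2 \<le> (exp (T * Psi v b l))\<^sup>2"
    using growth one_one(1) nrm_sq[OF u2[OF T]] by (simp add: exp_double[symmetric] ac_simps)
  hence "nrm (feynman_kac W T) \<le> exp (T * Psi v b l)" by (rule power2_le_imp_le) simp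
  hence "c * l2_norm mu (feynman_kac W T) \<le> exp (T * Psi v b l)" using lower[OF u2[OF T]] by simp
  thus ?thesis using c unfolding W_def[abs_def] by (simp add: field_simps)
qed

end

theorem theorem3p1:
  fixes Om :: "'w measure"
    and F :: "real \<Rightarrow> 'w measure"
    and X :: "real \<Rightarrow> 'w \<Rightarrow> 'x::polish_space"
    and P :: "'x \<Rightarrow> 'w measure"
    and mu_star mu :: "'x measure"
    and ip :: "('x \<Rightarrow> real) \<Rightarrow> ('x \<Rightarrow> real) \<Rightarrow> real"
    and c C \<alpha> T r sgm v b :: real
    and f fhat :: "'x \<Rightarrow> real"
    and Mdag :: "('x \<Rightarrow> real) \<Rightarrow> 'x \<Rightarrow> real"
  assumes process: "cadlag_markov_process Om F X P"
    and invariant: "invariant_measure X P mu_star"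
    and ergodic: "ergodic_measure X P mu_star"
    and init_prob: "prob_space mu" "sets mu = sets borel"
    and init_ac: "absolutely_continuous mu_star mu"
    and init_l2: "real_density mu_star mu \<in> l2 mu_star"
    and ip: "inner_product_on_l2 mu_star ip"
    and c_C: "0 < c" "c \<le> C"
    and norm_equiv: "\<forall>g\<in>l2 mu_star.
          c * l2_norm mu_star g \<le> ip_norm ip g \<and> ip_norm ip g \<le> C * l2_norm mu_star g"
    and ip_one: "\<forall>g\<in>l2 mu_star. ip g (\<lambda>_. 1) = l2_inner mu_star g (\<lambda>_. 1)"
    and alpha_pos: "0 < \<alpha>"
    and poincare: "\<forall>g\<in>generator_dom mu_star (markov_semigroup X P). (\<integral>x. g x \<partial>mu_star) = 0 \<longrightarrow>
          (ip_norm ip g)\<^sup>2 \<le> \<alpha> * ip (\<lambda>x. - generator mu_star (markov_semigroup X P) g x) g"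
    and f_meas: "f \<in> borel_measurable borel"
    and f_bounded: "bounded (range f)"
    and fhat: "fhat = (\<lambda>x. f x - (\<integral>y. f y \<partial>mu_star))"
    and sign: "sgm = 1 \<or> sgm = - 1"
    and adjoint: "is_adjoint mu_star ip (mult_op (\<lambda>x. sgm * fhat x)) Mdag"
    and v: "v = 2 * \<alpha> *
          (ip_norm ip (\<lambda>x. (mult_op (\<lambda>x. sgm * fhat x) (\<lambda>_. 1) x + Mdag (\<lambda>_. 1) x) / 2))\<^sup>2"
    and b: "b = \<alpha> * max 0
          (SUP g\<in>{g \<in> l2 mu_star. ip_norm ip g = 1}. ip (mult_op (\<lambda>x. sgm * fhat x) g) g)"
    and T: "0 < T" and r: "0 \<le> r"
  shows "emeasure (mu \<bind> P)
           {\<omega> \<in> space Om. r \<le> sgm * ((1 / T) * (LINT t:{0..T}|lborel. f (X t \<omega>)) - (\<integral>x. f x \<partial>mu_star))}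
         \<le> ennreal (1 / c * l2_norm mu_star (real_density mu_star mu))
             * exp_ereal (- (ereal T * Psi_star v b r))"
proof -
  interpret cadlag_markov_process Om F X P by (rule process)
  have mu_star: "prob_space mu_star" "sets mu_star = sets borel"
    using invariant by (auto simp: invariant_measure_def)
  interpret ms: prob_space mu_star by (rule mu_star)
  interpret L: equivalent_inner_l2 mu_star ip c C
    by unfold_locales (use ip norm_equiv ip_one c_C in auto)
  interpret Pm: prob_space "mu \<bind> P" by (rule prob_space_mixture[OF init_prob])
  define m where "m = (\<integral>x. f x \<partial>mu_star)"
  define V where "V x = sgm * fhat x" for x
  obtain Kf where Kf: "\<And>x. \<bar>f x\<bar> \<le> Kf" using f_bounded by (auto simp: bounded_iff)
  have m_le: "\<bar>m\<bar> \<le> Kf" unfolding m_def by (rule abs_integral_prob_le[OF mu_star(1) Kf])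
  have V_eq: "V x = sgm * (f x - m)" for x by (simp add: V_def fhat m_def)
  have V_meas: "V \<in> borel_measurable borel" unfolding V_eq[abs_def] using f_meas by measurable
  have V_le: "\<bar>V x\<bar> \<le> 2 * Kf" for x
    using Kf[of x] m_le sign unfolding V_eq by (auto simp: abs_mult)
  have f_int: "integrable mu_star f"
    by (rule integrable_bounded_finite[where K=Kf])
       (use Kf f_meas mu_star(2) in \<open>auto simp: ms.finite_measure_axioms cong: measurable_cong_sets\<close>)
  have V0: "(\<integral>x. V x \<partial>mu_star) = 0"
    unfolding V_eq using f_int by (simp add: m_def ms.prob_space)
  define D where "D = Mdag (\<lambda>_. 1)"
  have D: "D \<in> l2 mu_star" and adj: "\<And>g. g \<in> l2 mu_star \<Longrightarrow> ip (\<lambda>x. V x * g x) (\<lambda>_. 1) = ip g D"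
    using adjoint L.const_l2[of 1] by (auto simp: is_adjoint_def D_def mult_op_def V_def[abs_def])
  have v': "v = 2 * \<alpha> * (ip_norm ip (\<lambda>x. (V x + D x) / 2))\<^sup>2"
    unfolding v by (simp add: mult_op_def D_def V_def)
  have b': "b = \<alpha> * max 0 (SUP g\<in>{g \<in> l2 mu_star. ip_norm ip g = 1}. ip (mult_op V g) g)"
    unfolding b V_def[abs_def] ..
  have b0: "0 \<le> b" unfolding b' using alpha_pos by simp
  define A where "A = {w \<in> space Om. r \<le> sgm * ((1 / T) * (LINT t:{0..T}|lborel. f (X t w)) - (\<integral>x. f x \<partial>mu_star))}"
  have A_sets: "A \<in> sets (mu \<bind> P)"
  proof -
    note [measurable] = path_integral_measurable[OF f_meas Kf order_refl less_imp_le[OF T]]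
    have "A = {w \<in> space Om. r \<le> sgm * ((1 / T) * path_integral f 0 T w - m)}"
      by (simp add: A_def path_integral_def m_def)
    also have "\<dots> \<in> sets Om" by measurable
    finally show ?thesis by (simp add: prob_space_mixture[OF init_prob])
  qed
  have chernoff: "measure (mu \<bind> P) A
      \<le> 1 / c * l2_norm mu_star (real_density mu_star mu) * exp (- (T * (l * r - Psi v b l)))"
    if l: "0 \<le> l" "l * b < 1" for l
  proof -
    define W where "W x = l * V x" for x
    have W: "W \<in> borel_measurable borel" unfolding W_def[abs_def] using V_meas by measurable
    have WB: "\<bar>W y\<bar> \<le> l * (2 * Kf)" for y
      using V_le[of y] l by (simp add: W_def abs_mult mult_left_mono)
    have T0: "0 \<le> T" using T by simp
    note [measurable] = path_integral_measurable[OF W WB order_refl T0]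
    note [measurable_cong] = prob_space_mixture(2)[OF init_prob]
    have exp_le: "exp (path_integral W 0 T w) \<le> exp (l * (2 * Kf) * T)" if "w \<in> space Om" for w
      using exp_path_integral_le[OF W WB order_refl T0 that] by simp
    have int: "integrable (mu \<bind> P) (\<lambda>w. exp (path_integral W 0 T w))"
      by (rule integrable_bounded_finite[where K="exp (l * (2 * Kf) * T)"])
         (use exp_le in \<open>auto simp: Pm.finite_measure_axioms prob_space_mixture[OF init_prob]\<close>)
    have "measure (mu \<bind> P) A = (\<integral>w. indicator A w \<partial>(mu \<bind> P))" using A_sets by simp
    also have "\<dots> \<le> (\<integral>w. exp (- (T * (l * r))) * exp (path_integral W 0 T w) \<partial>(mu \<bind> P))"
    proof (rule integral_mono)
      show "integrable (mu \<bind> P) (indicator A :: 'w \<Rightarrow> real)"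
        using A_sets by (simp add: integrable_indicator_iff Pm.emeasure_eq_measure)
      show "integrable (mu \<bind> P) (\<lambda>w. exp (- (T * (l * r))) * exp (path_integral W 0 T w))" using int by simp
      fix w assume "w \<in> space (mu \<bind> P)"
      hence w: "w \<in> space Om" by (simp add: prob_space_mixture[OF init_prob])
      show "indicator A w \<le> exp (- (T * (l * r))) * exp (path_integral W 0 T w)"
      proof (cases "w \<in> A")
        case True
        have fi: "set_integrable lborel {0..T} (\<lambda>s. f (X s w))"
          by (rule path_set_integrable[OF f_meas Kf order_refl w])
        have ci: "set_integrable lborel {0..T} (\<lambda>s. m)"
          by (rule set_integrable_if_bounded[where B="\<bar>m\<bar>"]) auto
        have "path_integral W 0 T w = (LINT s:{0..T}|lborel. l * (sgm * (f (X s w) - m)))"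
          by (simp add: path_integral_def W_def V_eq)
        also have "\<dots> = l * (sgm * ((LINT s:{0..T}|lborel. f (X s w)) - (LINT s:{0..T}|lborel. m)))"
          by (simp add: set_integral_diff(2)[OF fi ci])
        also have "(LINT s:{0..T}|lborel. m) = T * m" using T by (simp add: set_lebesgue_integral_def)
        finally have scaled: "path_integral W 0 T w = l * (sgm * ((LINT s:{0..T}|lborel. f (X s w)) - T * m))" .
        \<comment> \<open>so on \<open>A\<close> the path integral is at least \<open>T l r\<close>\<close>
        have "path_integral W 0 T w = T * (l * (sgm * ((1 / T) * (LINT s:{0..T}|lborel. f (X s w)) - m)))"
        proof -
          have "J - T * m = T * ((1 / T) * J - m)" for J using T by (simp add: right_diff_distrib)
          thus ?thesis unfolding scaled by (simp only: mult.left_commute)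
        qed
        moreover have "T * (l * r) \<le> T * (l * (sgm * ((1 / T) * (LINT s:{0..T}|lborel. f (X s w)) - m)))"
          using True T l by (intro mult_left_mono) (auto simp: A_def m_def)
        ultimately have "0 \<le> - (T * (l * r)) + path_integral W 0 T w" by linarith
        hence "1 \<le> exp (- (T * (l * r)) + path_integral W 0 T w)" by simp
        hence "1 \<le> exp (- (T * (l * r))) * exp (path_integral W 0 T w)" by (simp only: exp_add)
        thus ?thesis using True by simp
      qed simp
    qed
    also have "\<dots> = exp (- (T * (l * r))) * (\<integral>w. exp (path_integral W 0 T w) \<partial>(mu \<bind> P))" by simp
    also have "(\<integral>w. exp (path_integral W 0 T w) \<partial>(mu \<bind> P)) = (\<integral>x. feynman_kac W T x \<partial>mu)"
      unfolding feynman_kac_def[OF W WB]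
      by (rule integral_mixture[OF init_prob, where K="exp (l * (2 * Kf) * T)"]) (use exp_le in auto)
    also have "exp (- (T * (l * r))) * (\<integral>x. feynman_kac W T x \<partial>mu) \<le> exp (- (T * (l * r))) *
       (l2_norm mu_star (real_density mu_star mu) * (1 / c * exp (T * Psi v b l)))"
    proof (rule mult_left_mono)
      have u2: "feynman_kac W T \<in> l2 mu_star"
        by (rule l2_bounded[where K="exp (l * (2 * Kf) * T)"])
           (use feynman_kac_bounds[OF W WB T0] feynman_kac_measurable[OF W WB T0] mu_star(2) in
             \<open>auto simp: ms.finite_measure_axioms cong: measurable_cong_sets\<close>)
      have "(\<integral>x. feynman_kac W T x \<partial>mu) \<le> l2_norm mu_star (real_density mu_star mu) * l2_norm mu_star (feynman_kac W T)"
        by (rule integral_le_density_norm[OF mu_star(1) init_prob(1) _ init_ac init_l2 u2])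
           (simp add: init_prob mu_star)
      also have "l2_norm mu_star (feynman_kac W T) \<le> 1 / c * exp (T * Psi v b l)"
        unfolding v' b' W_def[abs_def]
        by (rule feynman_kac_l2_norm_le[OF invariant L.equivalent_inner_l2_axioms V_meas V_le V0 D adj alpha_pos
              _ l(1) l(2)[unfolded b'] T0])
           (use poincare in auto)
      finally show "(\<integral>x. feynman_kac W T x \<partial>mu) \<le> l2_norm mu_star (real_density mu_star mu) * (1 / c * exp (T * Psi v b l))"
        by (simp add: mult_left_mono l2_norm_nonneg)
    qed simp
    also have "\<dots> = 1 / c * l2_norm mu_star (real_density mu_star mu) * (exp (- (T * (l * r))) * exp (T * Psi v b l))"
      by simp
    also have "exp (- (T * (l * r))) * exp (T * Psi v b l) = exp (- (T * (l * r - Psi v b l)))"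
      by (simp add: exp_add[symmetric] algebra_simps)
    finally show ?thesis .
  qed
  have "ennreal (measure (mu \<bind> P) A) \<le> ennreal (1 / c * l2_norm mu_star (real_density mu_star mu))
      * exp_ereal (- (ereal T * (SUP l\<in>{l. 0 \<le> l \<and> (b = 0 \<or> l < 1 / b)}. ereal (l * r - Psi v b l))))"
  proof (rule le_exp_neg_SUP[where base=0])
    show "0 \<le> 1 / c * l2_norm mu_star (real_density mu_star mu)" using c_C by (simp add: l2_norm_nonneg)
    show "0 \<in> {l. 0 \<le> l \<and> (b = 0 \<or> l < 1 / b)}" using b0 by auto
    fix l assume "l \<in> {l. 0 \<le> l \<and> (b = 0 \<or> l < 1 / b)}"
    hence l: "0 \<le> l" "b = 0 \<or> l < 1 / b" by auto
    have "l * b < 1"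
    proof (cases "b = 0")
      case False
      hence "0 < b" using b0 by simp
      thus ?thesis using l(2) by (simp add: pos_less_divide_eq)
    qed simp
    with l(1) show "measure (mu \<bind> P) A
      \<le> 1 / c * l2_norm mu_star (real_density mu_star mu) * exp (- (T * (l * r - Psi v b l)))"
      by (rule chernoff)
  qed (rule T)
  thus ?thesis unfolding Psi_star_def A_def[symmetric] Pm.emeasure_eq_measure .
qed

end
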